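(* Let $K$ be a number field of signature $(r,s)$ (that is, with $r$ real embeddings and $s$ pairs of complex conjugate non-real embeddings) and degree $n=r+2s\geq 4$, and let $d_K$ be the absolute value of the discriminant of $K$. Then the Euclidean minimum $M(K)$ of $K$ satisfies $$M(K)\leq 2^{\frac{-sn}{r+s}}\cdot \left(\tfrac12\sqrt n\right)^n\cdot d_K^{\frac{n}{2(r+s)}}.$$
   Context: For a number field $K$ with ring of integers $\mathcal{O}_K$, let $N:K\to\mathbb{Q}$ be the absolute value of the norm map $N_{K/\mathbb{Q}}$. The Euclidean minimum of $K$ is the real number $M(K):=\sup_{x\in K}\inf_{c\in\mathcal{O}_K}N(x-c)$. *)

theory Defs
  imports
    Complex_Main
    "HOL-Computational_Algebra.Polynomial"
    "HOL-Library.Extended_Real"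
    "Jordan_Normal_Form.Determinant"
begin

global_interpretation rat_vs: Vector_Spaces.vector_space
    "\<lambda>(q::rat) (x::'k::field_char_0). of_rat q * x"
  defines rat_span = rat_vs.span
    and rat_dependent = rat_vs.dependent
    and rat_dim = rat_vs.dim
    and rat_coord = rat_vs.representation
  by unfold_locales (simp_all add: algebra_simps of_rat_add of_rat_mult)

definition number_field :: "'k::field_char_0 itself \<Rightarrow> bool" where
  "number_field _ \<longleftrightarrow> (\<exists>B::'k set. finite B \<and> rat_span B = UNIV)"

definition field_degree :: "'k::field_char_0 itself \<Rightarrow> nat" where
  "field_degree _ = rat_dim (UNIV :: 'k set)"

definition ring_of_integers :: "'k::field_char_0 set" where
  "ring_of_integers = {x. algebraic_int x}"

text \<open>Norm and trace are the determinant and the trace of the \<open>\<rat>\<close>-linear map \<open>y \<mapsto> x * y\<close>,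
  computed in an arbitrarily chosen basis, on which they do not depend.\<close>

definition is_rat_basis :: "'k::field_char_0 list \<Rightarrow> bool" where
  "is_rat_basis bs \<longleftrightarrow> distinct bs \<and> \<not> rat_dependent (set bs) \<and> rat_span (set bs) = UNIV"

definition mult_matrix :: "'k::field_char_0 list \<Rightarrow> 'k \<Rightarrow> rat mat" where
  "mult_matrix bs x =
     mat (length bs) (length bs) (\<lambda>(i, j). rat_coord (set bs) (x * bs ! j) (bs ! i))"

definition field_norm :: "'k::field_char_0 \<Rightarrow> rat" where
  "field_norm x = det (mult_matrix (SOME bs. is_rat_basis bs) x)"

definition field_trace :: "'k::field_char_0 \<Rightarrow> rat" where
  "field_trace x =
     (let A = mult_matrix (SOME bs. is_rat_basis bs) x in \<Sum>i<dim_row A. A $$ (i, i))"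

definition abs_norm :: "'k::field_char_0 \<Rightarrow> rat" where
  "abs_norm x = \<bar>field_norm x\<bar>"

definition is_integral_basis :: "'k::field_char_0 list \<Rightarrow> bool" where
  "is_integral_basis bs \<longleftrightarrow> set bs \<subseteq> ring_of_integers \<and>
     (\<forall>x\<in>ring_of_integers. \<exists>!c::int list. length c = length bs \<and>
        x = (\<Sum>i<length bs. of_int (c ! i) * bs ! i))"

definition trace_form_matrix :: "'k::field_char_0 list \<Rightarrow> rat mat" where
  "trace_form_matrix bs =
     mat (length bs) (length bs) (\<lambda>(i, j). field_trace (bs ! i * bs ! j))"

definition field_discriminant :: "'k::field_char_0 itself \<Rightarrow> rat" where
  "field_discriminant _ = det (trace_form_matrix (SOME bs :: 'k list. is_integral_basis bs))"

definition complex_embeddings :: "('k::field_char_0 \<Rightarrow> complex) set" where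
  "complex_embeddings = {\<sigma>. \<sigma> 1 = 1 \<and> (\<forall>x y. \<sigma> (x + y) = \<sigma> x + \<sigma> y) \<and>
                            (\<forall>x y. \<sigma> (x * y) = \<sigma> x * \<sigma> y)}"

definition real_embeddings :: "('k::field_char_0 \<Rightarrow> complex) set" where
  "real_embeddings = {\<sigma> \<in> complex_embeddings. range \<sigma> \<subseteq> \<real>}"

definition conjugate_embedding_pairs :: "('k::field_char_0 \<Rightarrow> complex) set set" where
  "conjugate_embedding_pairs = {{\<sigma>, cnj \<circ> \<sigma>} | \<sigma>. \<sigma> \<in> complex_embeddings - real_embeddings}"

definition has_signature :: "'k::field_char_0 itself \<Rightarrow> nat \<Rightarrow> nat \<Rightarrow> bool" where
  "has_signature _ r s \<longleftrightarrow>
     card (real_embeddings :: ('k \<Rightarrow> complex) set) = r \<and>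
     card (conjugate_embedding_pairs :: ('k \<Rightarrow> complex) set set) = s"

text \<open>Taking values in \<^typ>\<open>ereal\<close> makes the supremum meaningful without knowing beforehand that it
  is finite; a real upper bound for it then includes its finiteness.\<close>

definition euclidean_minimum :: "'k::field_char_0 itself \<Rightarrow> ereal" where
  "euclidean_minimum _ =
     (SUP x::'k. INF c\<in>ring_of_integers. ereal (real_of_rat (abs_norm (x - c))))"

end

theory Submission
  imports Defs "HOL-Analysis.Analysis" "HOL-Algebra.Algebraic_Closure_Type"
    "Jordan_Normal_Form.Char_Poly"
begin

text \<open>Let \<open>y = x - c\<close> have minimal norm \<open>M\<close> in the class of \<open>x\<close> modulo the ring of integers, and
  consider the lattice of all \<open>\<lambda> = a / y\<close> with \<open>a\<close> integral. Minimality says that \<open>N (1 + \<lambda>) \<ge> 1\<close> for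
  every \<open>\<lambda>\<close>, hence \<open>N (1 - \<lambda>\<^sup>2) \<ge> 1\<close>, as in Chebotarev's work on Minkowski's conjecture; moreover
  \<open>N (\<lambda>) \<ge> 1 / M\<close> for \<open>\<lambda> \<noteq> 0\<close>. If \<open>M\<close> exceeds the bound, then the covolume is so small that Minkowski's
  theorem on linear forms yields a \<open>\<lambda> \<noteq> 0\<close> whose conjugates have real parts of size about \<open>1\<close> and very
  small imaginary parts. By the inequality of the means the sum of the \<open>\<bar>\<sigma> \<lambda>\<bar>\<^sup>2\<close> outweighs the
  imaginary parts, so that \<open>N (1 - \<lambda>\<^sup>2) < 1\<close>, a contradiction.

  In degrees up to 24 this needs a lower bound for \<open>M\<close>. It comes from a second, cruder estimate:
  reducing the dual lattice, the codifferent, bounds the covering radius of the ring of integers,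
  and so \<open>M\<close> by a constant multiple of the discriminant. For totally complex fields of degree at most 24
  this estimate is itself stronger than the claim.\<close>

hide_const (open) up_ring.monom up_ring.coeff Polynomials.degree Polynomials.lead_coeff
  Finite_Cartesian_Product.mat Finite_Cartesian_Product.vec Determinants.det

section \<open>Primitive elements\<close>

text \<open>Let h be the positive number with h^n = 1/M^2, and take the box of squared real parts
  below A and squared imaginary parts below \<beta>. With \<rho> = |\<sigma> \<lambda>|^2 one has |1
  - \<lambda>^2|^2 = 1 - 2 \<rho> + \<rho>^2 + 4 Im^2, where Im is the imaginary part of \<sigma>
  \<lambda>. As the \<rho> sum to at least n h, the imaginary parts may cost n h in all, so \<beta>
  = n h / (8 s) at best, provided 2 \<rho> - \<rho>^2 \<ge> \<rho>, that is \<rho> \<le> 1. The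
  obstacle: in small degrees the box with A + \<beta> \<le> 1 is too small for Minkowski's theorem;
  in degree 4 with s = 1 the volume condition already reads A^3 \<ge> 2. So \<rho> is allowed to
  exceed 1: a single such conjugate contributes at least A' (2 - A'), where A' = A + \<beta>, and
  this suffices once n h is small, which is what a lower bound for M provides. The reduction of the
  dual lattice costs a factor 4/3 per dimension; the resulting number 12 ((4/3)^n - 1) / n^3 stays
  below 1 up to degree 24 and exceeds it at 25, from where on A = 4/5 and \<beta> = h/5
  work.\<close>

abbreviation rat_eval :: "rat poly \<Rightarrow> 'a::field_char_0 \<Rightarrow> 'a" where
  "rat_eval p x \<equiv> poly (map_poly of_rat p) x"

lemma map_poly_of_rat_add:
  "map_poly of_rat (p + q) = (map_poly of_rat p + map_poly of_rat q :: 'a::field_char_0 poly)"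
  by (rule poly_eqI) (simp add: coeff_map_poly of_rat_add)

lemma map_poly_of_rat_diff:
  "map_poly of_rat (p - q) = (map_poly of_rat p - map_poly of_rat q :: 'a::field_char_0 poly)"
  by (rule poly_eqI) (simp add: coeff_map_poly of_rat_diff)

lemma map_poly_of_rat_mult:
  "map_poly of_rat (p * q) = (map_poly of_rat p * map_poly of_rat q :: 'a::field_char_0 poly)"
  by (rule poly_eqI) (simp add: coeff_map_poly coeff_mult of_rat_sum of_rat_mult)

lemma map_poly_of_rat_pderiv:
  "map_poly of_rat (pderiv p) = (pderiv (map_poly of_rat p) :: 'a::field_char_0 poly)"
  by (rule poly_eqI) (simp add: coeff_map_poly coeff_pderiv of_rat_mult of_rat_add)

lemma rat_eval_add: "rat_eval (p + q) x = rat_eval p x + rat_eval q x"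
  by (simp add: map_poly_of_rat_add)

lemma rat_eval_diff: "rat_eval (p - q) x = rat_eval p x - rat_eval q x"
  by (simp add: map_poly_of_rat_diff)

lemma rat_eval_mult: "rat_eval (p * q) x = rat_eval p x * rat_eval q x"
  by (simp add: map_poly_of_rat_mult)

lemma rat_eval_monom: "rat_eval (monom c i) x = of_rat c * x ^ i"
  by (simp add: map_poly_monom poly_monom)

lemma rat_eval_pCons: "rat_eval (pCons c p) x = of_rat c + x * rat_eval p x"
  by (cases "c = 0 \<and> p = 0") (auto simp: map_poly_pCons)

lemma rat_eval_sum: "rat_eval (\<Sum>i\<in>I. f i) x = (\<Sum>i\<in>I. rat_eval (f i) x)"
  by (induction I rule: infinite_finite_induct) (simp_all add: rat_eval_add)

lemma rat_eval_pcompose: "rat_eval (pcompose p q) x = rat_eval p (rat_eval q x)"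
  by (induction p) (simp_all add: pcompose_pCons rat_eval_add rat_eval_mult rat_eval_pCons)

lemma finite_rat_eval_roots:
  assumes "p \<noteq> 0"
  shows "finite {x::'a::field_char_0. rat_eval p x = 0}"
  using assms by (intro poly_roots_finite) (auto simp: map_poly_eq_0_iff)

text \<open>Least degree in place of irreducibility, and no normalisation: existence is then the
  well-ordering of degrees, and divisibility is division with remainder.\<close>

definition is_min_poly :: "rat poly \<Rightarrow> 'a::field_char_0 \<Rightarrow> bool" where
  "is_min_poly p x \<longleftrightarrow> p \<noteq> 0 \<and> rat_eval p x = 0 \<and>
     (\<forall>q. q \<noteq> 0 \<longrightarrow> rat_eval q x = 0 \<longrightarrow> degree p \<le> degree q)"

lemma is_min_poly_exists:
  assumes "q \<noteq> 0" "rat_eval q x = 0"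
  obtains p where "is_min_poly p x"
proof -
  have "\<exists>p. (p \<noteq> 0 \<and> rat_eval p x = 0) \<and> (\<forall>q. q \<noteq> 0 \<and> rat_eval q x = 0 \<longrightarrow> degree p \<le> degree q)"
    using assms by (intro ex_has_least_nat[where k = q]) auto
  then show ?thesis using that unfolding is_min_poly_def by blast
qed

lemma is_min_poly_dvd:
  assumes "is_min_poly p x" "rat_eval q x = 0"
  shows "p dvd q"
proof (rule ccontr)
  assume "\<not> p dvd q"
  then have ne: "q mod p \<noteq> 0" by (simp add: mod_eq_0_iff_dvd)
  have "rat_eval (q div p * p + q mod p) x = 0" using assms(2) by simp
  then have "rat_eval (q mod p) x = 0"
    using assms(1) unfolding rat_eval_add rat_eval_mult by (simp add: is_min_poly_def)
  moreover have "degree (q mod p) < degree p"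
    using ne assms(1) by (intro degree_mod_less') (auto simp: is_min_poly_def)
  ultimately show False using assms(1) ne unfolding is_min_poly_def by force
qed

lemma is_min_poly_degree_pos:
  assumes "is_min_poly p x"
  shows "degree p > 0"
proof (rule ccontr)
  assume "\<not> degree p > 0"
  then obtain c where "p = [:c:]" by (metis degree_eq_zeroE gr0I)
  then show False using assms by (auto simp: is_min_poly_def rat_eval_pCons)
qed

text \<open>Irreducibility in disguise: a minimal polynomial \<open>q\<close> of \<open>y\<close>
  divides \<open>p\<close>, and \<open>x\<close> cannot be a root of the cofactor, whose degree is
  too small. So \<open>x\<close> is a root of \<open>q\<close>, and \<open>q\<close> has the degree
  of \<open>p\<close>.\<close>

lemma is_min_poly_transfer:
  assumes "is_min_poly p x" "rat_eval p y = 0"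
  shows "is_min_poly p y"
proof -
  obtain q where q: "is_min_poly q y"
    using assms is_min_poly_exists unfolding is_min_poly_def by metis
  obtain w where w: "p = q * w" using is_min_poly_dvd[OF q assms(2)] by (auto simp: dvd_def)
  have ne: "p \<noteq> 0" "q \<noteq> 0" "w \<noteq> 0" using w assms(1) by (auto simp: is_min_poly_def)
  have deg: "degree p = degree q + degree w" using w ne by (simp add: degree_mult_eq)
  have "rat_eval q x = 0 \<or> rat_eval w x = 0"
    using assms(1) w by (auto simp: is_min_poly_def rat_eval_mult)
  moreover have "rat_eval w x \<noteq> 0"
    using assms(1) ne deg is_min_poly_degree_pos[OF q] unfolding is_min_poly_def by force
  ultimately have "degree p \<le> degree q" using assms(1) ne unfolding is_min_poly_def by blast
  then show ?thesis using q assms(2) ne unfolding is_min_poly_def by (meson order_trans)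
qed

lemma is_min_poly_simple_root:
  assumes "is_min_poly p x"
  shows "rat_eval (pderiv p) x \<noteq> 0"
proof
  assume *: "rat_eval (pderiv p) x = 0"
  have "pderiv p \<noteq> 0" using is_min_poly_degree_pos[OF assms] by (simp add: pderiv_eq_0_iff)
  then have "degree p \<le> degree (pderiv p)" using assms * by (simp add: is_min_poly_def)
  then show False using is_min_poly_degree_pos[OF assms] by (simp add: degree_pderiv)
qed

text \<open>The ring generated by \<open>z\<close> over the rationals; for algebraic
  \<open>z\<close> it is already a field, see \<open>inverse_in_adjoin\<close>.\<close>

definition adjoin :: "'a::field_char_0 \<Rightarrow> 'a set" where
  "adjoin z = range (\<lambda>p. rat_eval p z)"

lemma adjoin_of_rat: "of_rat c \<in> adjoin z"
  unfolding adjoin_def by (rule range_eqI[of _ _ "[:c:]"]) (simp add: rat_eval_pCons)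

lemma adjoin_self: "z \<in> adjoin z"
  unfolding adjoin_def by (rule range_eqI[of _ _ "[:0, 1:]"]) (simp add: rat_eval_pCons)

lemma adjoin_add: "a \<in> adjoin z \<Longrightarrow> b \<in> adjoin z \<Longrightarrow> a + b \<in> adjoin z"
  unfolding adjoin_def by (auto simp flip: rat_eval_add)

lemma adjoin_diff: "a \<in> adjoin z \<Longrightarrow> b \<in> adjoin z \<Longrightarrow> a - b \<in> adjoin z"
  unfolding adjoin_def by (auto simp flip: rat_eval_diff)

lemma adjoin_mult: "a \<in> adjoin z \<Longrightarrow> b \<in> adjoin z \<Longrightarrow> a * b \<in> adjoin z"
  unfolding adjoin_def by (auto simp flip: rat_eval_mult)

lemma adjoin_0 [simp]: "0 \<in> adjoin z"
  using adjoin_of_rat[of 0 z] by simp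

lemma adjoin_sum: "(\<And>i. i \<in> I \<Longrightarrow> f i \<in> adjoin z) \<Longrightarrow> sum f I \<in> adjoin z"
  by (induction I rule: infinite_finite_induct) (auto intro: adjoin_add)

lemma adjoin_mono: "a \<in> adjoin z \<Longrightarrow> adjoin a \<subseteq> adjoin z"
  unfolding adjoin_def by (auto simp flip: rat_eval_pcompose)

text \<open>For nonzero \<open>a\<close> a minimal polynomial has nonzero constant coefficient,
  since otherwise a factor X could be removed; its equation is then solved for
  \<open>inverse a\<close>.\<close>

lemma inverse_in_adjoin:
  assumes "q \<noteq> 0" "rat_eval q a = 0"
  shows "inverse a \<in> adjoin a"
proof (cases "a = 0")
  case False
  obtain p where p: "is_min_poly p a" using is_min_poly_exists assms by blast
  obtain c p' where pc: "p = pCons c p'" by (cases p)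
  have e: "of_rat c + a * rat_eval p' a = 0"
    using p pc by (simp add: is_min_poly_def rat_eval_pCons)
  have "c \<noteq> 0"
  proof
    assume "c = 0"
    then have "p' \<noteq> 0" "rat_eval p' a = 0" using e False p pc by (auto simp: is_min_poly_def)
    then have "degree p \<le> degree p'" using p by (auto simp: is_min_poly_def)
    then show False using pc \<open>p' \<noteq> 0\<close> by simp
  qed
  then have "inverse a = of_rat (- (1 / c)) * rat_eval p' a"
    using e False by (simp add: field_simps of_rat_divide of_rat_minus eq_neg_iff_add_eq_0)
  moreover have "rat_eval p' a \<in> adjoin a" by (simp add: adjoin_def)
  ultimately show ?thesis by (simp only: adjoin_mult adjoin_of_rat)
qed auto

text \<open>Intermediate fields are subsets here, so a polynomial over one of them is a polynomial
  over the whole field with restricted coefficients.\<close>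

definition poly_over :: "'a::field_char_0 \<Rightarrow> 'a poly \<Rightarrow> bool" where
  "poly_over z p \<longleftrightarrow> (\<forall>i. coeff p i \<in> adjoin z)"

lemma poly_over_add: "poly_over z p \<Longrightarrow> poly_over z q \<Longrightarrow> poly_over z (p + q)"
  by (simp add: poly_over_def adjoin_add)

lemma poly_over_diff: "poly_over z p \<Longrightarrow> poly_over z q \<Longrightarrow> poly_over z (p - q)"
  by (simp add: poly_over_def adjoin_diff)

lemma poly_over_mult: "poly_over z p \<Longrightarrow> poly_over z q \<Longrightarrow> poly_over z (p * q)"
  by (simp add: poly_over_def coeff_mult adjoin_mult adjoin_sum)

lemma poly_over_monom: "a \<in> adjoin z \<Longrightarrow> poly_over z (monom a i)"
  by (simp add: poly_over_def)

lemma poly_over_pCons: "a \<in> adjoin z \<Longrightarrow> poly_over z p \<Longrightarrow> poly_over z (pCons a p)"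
  by (auto simp: poly_over_def coeff_pCons split: nat.split)

lemma poly_over_0: "poly_over z 0"
  by (simp add: poly_over_def)

lemma poly_over_map_of_rat: "poly_over z (map_poly of_rat p)"
  by (simp add: poly_over_def coeff_map_poly adjoin_of_rat)

lemma poly_over_pcompose: "poly_over z q \<Longrightarrow> poly_over z (pcompose (map_poly of_rat p) q)"
  by (induction p)
    (auto simp: map_poly_pCons pcompose_pCons poly_over_0
      intro!: poly_over_add poly_over_mult poly_over_pCons adjoin_of_rat)

lemma map_poly_to_ac_add: "map_poly to_ac (p + q) = map_poly to_ac p + map_poly to_ac q"
  by (rule poly_eqI) (simp add: coeff_map_poly)

lemma map_poly_to_ac_mult: "map_poly to_ac (p * q) = map_poly to_ac p * map_poly to_ac q"
  by (rule poly_eqI) (simp add: coeff_map_poly coeff_mult to_ac_sum)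

lemma map_poly_to_ac_pCons: "map_poly to_ac (pCons a p) = pCons (to_ac a) (map_poly to_ac p)"
  by (rule poly_eqI) (simp add: coeff_map_poly coeff_pCons split: nat.split)

lemma map_poly_to_ac_pcompose:
  "map_poly to_ac (pcompose p q) = pcompose (map_poly to_ac p) (map_poly to_ac q)"
  by (induction p)
    (simp_all add: pcompose_pCons map_poly_to_ac_add map_poly_to_ac_mult map_poly_to_ac_pCons)

text \<open>The classical choice \<gamma> = \<alpha> + c \<beta> with c outside a finite set: g(X)
  and f(\<gamma> - c X) then share only the root \<beta>, which is simple in g. Their greatest
  common divisor over the field of \<gamma> is therefore X - \<beta>, so \<beta> lies in that
  field.\<close>

lemma primitive_element_two:
  fixes \<alpha> \<beta> :: "'a::field_char_0"
  assumes alg: "\<And>x::'a. \<exists>p. p \<noteq> 0 \<and> rat_eval p x = 0"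
  shows "\<exists>\<gamma>. \<alpha> \<in> adjoin \<gamma> \<and> \<beta> \<in> adjoin \<gamma>"
proof -
  obtain f where f: "is_min_poly f \<alpha>" using alg is_min_poly_exists by metis
  obtain g where g: "is_min_poly g \<beta>" using alg is_min_poly_exists by metis
  define Rf where "Rf = {x::'a alg_closure. rat_eval f x = 0}"
  define Rg where "Rg = {x::'a alg_closure. rat_eval g x = 0}"
  have fin: "finite Rf" "finite Rg"
    unfolding Rf_def Rg_def using f g by (auto intro!: finite_rat_eval_roots simp: is_min_poly_def)
  \<comment> \<open>For b distinct from \<beta> the quotient is the one c with \<alpha> + c \<beta>
    = a + c b, the coincidence to be avoided. For b = \<beta> division by zero yields 0, which only
    excludes c = 0.\<close>
  define Bad where "Bad = (\<lambda>(a, b). (a - to_ac \<alpha>) / (to_ac \<beta> - b)) ` (Rf \<times> Rg)"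
  have "finite Bad" unfolding Bad_def using fin by auto
  moreover have "infinite (range (of_nat :: nat \<Rightarrow> 'a alg_closure))"
    by (intro range_inj_infinite injI) simp
  ultimately obtain c :: nat where c: "of_nat c \<notin> Bad" by (metis finite_subset image_subsetI)
  define \<gamma> where "\<gamma> = \<alpha> + of_nat c * \<beta>"
  have sep: "b = to_ac \<beta>" if "b \<in> Rg" "to_ac \<gamma> - of_nat c * b \<in> Rf" for b
  proof (rule ccontr)
    assume "b \<noteq> to_ac \<beta>"
    then have "of_nat c = (to_ac \<gamma> - of_nat c * b - to_ac \<alpha>) / (to_ac \<beta> - b)"
      by (simp add: \<gamma>_def field_simps)
    then have "of_nat c \<in> Bad" unfolding Bad_def using that by force
    then show False using c by simp
  qed
  \<comment> \<open>An element of least degree in \<open>S\<close> serves as the greatest common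
    divisor; it is the minimal polynomial of \<beta> over the field of \<gamma>.\<close>
  define S where "S = {u. poly_over \<gamma> u \<and> lead_coeff u = 1 \<and> poly u \<beta> = 0}"
  have norm: "\<exists>w\<in>S. degree w = degree v" if "poly_over \<gamma> v" "poly v \<beta> = 0" "v \<noteq> 0" for v
  proof -
    let ?a = "lead_coeff v"
    obtain q where "q \<noteq> 0" "rat_eval q ?a = 0" using alg by blast
    then have inv: "inverse ?a \<in> adjoin \<gamma>"
      using inverse_in_adjoin[of q ?a] adjoin_mono[of ?a \<gamma>] that by (auto simp: poly_over_def)
    have "smult (inverse ?a) v \<in> S"
      using that inv by (auto simp: S_def poly_over_def adjoin_mult)
    then show ?thesis using that by (intro bexI[of _ "smult (inverse ?a) v"]) auto
  qed
  have rat_ne: "map_poly of_rat g \<noteq> (0 :: 'a poly)"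
    using g by (auto simp: is_min_poly_def map_poly_eq_0_iff)
  then obtain u0 where "u0 \<in> S"
    using norm[of "map_poly of_rat g"] g by (auto simp: poly_over_map_of_rat is_min_poly_def)
  then obtain u where u: "u \<in> S" and least: "\<And>v. v \<in> S \<Longrightarrow> degree u \<le> degree v"
    using ex_has_least_nat[of "\<lambda>u. u \<in> S" u0 degree] by blast
  have u': "poly_over \<gamma> u" "lead_coeff u = 1" "poly u \<beta> = 0" "u \<noteq> 0" using u by (auto simp: S_def)
  have udvd: "u dvd v" if "poly_over \<gamma> v" "poly v \<beta> = 0" for v
    using that
  proof (induction "degree v" arbitrary: v rule: less_induct)
    case less
    show ?case
    proof (cases "v = 0")
      case False
      then have le: "degree u \<le> degree v" using norm[OF less.prems] least by force
      \<comment> \<open>One step of long division by the monic \<open>u\<close>, carried out by hand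
        so that the coefficients stay in \<open>adjoin \<gamma>\<close>.\<close>
      define v' where "v' = v - monom (lead_coeff v) (degree v - degree u) * u"
      have over: "poly_over \<gamma> v'" unfolding v'_def using less.prems u'
        by (intro poly_over_diff poly_over_mult poly_over_monom) (auto simp: poly_over_def)
      have root: "poly v' \<beta> = 0" unfolding v'_def using less.prems u' by simp
      have "u dvd v'"
      proof (cases "v' = 0")
        case False
        have "degree (monom (lead_coeff v) (degree v - degree u) * u) = degree v"
          using \<open>v \<noteq> 0\<close> u' le by (simp add: degree_mult_eq degree_monom_eq monom_eq_0_iff)
        moreover have "coeff (monom (lead_coeff v) (degree v - degree u) * u) (degree v) = lead_coeff v"
          using le u' by (simp add: coeff_monom_mult)
        ultimately have "degree v' \<le> degree v" "coeff v' (degree v) = 0"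
          unfolding v'_def by (auto intro!: degree_diff_le)
        then have "degree v' < degree v"
          using False by (metis leading_coeff_0_iff le_neq_implies_less)
        then show ?thesis using less.hyps over root by blast
      qed auto
      then have "u dvd v' + monom (lead_coeff v) (degree v - degree u) * u" by simp
      then show ?thesis by (simp add: v'_def)
    qed auto
  qed
  have dg: "u dvd map_poly of_rat g"
    using g by (intro udvd) (auto simp: poly_over_map_of_rat is_min_poly_def)
  have df: "u dvd pcompose (map_poly of_rat f) [:\<gamma>, - of_nat c:]"
  proof (rule udvd)
    have "of_nat c = (of_rat (of_nat c) :: 'a)" by simp
    then have "- of_nat c \<in> adjoin \<gamma>"
      using adjoin_of_rat[of "- of_nat c" \<gamma>] by (simp add: of_rat_minus)
    then show "poly_over \<gamma> (pcompose (map_poly of_rat f) [:\<gamma>, - of_nat c:])"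
      by (intro poly_over_pcompose poly_over_pCons adjoin_self poly_over_0)
    show "poly (pcompose (map_poly of_rat f) [:\<gamma>, - of_nat c:]) \<beta> = 0"
      using f by (simp add: poly_pcompose \<gamma>_def is_min_poly_def algebra_simps)
  qed
  have of_rat_ac: "to_ac (of_rat q) = of_rat q" for q :: rat
    by (cases q) (simp add: of_rat_rat)
  have lift: "map_poly to_ac (map_poly of_rat p :: 'a poly) = (map_poly of_rat p :: 'a alg_closure poly)" for p
    by (rule poly_eqI) (simp add: coeff_map_poly of_rat_ac)
  have root: "x = to_ac \<beta>" if x: "poly (map_poly to_ac u) x = 0" for x
  proof (rule sep)
    obtain w where "map_poly of_rat g = u * w" using dg by (auto simp: dvd_def)
    then have "map_poly to_ac (map_poly of_rat g :: 'a poly) = map_poly to_ac u * map_poly to_ac w"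
      by (simp add: map_poly_to_ac_mult)
    then show "x \<in> Rg" using x by (simp add: Rg_def lift)
    obtain w where "pcompose (map_poly of_rat f) [:\<gamma>, - of_nat c:] = u * w"
      using df by (auto simp: dvd_def)
    then have "map_poly to_ac (pcompose (map_poly of_rat f) [:\<gamma>, - of_nat c:]) = map_poly to_ac u * map_poly to_ac w"
      by (simp add: map_poly_to_ac_mult)
    then have "poly (map_poly to_ac (pcompose (map_poly of_rat f) [:\<gamma>, - of_nat c:])) x = 0"
      using x by simp
    then show "to_ac \<gamma> - of_nat c * x \<in> Rf"
      by (simp add: map_poly_to_ac_pcompose lift poly_pcompose Rf_def map_poly_to_ac_pCons algebra_simps)
  qed
  obtain u1 where u1: "u = [:- \<beta>, 1:] * u1" using u'(3) by (auto simp: poly_eq_0_iff_dvd dvd_def)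
  \<comment> \<open>If \<open>u1\<close> were not constant, it would have a root in the algebraic
    closure, and this can only be \<beta> again; then g would have a double root at \<beta>, against
    \<open>is_min_poly_simple_root\<close>.\<close>
  have "degree u1 = 0"
  proof (rule ccontr)
    assume pos: "degree u1 \<noteq> 0"
    then have "degree (map_poly to_ac u1) > 0" by (subst degree_map_poly) auto
    then obtain x where x: "poly (map_poly to_ac u1) x = 0" using alg_closed_imp_poly_has_root by blast
    then have "poly (map_poly to_ac u) x = 0" unfolding u1 map_poly_to_ac_mult by simp
    then have "x = to_ac \<beta>" by (rule root)
    moreover have "poly (map_poly to_ac p) (to_ac y) = to_ac (poly p y)" for p :: "'a poly" and y
      by (induction p) (simp_all add: map_poly_to_ac_pCons)
    ultimately have "poly u1 \<beta> = 0" using x by simp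
    then obtain u2 where u2: "u1 = [:- \<beta>, 1:] * u2" by (auto simp: poly_eq_0_iff_dvd dvd_def)
    obtain w0 where "map_poly of_rat g = u * w0" using dg by (auto simp: dvd_def)
    then have w: "map_poly of_rat g = [:- \<beta>, 1:] * ([:- \<beta>, 1:] * (u2 * w0))"
      using u1 u2 by (simp only: mult.assoc)
    have "rat_eval (pderiv g) \<beta> = 0"
      by (simp only: map_poly_of_rat_pderiv w pderiv_mult poly_add poly_mult) simp
    then show False using is_min_poly_simple_root[OF g] by simp
  qed
  then obtain a where "u1 = [:a:]" by (auto elim: degree_eq_zeroE)
  then have "a = 1" "coeff u 0 = - \<beta> * a" using u' u1 by auto
  then have "- \<beta> \<in> adjoin \<gamma>" using u'(1) by (simp add: poly_over_def) metis
  then have \<beta>: "\<beta> \<in> adjoin \<gamma>" using adjoin_diff[OF adjoin_0] by force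
  have "of_rat (of_nat c) * \<beta> \<in> adjoin \<gamma>" by (intro adjoin_mult adjoin_of_rat \<beta>)
  then have "\<gamma> - of_nat c * \<beta> \<in> adjoin \<gamma>" by (intro adjoin_diff adjoin_self) simp
  then show ?thesis using \<beta> by (auto simp: \<gamma>_def)
qed

text \<open>Families instead of sets, since the powers of a root of unity repeat: a repeated value
  gives a relation with coefficients 1 and -1, and an injective family is dependent by
  counting.\<close>

lemma rat_relation:
  fixes f :: "'i \<Rightarrow> 'a::field_char_0"
  assumes B: "finite B" "rat_span B = (UNIV :: 'a set)" and I: "finite I" "card I > card B"
  obtains c where "\<exists>i\<in>I. c i \<noteq> 0" "(\<Sum>i\<in>I. of_rat (c i) * f i) = 0"
proof (cases "inj_on f I")
  case True
  have "rat_dependent (f ` I)"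
    using rat_vs.independent_span_bound[of B "f ` I"] B I True by (auto simp: card_image)
  then obtain u where u: "\<exists>v\<in>f ` I. u v \<noteq> 0" "(\<Sum>v\<in>f ` I. of_rat (u v) * v) = 0"
    using rat_vs.dependent_finite[of "f ` I"] I by auto
  then show ?thesis using True by (intro that[of "u \<circ> f"]) (auto simp: sum.reindex)
next
  case False
  then obtain i j where ij: "i \<in> I" "j \<in> I" "i \<noteq> j" "f i = f j" by (auto simp: inj_on_def)
  define c :: "'i \<Rightarrow> rat" where "c = (\<lambda>l. if l = i then 1 else if l = j then - 1 else 0)"
  have "(\<Sum>l\<in>I. of_rat (c l) * f l) = (\<Sum>l\<in>{i, j}. of_rat (c l) * f l)"
    using ij I by (intro sum.mono_neutral_right) (auto simp: c_def)
  also have "\<dots> = 0" using ij by (simp add: c_def of_rat_minus)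
  finally show ?thesis using ij by (intro that[of c]) (auto simp: c_def)
qed

lemma number_field_algebraic:
  assumes "number_field TYPE('a::field_char_0)"
  shows "\<exists>p. p \<noteq> 0 \<and> rat_eval p (x::'a) = 0"
proof -
  obtain B :: "'a set" where B: "finite B" "rat_span B = UNIV" using assms by (auto simp: number_field_def)
  obtain c where c: "\<exists>i\<in>{..card B}. c i \<noteq> 0" "(\<Sum>i\<le>card B. of_rat (c i) * x ^ i) = 0"
    using rat_relation[OF B, of "{..card B}" "\<lambda>i. x ^ i"] by auto
  then have "rat_eval (\<Sum>i\<le>card B. monom (c i) i) x = 0" by (simp only: rat_eval_sum rat_eval_monom)
  moreover obtain i where "i \<le> card B" "c i \<noteq> 0" using c by auto
  then have "coeff (\<Sum>i\<le>card B. monom (c i) i) i \<noteq> 0" by (simp add: coeff_sum sum.delta)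
  then have "(\<Sum>i\<le>card B. monom (c i) i) \<noteq> 0" by auto
  ultimately show ?thesis by blast
qed

theorem primitive_element:
  assumes "number_field TYPE('a::field_char_0)"
  obtains \<gamma> :: "'a::field_char_0" where "adjoin \<gamma> = UNIV"
proof -
  obtain B :: "'a set" where B: "finite B" "rat_span B = UNIV" using assms by (auto simp: number_field_def)
  have "\<exists>\<gamma>. B \<subseteq> adjoin \<gamma>" using B(1)
  proof (induction B)
    case (insert b B)
    then obtain a where a: "B \<subseteq> adjoin a" by auto
    obtain \<gamma> where "a \<in> adjoin \<gamma>" "b \<in> adjoin \<gamma>"
      using primitive_element_two number_field_algebraic[OF assms] by metis
    then show ?case using a adjoin_mono by blast
  qed auto
  then obtain \<gamma> where \<gamma>: "B \<subseteq> adjoin \<gamma>" by auto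
  have "x \<in> adjoin \<gamma>" for x
  proof -
    have "x \<in> rat_span B" using B by simp
    then show ?thesis
      unfolding rat_vs.span_finite[OF B(1)] using \<gamma>
      by (auto intro!: adjoin_sum adjoin_mult adjoin_of_rat)
  qed
  then show ?thesis using that by auto
qed

section \<open>Embeddings, norm and trace\<close>

lemma complex_embeddingsD:
  assumes "\<sigma> \<in> complex_embeddings"
  shows "\<sigma> 1 = 1" "\<sigma> (x + y) = \<sigma> x + \<sigma> y" "\<sigma> (x * y) = \<sigma> x * \<sigma> y"
  using assms by (auto simp: complex_embeddings_def)

lemma embedding_0: "\<sigma> \<in> complex_embeddings \<Longrightarrow> \<sigma> 0 = 0"
  using complex_embeddingsD(2)[of \<sigma> 0 0] by simp

lemma embedding_minus: "\<sigma> \<in> complex_embeddings \<Longrightarrow> \<sigma> (- x) = - \<sigma> x"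
  using complex_embeddingsD(2)[of \<sigma> x "- x"] by (simp add: embedding_0 eq_neg_iff_add_eq_0 add.commute)

lemma embedding_diff: "\<sigma> \<in> complex_embeddings \<Longrightarrow> \<sigma> (x - y) = \<sigma> x - \<sigma> y"
  using complex_embeddingsD(2)[of \<sigma> x "- y"] by (simp add: embedding_minus)

lemma embedding_sum: "\<sigma> \<in> complex_embeddings \<Longrightarrow> \<sigma> (\<Sum>i\<in>I. f i) = (\<Sum>i\<in>I. \<sigma> (f i))"
  by (induction I rule: infinite_finite_induct) (simp_all add: embedding_0 complex_embeddingsD)

lemma embedding_power: "\<sigma> \<in> complex_embeddings \<Longrightarrow> \<sigma> (x ^ m) = \<sigma> x ^ m"
  by (induction m) (simp_all add: complex_embeddingsD)

lemma embedding_of_nat: "\<sigma> \<in> complex_embeddings \<Longrightarrow> \<sigma> (of_nat m) = of_nat m"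
  by (induction m) (simp_all add: embedding_0 complex_embeddingsD)

lemma embedding_of_int: "\<sigma> \<in> complex_embeddings \<Longrightarrow> \<sigma> (of_int m) = of_int m"
  by (cases m rule: int_cases2) (simp_all add: embedding_minus embedding_of_nat)

lemma embedding_eq_0_iff [simp]:
  assumes "\<sigma> \<in> complex_embeddings"
  shows "\<sigma> x = 0 \<longleftrightarrow> x = 0"
proof (cases "x = 0")
  case False
  have "\<sigma> x * \<sigma> (inverse x) = 1"
    using False complex_embeddingsD[OF assms] by (metis right_inverse)
  then show ?thesis using False by auto
qed (simp add: embedding_0[OF assms])

lemma embedding_inverse: "\<sigma> \<in> complex_embeddings \<Longrightarrow> \<sigma> (inverse x) = inverse (\<sigma> x)"
proof (cases "x = 0")
  case False
  assume \<sigma>: "\<sigma> \<in> complex_embeddings"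
  have "\<sigma> x * \<sigma> (inverse x) = 1"
    using False complex_embeddingsD[OF \<sigma>] by (metis right_inverse)
  then show ?thesis by (simp add: inverse_unique)
qed (simp add: embedding_0)

lemma embedding_divide: "\<sigma> \<in> complex_embeddings \<Longrightarrow> \<sigma> (x / y) = \<sigma> x / \<sigma> y"
  by (simp add: divide_inverse complex_embeddingsD embedding_inverse)

lemma embedding_of_rat: "\<sigma> \<in> complex_embeddings \<Longrightarrow> \<sigma> (of_rat q) = of_rat q"
  by (cases q) (simp add: of_rat_rat embedding_divide embedding_of_int)

lemma embedding_rat_eval: "\<sigma> \<in> complex_embeddings \<Longrightarrow> \<sigma> (rat_eval q x) = rat_eval q (\<sigma> x)"
  by (induction q)
    (simp_all add: rat_eval_pCons embedding_0 embedding_of_rat complex_embeddingsD)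

lemma embedding_cnj: "\<sigma> \<in> complex_embeddings \<Longrightarrow> cnj \<circ> \<sigma> \<in> complex_embeddings"
  by (auto simp: complex_embeddings_def)

text \<open>All later arguments are relative to a fixed generator: embeddings correspond to the
  complex roots of \<open>p\<close>, and the imaginary part of \<sigma> \<gamma> tells real
  embeddings and the two members of a conjugate pair apart.\<close>

locale primitive_number_field =
  fixes \<gamma> :: "'k::field_char_0" and p :: "rat poly"
  assumes adjoin_eq_UNIV: "adjoin \<gamma> = UNIV" and min_poly: "is_min_poly p \<gamma>"
begin

abbreviation n :: nat where "n \<equiv> degree p"

lemma rat_eval_surj: "\<exists>q. x = rat_eval q \<gamma>"
  using adjoin_eq_UNIV unfolding adjoin_def by blast

lemma rat_eval_root_cong:
  assumes "rat_eval q \<gamma> = rat_eval q' \<gamma>" "rat_eval p z = 0"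
  shows "rat_eval q z = rat_eval q' z"
proof -
  have "p dvd q - q'" using assms(1) by (intro is_min_poly_dvd[OF min_poly]) (simp add: rat_eval_diff)
  then obtain w where "q - q' = p * w" by (auto simp: dvd_def)
  then have "rat_eval (q - q') z = 0" using assms(2) by (simp add: rat_eval_mult)
  then show ?thesis by (simp add: rat_eval_diff)
qed

text \<open>The map sending q(\<gamma>) to q(z). For a root \<open>z\<close> of \<open>p\<close> it
  does not depend on the chosen q, by \<open>rat_eval_root_cong\<close>.\<close>

definition root_embedding :: "complex \<Rightarrow> 'k \<Rightarrow> complex" where
  "root_embedding z x = rat_eval (SOME q. rat_eval q \<gamma> = x) z"

lemma root_embedding_rat_eval:
  assumes "rat_eval p z = 0"
  shows "root_embedding z (rat_eval q \<gamma>) = rat_eval q z"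
  unfolding root_embedding_def
  by (rule rat_eval_root_cong[OF _ assms]) (rule someI[of _ q], simp)

lemma root_embedding_self:
  assumes "rat_eval p z = 0"
  shows "root_embedding z \<gamma> = z"
  using root_embedding_rat_eval[OF assms, of "[:0, 1:]"] by (simp add: rat_eval_pCons)

lemma root_embedding_in:
  assumes z: "rat_eval p z = 0"
  shows "root_embedding z \<in> complex_embeddings"
  unfolding complex_embeddings_def
proof (intro CollectI conjI allI)
  show "root_embedding z 1 = 1"
    using root_embedding_rat_eval[OF z, of "[:1:]"] by (simp add: rat_eval_pCons)
  fix x y
  obtain q r where qr: "x = rat_eval q \<gamma>" "y = rat_eval r \<gamma>" using rat_eval_surj by metis
  show "root_embedding z (x + y) = root_embedding z x + root_embedding z y"
    unfolding qr rat_eval_add[symmetric] root_embedding_rat_eval[OF z] by (simp add: rat_eval_add)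
  show "root_embedding z (x * y) = root_embedding z x * root_embedding z y"
    unfolding qr rat_eval_mult[symmetric] root_embedding_rat_eval[OF z] by (simp add: rat_eval_mult)
qed

lemma embedding_eqI:
  assumes "\<sigma> \<in> complex_embeddings" "\<tau> \<in> complex_embeddings" "\<sigma> \<gamma> = \<tau> \<gamma>"
  shows "\<sigma> = \<tau>"
proof
  fix x
  obtain q where "x = rat_eval q \<gamma>" using rat_eval_surj by blast
  then show "\<sigma> x = \<tau> x" using assms by (simp add: embedding_rat_eval)
qed

lemma embedding_root: "\<sigma> \<in> complex_embeddings \<Longrightarrow> rat_eval p (\<sigma> \<gamma>) = 0"
  using min_poly by (simp add: is_min_poly_def embedding_0 flip: embedding_rat_eval)

lemma embeddings_bij: "bij_betw (\<lambda>\<sigma>. \<sigma> \<gamma>) complex_embeddings {z. rat_eval p z = 0}"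
  unfolding bij_betw_def
proof
  show "inj_on (\<lambda>\<sigma>. \<sigma> \<gamma>) complex_embeddings" by (auto intro!: inj_onI embedding_eqI)
  show "(\<lambda>\<sigma>. \<sigma> \<gamma>) ` complex_embeddings = {z. rat_eval p z = 0}"
    by (auto simp: embedding_root image_iff intro!: bexI[OF _ root_embedding_in] root_embedding_self[symmetric])
qed

text \<open>Every complex root of \<open>p\<close> again has \<open>p\<close> as a minimal
  polynomial, by \<open>is_min_poly_transfer\<close>, and so is simple.\<close>

lemma card_roots: "card {z::complex. rat_eval p z = 0} = n"
proof -
  let ?P = "map_poly of_rat p :: complex poly"
  have ne: "p \<noteq> 0" using min_poly by (simp add: is_min_poly_def)
  have "rsquarefree ?P"
    unfolding rsquarefree_roots
    using is_min_poly_simple_root[OF is_min_poly_transfer[OF min_poly]] by (auto simp: map_poly_of_rat_pderiv)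
  then have "?P = smult (lead_coeff ?P) (\<Prod>z | poly ?P z = 0. [:- z, 1:])"
    by (rule complex_poly_decompose_rsquarefree[symmetric])
  then have "degree ?P = degree (smult (lead_coeff ?P) (\<Prod>z | poly ?P z = 0. [:- z, 1:]))" by (rule arg_cong)
  also have "\<dots> = degree (\<Prod>z | poly ?P z = 0. [:- z, 1:])"
    using ne by (simp add: map_poly_eq_0_iff)
  also have "\<dots> = card {z::complex. rat_eval p z = 0}"
    by (subst degree_prod_eq_sum_degree) auto
  finally show ?thesis by (simp add: degree_map_poly)
qed

lemma finite_embeddings [simp]: "finite (complex_embeddings :: ('k \<Rightarrow> complex) set)"
  and card_embeddings: "card (complex_embeddings :: ('k \<Rightarrow> complex) set) = n"
proof -
  have "finite {z::complex. rat_eval p z = 0}"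
    using min_poly by (intro finite_rat_eval_roots) (simp add: is_min_poly_def)
  then show "finite (complex_embeddings :: ('k \<Rightarrow> complex) set)"
    using bij_betw_finite[OF embeddings_bij] by simp
  show "card (complex_embeddings :: ('k \<Rightarrow> complex) set) = n"
    using bij_betw_same_card[OF embeddings_bij] card_roots by simp
qed

lemma n_pos: "n > 0"
  by (rule is_min_poly_degree_pos[OF min_poly])

lemma low_degree_unique:
  assumes "degree q < n" "rat_eval q \<gamma> = 0"
  shows "q = 0"
  using assms min_poly unfolding is_min_poly_def by force

lemma power_basis_relation:
  assumes "(\<Sum>i<n. of_rat (c i) * \<gamma> ^ i) = 0" "i < n"
  shows "c i = 0"
proof -
  let ?q = "\<Sum>i<n. monom (c i) i"
  have "degree ?q \<le> n - 1" by (intro degree_sum_le) (auto intro: order_trans[OF degree_monom_le])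
  then have "degree ?q < n" using n_pos by simp
  moreover have "rat_eval ?q \<gamma> = 0" using assms(1) by (simp only: rat_eval_sum rat_eval_monom)
  ultimately have "?q = 0" by (rule low_degree_unique)
  then have "coeff ?q i = 0" by simp
  then show ?thesis using assms(2) by (simp add: coeff_sum sum.delta)
qed

lemma power_basis_span: "\<exists>c. x = (\<Sum>i<n. of_rat (c i) * \<gamma> ^ i)"
proof -
  obtain q where q: "x = rat_eval q \<gamma>" using rat_eval_surj by blast
  let ?r = "q mod p"
  have "rat_eval (q div p * p + ?r) \<gamma> = rat_eval ?r \<gamma>"
    using min_poly unfolding rat_eval_add rat_eval_mult by (simp add: is_min_poly_def)
  then have x: "x = rat_eval ?r \<gamma>" using q by simp
  have "degree ?r < n"
    using n_pos min_poly by (cases "?r = 0") (auto simp: is_min_poly_def intro: degree_mod_less')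
  then have "?r = (\<Sum>i\<le>n - 1. monom (coeff ?r i) i)"
    by (intro poly_as_sum_of_monoms'[symmetric]) auto
  moreover have "{..n - 1} = {..<n}" using n_pos by auto
  ultimately have "rat_eval ?r \<gamma> = rat_eval (\<Sum>i<n. monom (coeff ?r i) i) \<gamma>" by simp
  then show ?thesis using x unfolding rat_eval_sum rat_eval_monom by blast
qed

lemma power_basis_inj: "inj_on (\<lambda>i. \<gamma> ^ i) {..<n}"
proof (rule inj_onI, rule ccontr)
  fix i j assume ij: "i \<in> {..<n}" "j \<in> {..<n}" "\<gamma> ^ i = \<gamma> ^ j" "i \<noteq> j"
  define c :: "nat \<Rightarrow> rat" where "c = (\<lambda>l. if l = i then 1 else if l = j then - 1 else 0)"
  have "(\<Sum>l<n. of_rat (c l) * \<gamma> ^ l) = (\<Sum>l\<in>{i, j}. of_rat (c l) * \<gamma> ^ l)"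
    using ij by (intro sum.mono_neutral_right) (auto simp: c_def)
  also have "\<dots> = 0" using ij by (simp add: c_def of_rat_minus)
  finally have "c i = 0" using ij by (intro power_basis_relation) auto
  then show False by (simp add: c_def)
qed

lemma power_basis: "is_rat_basis (map (\<lambda>i. \<gamma> ^ i) [0..<n])"
proof -
  let ?S = "(\<lambda>i. \<gamma> ^ i) ` {..<n}"
  have set_eq: "set (map (\<lambda>i. \<gamma> ^ i) [0..<n]) = ?S" by (auto simp: atLeast_upt)
  have "\<not> rat_dependent ?S"
  proof
    assume "rat_dependent ?S"
    then obtain u where u: "\<exists>v\<in>?S. u v \<noteq> 0" "(\<Sum>v\<in>?S. of_rat (u v) * v) = 0"
      by (subst (asm) rat_vs.dependent_finite) auto
    then have "(\<Sum>i<n. of_rat (u (\<gamma> ^ i)) * \<gamma> ^ i) = 0"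
      by (simp add: sum.reindex[OF power_basis_inj])
    then show False using u(1) power_basis_relation by fastforce
  qed
  moreover have "x \<in> rat_span ?S" for x
  proof -
    obtain c where c: "x = (\<Sum>i<n. of_rat (c i) * \<gamma> ^ i)" using power_basis_span by blast
    show ?thesis unfolding c
      by (intro rat_vs.span_sum rat_vs.span_scale rat_vs.span_base) auto
  qed
  moreover have "distinct (map (\<lambda>i. \<gamma> ^ i) [0..<n])"
    using power_basis_inj by (simp add: distinct_map lessThan_atLeast0)
  ultimately show ?thesis unfolding is_rat_basis_def set_eq by auto
qed

lemma is_rat_basis_length:
  assumes "is_rat_basis (bs :: 'k list)"
  shows "length bs = field_degree TYPE('k)"
proof -
  have "rat_dim (UNIV :: 'k set) = card (set bs)"
    using assms by (intro rat_vs.dim_eq_card) (auto simp: is_rat_basis_def)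
  then show ?thesis using assms by (simp add: field_degree_def is_rat_basis_def distinct_card)
qed

lemma field_degree_eq: "field_degree TYPE('k) = n"
  using is_rat_basis_length[OF power_basis] by simp

section \<open>The matrix of all embeddings\<close>

definition emb_list :: "('k \<Rightarrow> complex) list" where
  "emb_list = (SOME es. distinct es \<and> set es = complex_embeddings)"

lemma emb_list: "distinct emb_list" "set emb_list = complex_embeddings" "length emb_list = n"
proof -
  have "\<exists>es. distinct es \<and> set es = (complex_embeddings :: ('k \<Rightarrow> complex) set)"
    using finite_distinct_list[OF finite_embeddings] by blast
  then have *: "distinct emb_list \<and> set emb_list = complex_embeddings"
    unfolding emb_list_def by (rule someI_ex)
  then show "distinct emb_list" "set emb_list = complex_embeddings" by auto
  then show "length emb_list = n" using distinct_card[of emb_list] card_embeddings by simp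
qed

lemma emb_list_nth: "i < n \<Longrightarrow> emb_list ! i \<in> complex_embeddings"
  using emb_list by (metis nth_mem)

lemma emb_list_bij: "bij_betw (\<lambda>i. emb_list ! i) {..<n} complex_embeddings"
  by (rule bij_betw_nth) (use emb_list in auto)

definition emb_mat :: "'k list \<Rightarrow> complex mat" where
  "emb_mat bs = mat n n (\<lambda>(i, j). (emb_list ! i) (bs ! j))"

text \<open>Independence is implied by the length, so when an entry is exchanged in
  \<open>integral_basis_exists\<close> only spanning is to be checked.\<close>

definition rat_spanning :: "'k list \<Rightarrow> bool" where
  "rat_spanning bs \<longleftrightarrow> length bs = n \<and> (\<forall>x. \<exists>c. x = (\<Sum>j<n. of_rat (c j) * bs ! j))"

lemma emb_mat_carrier [simp]: "emb_mat bs \<in> carrier_mat n n"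
  by (simp add: emb_mat_def)

lemma is_rat_basis_sum:
  assumes "is_rat_basis (bs :: 'k list)"
  shows "x = (\<Sum>j<n. of_rat (rat_coord (set bs) x (bs ! j)) * bs ! j)"
proof -
  have len: "length bs = n" using is_rat_basis_length[OF assms] field_degree_eq by simp
  have "bij_betw (\<lambda>i. bs ! i) {..<n} (set bs)"
    using assms len by (intro bij_betw_nth) (auto simp: is_rat_basis_def)
  from sum.reindex_bij_betw[OF this, of "\<lambda>b. of_rat (rat_coord (set bs) x b) * b"]
  show ?thesis
    using assms rat_vs.sum_representation_eq[of "set bs" x "set bs"] by (simp add: is_rat_basis_def)
qed

lemma is_rat_basis_spanning: "is_rat_basis (bs :: 'k list) \<Longrightarrow> rat_spanning bs"
  unfolding rat_spanning_def using is_rat_basis_sum is_rat_basis_length field_degree_eq by metis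

text \<open>Linear independence of the embeddings. A vector killed by the transpose is a relation
  between the embeddings on all of K; testing it on powers of \<gamma> and interpolating at the
  distinct points \<sigma> \<gamma> makes each coefficient vanish.\<close>

lemma det_emb_mat_nonzero:
  assumes "rat_spanning bs"
  shows "det (emb_mat bs) \<noteq> 0"
proof
  assume "det (emb_mat bs) = 0"
  then have "det (transpose_mat (emb_mat bs)) = 0" by (simp add: Determinant.det_transpose[OF emb_mat_carrier])
  then obtain v where v: "v \<in> carrier_vec n" "v \<noteq> 0\<^sub>v n" "transpose_mat (emb_mat bs) *\<^sub>v v = 0\<^sub>v n"
    using det_0_iff_vec_prod_zero[OF iffD2[OF transpose_carrier_mat emb_mat_carrier]] by blast
  have rel: "(\<Sum>i<n. (emb_list ! i) (bs ! j) * v $ i) = 0" if "j < n" for j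
  proof -
    have "(transpose_mat (emb_mat bs) *\<^sub>v v) $ j = 0" using v that by simp
    then show ?thesis using that v by (simp add: scalar_prod_def emb_mat_def atLeast0LessThan)
  qed
  have all: "(\<Sum>i<n. v $ i * (emb_list ! i) x) = 0" for x
  proof -
    obtain c where c: "x = (\<Sum>j<n. of_rat (c j) * bs ! j)" using assms unfolding rat_spanning_def by blast
    have "(\<Sum>i<n. v $ i * (emb_list ! i) x) = (\<Sum>i<n. \<Sum>j<n. of_rat (c j) * ((emb_list ! i) (bs ! j) * v $ i))"
      unfolding c
      by (intro sum.cong refl)
        (simp add: embedding_sum emb_list_nth complex_embeddingsD embedding_of_rat sum_distrib_left mult_ac)
    also have "\<dots> = (\<Sum>j<n. of_rat (c j) * (\<Sum>i<n. (emb_list ! i) (bs ! j) * v $ i))"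
      by (subst sum.swap) (simp add: sum_distrib_left)
    also have "\<dots> = 0" using rel by simp
    finally show ?thesis .
  qed
  define z where "z = (\<lambda>i. (emb_list ! i) \<gamma>)"
  \<comment> \<open>Complex coefficients are allowed in \<open>P\<close>, because the relation holds
    for every power of \<gamma> separately.\<close>
  have P: "(\<Sum>i<n. v $ i * poly P (z i)) = 0" for P
  proof -
    have "(\<Sum>i<n. v $ i * poly P (z i)) = (\<Sum>i<n. \<Sum>l\<le>degree P. coeff P l * (v $ i * (emb_list ! i) (\<gamma> ^ l)))"
      by (simp add: poly_altdef z_def sum_distrib_left mult_ac embedding_power emb_list_nth)
    also have "\<dots> = (\<Sum>l\<le>degree P. coeff P l * (\<Sum>i<n. v $ i * (emb_list ! i) (\<gamma> ^ l)))"
      by (subst sum.swap) (simp add: sum_distrib_left)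
    finally show ?thesis by (simp add: all)
  qed
  have zinj: "z i = z j \<longleftrightarrow> i = j" if "i < n" "j < n" for i j
    using that embedding_eqI[OF emb_list_nth emb_list_nth] emb_list
    by (auto simp: z_def nth_eq_iff_index_eq)
  have "v $ k = 0" if k: "k < n" for k
  proof -
    define P where "P = (\<Prod>j\<in>{..<n} - {k}. [:- z j, 1:])"
    have "(\<Sum>i<n. v $ i * poly P (z i)) = (\<Sum>i\<in>{k}. v $ i * poly P (z i))"
      using k by (intro sum.mono_neutral_right) (auto simp: P_def poly_prod)
    then have "v $ k * poly P (z k) = 0" using P by simp
    moreover have "poly P (z k) \<noteq> 0" using zinj k by (auto simp: P_def poly_prod)
    ultimately show ?thesis by simp
  qed
  then show False using v by auto
qed

lemma some_rat_basis: "is_rat_basis (SOME bs :: 'k list. is_rat_basis bs)"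
  using power_basis by (rule someI)

text \<open>The embeddings diagonalise all multiplications at once: each row of
  \<open>emb_mat bs\<close> is a left eigenvector of multiplication by \<open>x\<close>, with the
  conjugate \<sigma> x as eigenvalue.\<close>

lemma mult_matrix_conj:
  assumes "is_rat_basis (bs :: 'k list)"
  shows "emb_mat bs * map_mat of_rat (mult_matrix bs x)
    = mat n n (\<lambda>(i, j). if i = j then (emb_list ! i) x else 0) * emb_mat bs"
proof (rule eq_matI)
  have len: "length bs = n" using is_rat_basis_length[OF assms] field_degree_eq by simp
  show "dim_row (emb_mat bs * map_mat of_rat (mult_matrix bs x))
    = dim_row (mat n n (\<lambda>(i, j). if i = j then (emb_list ! i) x else 0) * emb_mat bs)"
    "dim_col (emb_mat bs * map_mat of_rat (mult_matrix bs x))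
    = dim_col (mat n n (\<lambda>(i, j). if i = j then (emb_list ! i) x else 0) * emb_mat bs)"
    using len by (simp_all add: emb_mat_def mult_matrix_def)
  fix i j assume "i < dim_row (mat n n (\<lambda>(i, j). if i = j then (emb_list ! i) x else 0) * emb_mat bs)"
    "j < dim_col (mat n n (\<lambda>(i, j). if i = j then (emb_list ! i) x else 0) * emb_mat bs)"
  then have ij: "i < n" "j < n" by (simp_all add: emb_mat_def)
  let ?\<sigma> = "emb_list ! i"
  have \<sigma>: "?\<sigma> \<in> complex_embeddings" using ij emb_list_nth by blast
  have "(emb_mat bs * map_mat of_rat (mult_matrix bs x)) $$ (i, j)
    = (\<Sum>l<n. ?\<sigma> (bs ! l) * of_rat (rat_coord (set bs) (x * bs ! j) (bs ! l)))"
    using ij len by (simp add: emb_mat_def mult_matrix_def scalar_prod_def atLeast0LessThan)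
  also have "\<dots> = ?\<sigma> (\<Sum>l<n. of_rat (rat_coord (set bs) (x * bs ! j) (bs ! l)) * bs ! l)"
    by (simp add: embedding_sum[OF \<sigma>] complex_embeddingsD(3)[OF \<sigma>] embedding_of_rat[OF \<sigma>] mult.commute)
  also have "\<dots> = ?\<sigma> x * ?\<sigma> (bs ! j)"
    using is_rat_basis_sum[OF assms, of "x * bs ! j"] complex_embeddingsD(3)[OF \<sigma>] by simp
  also have "\<dots> = (mat n n (\<lambda>(i, j). if i = j then (emb_list ! i) x else 0) * emb_mat bs) $$ (i, j)"
    using ij by (simp add: emb_mat_def scalar_prod_def atLeast0LessThan if_distrib[of "\<lambda>x. x * _"] sum.delta cong: if_cong)
  finally show "(emb_mat bs * map_mat of_rat (mult_matrix bs x)) $$ (i, j)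
    = (mat n n (\<lambda>(i, j). if i = j then (emb_list ! i) x else 0) * emb_mat bs) $$ (i, j)" .
qed

lemma det_diag_mat:
  "det (mat n n (\<lambda>(i, j). if i = j then f i else (0::complex))) = (\<Prod>i<n. f i)"
  by (subst det_upper_triangular[of _ n])
    (auto intro!: upper_triangularI simp: prod_list_diag_prod atLeast0LessThan)

lemma prod_emb_list: "(\<Prod>i<n. f (emb_list ! i)) = (\<Prod>\<sigma>\<in>complex_embeddings. f \<sigma>)"
  by (rule prod.reindex_bij_betw[OF emb_list_bij])

lemma sum_emb_list: "(\<Sum>i<n. f (emb_list ! i)) = (\<Sum>\<sigma>\<in>complex_embeddings. f \<sigma>)"
  by (rule sum.reindex_bij_betw[OF emb_list_bij])

theorem field_norm_eq_prod: "of_rat (field_norm x) = (\<Prod>\<sigma>\<in>complex_embeddings. \<sigma> (x::'k))"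
proof -
  define bs :: "'k list" where "bs = (SOME bs. is_rat_basis bs)"
  have bs: "is_rat_basis bs" unfolding bs_def by (rule some_rat_basis)
  have len: "length bs = n" using is_rat_basis_length[OF bs] field_degree_eq by simp
  have cM: "map_mat of_rat (mult_matrix bs x) \<in> carrier_mat n n" using len by (simp add: mult_matrix_def)
  have diag_carrier: "mat n n (\<lambda>(i, j). if i = j then (emb_list ! i) x else 0) \<in> carrier_mat n n" by simp
  have "det (emb_mat bs) * det (map_mat of_rat (mult_matrix bs x))
    = det (mat n n (\<lambda>(i, j). if i = j then (emb_list ! i) x else 0)) * det (emb_mat bs)"
    using mult_matrix_conj[OF bs, of x] det_mult[OF emb_mat_carrier cM, of bs]
      det_mult[OF diag_carrier emb_mat_carrier, of bs] by (simp only: mult.commute)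
  then have "det (map_mat of_rat (mult_matrix bs x)) = (\<Prod>i<n. (emb_list ! i) x)"
    using det_emb_mat_nonzero[OF is_rat_basis_spanning[OF bs]] by (simp add: det_diag_mat)
  then show ?thesis unfolding field_norm_def bs_def[symmetric] of_rat_hom.hom_det
    by (simp add: prod_emb_list[of "\<lambda>\<sigma>. \<sigma> x"])
qed

lemma left_inverse_exists:
  assumes "(A :: complex mat) \<in> carrier_mat n n" "det A \<noteq> 0"
  obtains B where "B \<in> carrier_mat n n" "B * A = 1\<^sub>m n" "A * B = 1\<^sub>m n"
  using det_non_zero_imp_unit[OF assms, of "()"] by (auto simp: Units_def ring_mat_def)

theorem field_trace_eq_sum: "of_rat (field_trace x) = (\<Sum>\<sigma>\<in>complex_embeddings. \<sigma> (x::'k))"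
proof -
  define bs :: "'k list" where "bs = (SOME bs. is_rat_basis bs)"
  have bs: "is_rat_basis bs" unfolding bs_def by (rule some_rat_basis)
  have len: "length bs = n" using is_rat_basis_length[OF bs] field_degree_eq by simp
  let ?E = "emb_mat bs" and ?M = "map_mat of_rat (mult_matrix bs x) :: complex mat"
  let ?D = "mat n n (\<lambda>(i, j). if i = j then (emb_list ! i) x else 0)"
  have cM: "?M \<in> carrier_mat n n" using len by (simp add: mult_matrix_def)
  obtain B where B: "B \<in> carrier_mat n n" "B * ?E = 1\<^sub>m n" "?E * B = 1\<^sub>m n"
    using left_inverse_exists[OF emb_mat_carrier det_emb_mat_nonzero[OF is_rat_basis_spanning[OF bs]]] .
  have "?M = (B * ?E) * ?M" using B cM by simp
  also have "\<dots> = B * (?E * ?M)" by (rule assoc_mult_mat[OF B(1) emb_mat_carrier cM])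
  also have "\<dots> = B * (?D * ?E)" using mult_matrix_conj[OF bs] by simp
  finally have M: "?M = B * (?D * ?E)" .
  have DE: "(?D * ?E) $$ (k, i) = (emb_list ! k) x * ?E $$ (k, i)" if "k < n" "i < n" for k i
    using that by (simp add: emb_mat_def scalar_prod_def atLeast0LessThan if_distrib[of "\<lambda>x. x * _"] sum.delta cong: if_cong)
  \<comment> \<open>Invariance of the trace: once the two sums are interchanged, only these diagonal
    entries are left of the conjugation.\<close>
  have EB: "(\<Sum>i<n. ?E $$ (k, i) * B $$ (i, k)) = 1" if "k < n" for k
  proof -
    have "(?E * B) $$ (k, k) = 1" using B that by simp
    then show ?thesis using that B(1) emb_mat_carrier[of bs]
      by (simp add: scalar_prod_def atLeast0LessThan del: emb_mat_carrier)
  qed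
  have "of_rat (field_trace x) = (\<Sum>i<n. ?M $$ (i, i))"
    unfolding field_trace_def bs_def[symmetric] Let_def
    using len by (simp add: mult_matrix_def of_rat_sum)
  also have "\<dots> = (\<Sum>i<n. \<Sum>k<n. B $$ (i, k) * ((emb_list ! k) x * ?E $$ (k, i)))"
  proof (intro sum.cong refl)
    fix i assume "i \<in> {..<n}"
    then show "?M $$ (i, i) = (\<Sum>k<n. B $$ (i, k) * ((emb_list ! k) x * ?E $$ (k, i)))"
      unfolding M using B(1) DE by (simp add: scalar_prod_def atLeast0LessThan emb_mat_def)
  qed
  also have "\<dots> = (\<Sum>k<n. (emb_list ! k) x * (\<Sum>i<n. ?E $$ (k, i) * B $$ (i, k)))"
    by (subst sum.swap) (simp add: sum_distrib_left mult_ac)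
  also have "\<dots> = (\<Sum>k<n. (emb_list ! k) x)" by (simp add: EB)
  finally show ?thesis by (simp add: sum_emb_list[of "\<lambda>\<sigma>. \<sigma> x"])
qed

text \<open>The Gram matrix of the form tr(w a b) is E^T D E with E = \<open>emb_mat bs\<close> and
  D the diagonal of the conjugates of \<open>w\<close>. The case \<open>w = 1\<close> gives the
  discriminant, the general case serves \<open>codifferent_norm_ge\<close>.\<close>

lemma det_twisted_trace_form:
  fixes w :: 'k
  assumes "length bs = n"
  shows "of_rat (det (mat n n (\<lambda>(i, j). field_trace (w * bs ! i * bs ! j))))
    = of_rat (field_norm w) * det (emb_mat bs) ^ 2"
proof -
  let ?D = "mat n n (\<lambda>(i, j). if i = j then (emb_list ! i) w else 0)"
  have diag_carrier: "?D \<in> carrier_mat n n" by simp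
  have "map_mat of_rat (mat n n (\<lambda>(i, j). field_trace (w * bs ! i * bs ! j)))
    = transpose_mat (emb_mat bs) * (?D * emb_mat bs)"
  proof (rule eq_matI)
    fix i j assume "i < dim_row (transpose_mat (emb_mat bs) * (?D * emb_mat bs))"
      "j < dim_col (transpose_mat (emb_mat bs) * (?D * emb_mat bs))"
    then have ij: "i < n" "j < n" by (simp_all add: emb_mat_def)
    have DE: "(?D * emb_mat bs) $$ (k, j) = (emb_list ! k) w * (emb_list ! k) (bs ! j)" if "k < n" for k
      using that ij by (simp add: emb_mat_def scalar_prod_def atLeast0LessThan if_distrib[of "\<lambda>x. x * _"] sum.delta cong: if_cong)
    have "(transpose_mat (emb_mat bs) * (?D * emb_mat bs)) $$ (i, j)
      = (\<Sum>k<n. (emb_list ! k) (bs ! i) * ((?D * emb_mat bs) $$ (k, j)))"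
      using ij by (simp add: scalar_prod_def atLeast0LessThan emb_mat_def)
    also have "\<dots> = (\<Sum>k<n. (emb_list ! k) (w * bs ! i * bs ! j))"
      by (intro sum.cong refl) (simp add: DE emb_list_nth complex_embeddingsD mult_ac)
    also have "\<dots> = of_rat (field_trace (w * bs ! i * bs ! j))"
      by (simp add: field_trace_eq_sum sum_emb_list[of "\<lambda>\<sigma>. \<sigma> (w * bs ! i * bs ! j)"])
    finally show "map_mat of_rat (mat n n (\<lambda>(i, j). field_trace (w * bs ! i * bs ! j))) $$ (i, j)
      = (transpose_mat (emb_mat bs) * (?D * emb_mat bs)) $$ (i, j)"
      using ij by simp
  qed (simp_all add: emb_mat_def)
  then have "det (map_mat of_rat (mat n n (\<lambda>(i, j). field_trace (w * bs ! i * bs ! j))))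
    = det (transpose_mat (emb_mat bs)) * (det ?D * det (emb_mat bs))"
    using det_mult[OF diag_carrier emb_mat_carrier, of bs]
      det_mult[OF iffD2[OF transpose_carrier_mat emb_mat_carrier] mult_carrier_mat[OF diag_carrier emb_mat_carrier], of bs bs]
    by simp
  then show ?thesis
    unfolding of_rat_hom.hom_det
    by (simp add: Determinant.det_transpose[OF emb_mat_carrier] det_diag_mat prod_emb_list[of "\<lambda>\<sigma>. \<sigma> w"] field_norm_eq_prod power2_eq_square)
qed

end

section \<open>Algebraic integers and integral bases\<close>

text \<open>The relations make the nonzero vector of the \<open>f i\<close> an eigenvector of an
  integer matrix with eigenvalue \<open>z\<close>, and the characteristic polynomial of that matrix
  is monic.\<close>

lemma algebraic_int_of_module:
  fixes z :: "'a::field_char_0" and f :: "'i \<Rightarrow> 'a"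
  assumes I: "finite I" and ne: "\<exists>i\<in>I. f i \<noteq> 0"
    and rel: "\<And>i. i \<in> I \<Longrightarrow> z * f i = (\<Sum>j\<in>I. of_int (N i j) * f j)"
  shows "algebraic_int z"
proof -
  define m where "m = card I"
  obtain h where h: "bij_betw h {0..<m} I" using ex_bij_betw_nat_finite[OF I] by (auto simp: m_def)
  define A :: "int mat" where "A = mat m m (\<lambda>(i, j). N (h i) (h j))"
  define v where "v = vec m (\<lambda>i. f (h i))"
  have A: "A \<in> carrier_mat m m" by (simp add: A_def)
  have "eigenvector (map_mat of_int A) v z"
    unfolding eigenvector_def
  proof (intro conjI)
    show "v \<in> carrier_vec (dim_row (map_mat of_int A))" by (simp add: v_def A_def)
    obtain i where i: "i \<in> I" "f i \<noteq> 0" using ne by blast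
    then obtain k where k: "k < m" "i = h k" using h by (auto simp: bij_betw_def)
    then have "v $ k \<noteq> 0" using i by (simp add: v_def)
    then show "v \<noteq> 0\<^sub>v (dim_row (map_mat of_int A))" using k by (auto simp: A_def)
    show "map_mat of_int A *\<^sub>v v = z \<cdot>\<^sub>v v"
    proof (rule eq_vecI)
      fix i assume "i < dim_vec (z \<cdot>\<^sub>v v)"
      then have i: "i < m" by (simp add: v_def)
      then have "h i \<in> I" using h by (auto simp: bij_betw_def)
      have "(map_mat of_int A *\<^sub>v v) $ i = (\<Sum>j\<in>{0..<m}. of_int (N (h i) (h j)) * f (h j))"
        using i by (simp add: A_def v_def scalar_prod_def)
      also have "\<dots> = (\<Sum>j\<in>I. of_int (N (h i) j) * f j)"
        by (rule sum.reindex_bij_betw[OF h])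
      also have "\<dots> = z * f (h i)" using rel[OF \<open>h i \<in> I\<close>] by simp
      finally show "(map_mat of_int A *\<^sub>v v) $ i = (z \<cdot>\<^sub>v v) $ i" using i by (simp add: v_def)
    qed (simp add: A_def v_def)
  qed
  then have "eigenvalue (map_mat of_int A) z" by (auto simp: eigenvalue_def)
  then have "poly (char_poly (map_mat of_int A)) z = 0"
    using eigenvalue_root_char_poly[of "map_mat of_int A" m z] A by simp
  then have "poly (map_poly of_int (char_poly A)) z = 0"
    using of_int_hom.char_poly_hom[OF A] by metis
  moreover have "lead_coeff (char_poly A) = 1" using degree_monic_char_poly[OF A] by simp
  ultimately show ?thesis unfolding algebraic_int_altdef_ipoly by blast
qed

lemma algebraic_int_power_relation:
  fixes x :: "'a::field_char_0"
  assumes "algebraic_int x"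
  obtains a N where "a > 0" "\<And>i. i < a \<Longrightarrow> x * x ^ i = (\<Sum>l<a. of_int (N i l) * x ^ l)"
proof -
  obtain P :: "int poly" where P: "poly (of_int_poly P) x = 0" "lead_coeff P = 1"
    using assms unfolding algebraic_int_altdef_ipoly by blast
  define a where "a = degree P"
  have a: "a > 0"
  proof (rule ccontr)
    assume "\<not> a > 0"
    then obtain c where "P = [:c:]" by (auto simp: a_def elim: degree_eq_zeroE)
    then show False using P by simp
  qed
  have top: "x ^ a = (\<Sum>l<a. of_int (- coeff P l) * x ^ l)"
  proof -
    have "0 = (\<Sum>l\<le>a. of_int (coeff P l) * x ^ l)"
      using P(1) by (simp add: poly_altdef a_def degree_map_poly)
    also have "\<dots> = (\<Sum>l<a. of_int (coeff P l) * x ^ l) + x ^ a"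
      using P(2) by (simp add: a_def lessThan_Suc_atMost[symmetric])
    finally show ?thesis by (simp add: sum_negf add_eq_0_iff)
  qed
  \<comment> \<open>The companion matrix of \<open>P\<close>: a shift, with the negated coefficients
    in the last row.\<close>
  define N where "N = (\<lambda>i l. if Suc i < a then (if l = Suc i then 1 else 0) else - coeff P l)"
  have "x * x ^ i = (\<Sum>l<a. of_int (N i l) * x ^ l)" if "i < a" for i
  proof (cases "Suc i < a")
    case True
    have "(\<Sum>l<a. of_int (N i l) * x ^ l) = (\<Sum>l<a. if l = Suc i then x ^ l else 0)"
      using True by (intro sum.cong) (auto simp: N_def)
    then show ?thesis using True by simp
  next
    case False
    then have "Suc i = a" using that by simp
    then show ?thesis using top False by (simp add: N_def flip: power_Suc)
  qed
  then show ?thesis using a that by blast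
qed

text \<open>The module spanned by the products x^i y^j is stable under \<open>x\<close> and
  \<open>y\<close>, hence under their sum and product. The integer matrices are the Kronecker sum
  and the Kronecker product of \<open>N\<close> and \<open>N'\<close>.\<close>

lemma
  fixes x y :: "'a::field_char_0"
  assumes "algebraic_int x" "algebraic_int y"
  shows algebraic_int_add: "algebraic_int (x + y)"
    and algebraic_int_mult: "algebraic_int (x * y)"
proof -
  obtain a N where N: "a > 0" "\<And>i. i < a \<Longrightarrow> x * x ^ i = (\<Sum>l<a. of_int (N i l) * x ^ l)"
    using algebraic_int_power_relation[OF assms(1)] by blast
  obtain b N' where N': "b > 0" "\<And>i. i < b \<Longrightarrow> y * y ^ i = (\<Sum>l<b. of_int (N' i l) * y ^ l)"
    using algebraic_int_power_relation[OF assms(2)] by blast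
  let ?I = "{..<a} \<times> {..<b}" and ?f = "\<lambda>(i, j). x ^ i * y ^ j"
  have ne: "\<exists>i\<in>?I. ?f i \<noteq> 0" using N(1) N'(1) by (intro bexI[of _ "(0, 0)"]) auto
  show "algebraic_int (x + y)"
  proof (rule algebraic_int_of_module[OF _ ne,
        where N = "\<lambda>(i, j) (l, m). (if m = j then N i l else 0) + (if l = i then N' j m else 0)"])
    fix ij assume "ij \<in> ?I"
    then obtain i j where ij: "ij = (i, j)" "i < a" "j < b" by auto
    have "(x + y) * ?f ij = (x * x ^ i) * y ^ j + x ^ i * (y * y ^ j)"
      by (simp add: ij algebra_simps)
    also have "\<dots> = (\<Sum>l<a. of_int (N i l) * x ^ l * y ^ j) + (\<Sum>m<b. of_int (N' j m) * x ^ i * y ^ m)"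
      unfolding N(2)[OF ij(2)] N'(2)[OF ij(3)] by (simp add: sum_distrib_left sum_distrib_right mult_ac)
    also have "\<dots> = (\<Sum>l<a. \<Sum>m<b. if m = j then of_int (N i l) * x ^ l * y ^ m else 0)
        + (\<Sum>l<a. if l = i then \<Sum>m<b. of_int (N' j m) * x ^ l * y ^ m else 0)"
      using ij by simp
    also have "\<dots> = (\<Sum>l<a. \<Sum>m<b. of_int ((if m = j then N i l else 0) + (if l = i then N' j m else 0)) * (x ^ l * y ^ m))"
      unfolding sum.distrib[symmetric]
    proof (intro sum.cong refl)
      fix l
      show "(\<Sum>m<b. if m = j then of_int (N i l) * x ^ l * y ^ m else 0)
        + (if l = i then \<Sum>m<b. of_int (N' j m) * x ^ l * y ^ m else 0)
        = (\<Sum>m<b. of_int ((if m = j then N i l else 0) + (if l = i then N' j m else 0)) * (x ^ l * y ^ m))"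
      proof -
        have "(\<Sum>m<b. of_int ((if m = j then N i l else 0) + (if l = i then N' j m else 0)) * (x ^ l * y ^ m))
          = (\<Sum>m<b. (if m = j then of_int (N i l) * x ^ l * y ^ m else 0)
            + (if l = i then of_int (N' j m) * x ^ l * y ^ m else 0))"
          by (intro sum.cong refl) (auto simp: algebra_simps)
        also have "\<dots> = (\<Sum>m<b. if m = j then of_int (N i l) * x ^ l * y ^ m else 0)
          + (if l = i then \<Sum>m<b. of_int (N' j m) * x ^ l * y ^ m else 0)"
          by (cases "l = i") (simp_all add: sum.distrib)
        finally show ?thesis by simp
      qed
    qed
    finally show "(x + y) * ?f ij = (\<Sum>lm\<in>?I. of_int ((\<lambda>(i, j) (l, m). (if m = j then N i l else 0)
        + (if l = i then N' j m else 0)) ij lm) * ?f lm)"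
      by (simp only: ij sum.cartesian_product split_def fst_conv snd_conv)
  qed simp
  show "algebraic_int (x * y)"
  proof (rule algebraic_int_of_module[OF _ ne, where N = "\<lambda>(i, j) (l, m). N i l * N' j m"])
    fix ij assume "ij \<in> ?I"
    then obtain i j where ij: "ij = (i, j)" "i < a" "j < b" by auto
    have "(x * y) * ?f ij = (x * x ^ i) * (y * y ^ j)" by (simp add: ij algebra_simps)
    also have "\<dots> = (\<Sum>l<a. \<Sum>m<b. of_int (N i l * N' j m) * (x ^ l * y ^ m))"
      unfolding N(2)[OF ij(2)] N'(2)[OF ij(3)] by (simp add: sum_product mult_ac)
    finally show "(x * y) * ?f ij = (\<Sum>lm\<in>?I. of_int ((\<lambda>(i, j) (l, m). N i l * N' j m) ij lm) * ?f lm)"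
      by (simp add: ij sum.cartesian_product split_def)
  qed simp
qed

lemma algebraic_int_diff:
  "algebraic_int x \<Longrightarrow> algebraic_int y \<Longrightarrow> algebraic_int (x - y :: 'a::field_char_0)"
  using algebraic_int_add[of x "- y"] by simp

lemma algebraic_int_sum:
  "(\<And>i. i \<in> I \<Longrightarrow> algebraic_int (f i :: 'a::field_char_0)) \<Longrightarrow> algebraic_int (\<Sum>i\<in>I. f i)"
  by (induction I rule: infinite_finite_induct) (auto intro: algebraic_int_add)

lemma algebraic_int_prod:
  "(\<And>i. i \<in> I \<Longrightarrow> algebraic_int (f i :: 'a::field_char_0)) \<Longrightarrow> algebraic_int (\<Prod>i\<in>I. f i)"
  by (induction I rule: infinite_finite_induct) (auto intro: algebraic_int_mult)

lemma algebraic_int_embedding: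
  assumes "\<sigma> \<in> complex_embeddings" "algebraic_int x"
  shows "algebraic_int (\<sigma> x)"
proof -
  obtain P :: "int poly" where P: "poly (of_int_poly P) x = 0" "lead_coeff P = 1"
    using assms unfolding algebraic_int_altdef_ipoly by blast
  have "\<sigma> (poly (of_int_poly Q) x) = poly (of_int_poly Q) (\<sigma> x)" for Q :: "int poly"
    by (induction Q) (simp_all add: map_poly_pCons embedding_0 embedding_of_int complex_embeddingsD assms)
  then have "poly (of_int_poly P) (\<sigma> x) = 0" using P(1) assms by (metis embedding_0)
  then show ?thesis using P(2) unfolding algebraic_int_altdef_ipoly by blast
qed

lemma of_rat_algebraic_int_complex:
  assumes "algebraic_int (of_rat q :: complex)"
  shows "q \<in> \<int>"
proof -
  have "of_rat q \<in> (\<int> :: complex set)" using assms by (rule rational_algebraic_int_is_int) simp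
  then obtain k where "of_rat q = (of_int k :: complex)" by (auto elim: Ints_cases)
  then have "of_rat q = (of_rat (of_int k) :: complex)" by simp
  then have "q = of_int k" by (simp only: of_rat_eq_iff)
  then show ?thesis by simp
qed

lemma common_denominator:
  fixes f :: "'i \<Rightarrow> rat"
  assumes "finite I"
  shows "\<exists>D::int. D > 0 \<and> (\<forall>i\<in>I. of_int D * f i \<in> \<int>)"
  using assms
proof (induction I)
  case (insert i I)
  then obtain D :: int where D: "D > 0" "\<forall>i\<in>I. of_int D * f i \<in> \<int>" by auto
  obtain a b where ab: "f i = Rat.Fract a b" "b > 0" by (cases "f i") auto
  have "of_int (b * D) * f i = of_int (D * a)"
    using ab by (simp add: Fract_of_int_quotient field_simps)
  moreover have "of_int (b * D) * f j \<in> \<int>" if "j \<in> I" for j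
    using D(2) that by (metis Ints_mult Ints_of_int mult.assoc of_int_mult)
  ultimately show ?case using D ab by (intro exI[of _ "b * D"]) (auto simp del: of_int_mult)
qed (auto intro: exI[of _ 1])

lemma det_integer:
  fixes A :: "rat mat"
  assumes "A \<in> carrier_mat m m" "\<And>i j. i < m \<Longrightarrow> j < m \<Longrightarrow> A $$ (i, j) \<in> \<int>"
  shows "det A \<in> \<int>"
  unfolding det_def' [OF assms(1)]
proof (intro Ints_sum Ints_mult Ints_prod)
  fix q i assume "q \<in> {q. q permutes {0..<m}}" "i \<in> {0..<m}"
  then show "A $$ (i, q i) \<in> \<int>" using assms(2) permutes_in_image[of q "{0..<m}" i] by auto
qed (auto simp: sign_def)

context primitive_number_field
begin

section \<open>Integrality of norm and trace\<close>

lemma ring_of_integers_norm: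
  assumes "x \<in> (ring_of_integers :: 'k set)"
  shows "field_norm x \<in> \<int>"
proof (rule of_rat_algebraic_int_complex)
  show "algebraic_int (complex_of_rat (field_norm x))"
    using assms unfolding field_norm_eq_prod
    by (intro algebraic_int_prod) (rule algebraic_int_embedding, auto simp: ring_of_integers_def)
qed

lemma ring_of_integers_trace:
  assumes "x \<in> (ring_of_integers :: 'k set)"
  shows "field_trace x \<in> \<int>"
proof (rule of_rat_algebraic_int_complex)
  show "algebraic_int (complex_of_rat (field_trace x))"
    using assms unfolding field_trace_eq_sum
    by (intro algebraic_int_sum) (rule algebraic_int_embedding, auto simp: ring_of_integers_def)
qed

text \<open>With D a common denominator of the matrix of \<open>x\<close> in the power basis, D x
  acts on the powers of \<gamma> by an integer matrix.\<close>

lemma integral_multiple: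
  fixes x :: 'k
  obtains D :: int where "D > 0" "of_int D * x \<in> ring_of_integers"
proof -
  have "\<forall>i. \<exists>c. x * \<gamma> ^ i = (\<Sum>j<n. of_rat (c j) * \<gamma> ^ j)" using power_basis_span by blast
  then obtain c where c: "\<And>i. x * \<gamma> ^ i = (\<Sum>j<n. of_rat (c i j) * \<gamma> ^ j)" by metis
  obtain D :: int where D: "D > 0" "\<forall>ij\<in>{..<n} \<times> {..<n}. of_int D * (case ij of (i, j) \<Rightarrow> c i j) \<in> \<int>"
    using common_denominator[of "{..<n} \<times> {..<n}" "\<lambda>(i, j). c i j"] by auto
  define N where "N = (\<lambda>i j. \<lfloor>of_int D * c i j\<rfloor>)"
  have N: "of_int (N i j) = of_int D * c i j" if "i < n" "j < n" for i j
  proof -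
    have "of_int D * c i j \<in> \<int>" using D(2) that by auto
    then show ?thesis by (auto simp: N_def elim!: Ints_cases)
  qed
  have "algebraic_int (of_int D * x)"
  proof (rule algebraic_int_of_module)
    show "\<exists>i\<in>{..<n}. \<gamma> ^ i \<noteq> 0" using n_pos by (intro bexI[of _ 0]) auto
    fix i assume i: "i \<in> {..<n}"
    have "of_int D * x * \<gamma> ^ i = (\<Sum>j<n. of_rat (of_int D * c i j) * \<gamma> ^ j)"
      unfolding mult.assoc c by (simp add: sum_distrib_left of_rat_mult mult_ac)
    also have "\<dots> = (\<Sum>j<n. of_int (N i j) * \<gamma> ^ j)"
    proof (intro sum.cong refl)
      fix j assume "j \<in> {..<n}"
      then have "of_int D * c i j = of_int (N i j)" using N i by simp
      then show "of_rat (of_int D * c i j) * \<gamma> ^ j = of_int (N i j) * \<gamma> ^ j"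
        by (simp only: of_rat_of_int_eq)
    qed
    finally show "of_int D * x * \<gamma> ^ i = (\<Sum>j<n. of_int (N i j) * \<gamma> ^ j)" .
  qed simp
  then show ?thesis using D(1) that by (simp add: ring_of_integers_def)
qed

lemma of_rat_det_trace_form:
  assumes "length bs = n"
  shows "of_rat (det (trace_form_matrix (bs :: 'k list))) = det (emb_mat bs) ^ 2"
proof -
  have "trace_form_matrix bs = mat n n (\<lambda>(i, j). field_trace (1 * bs ! i * bs ! j))"
    using assms by (simp add: trace_form_matrix_def)
  moreover have "of_rat (field_norm (1 :: 'k)) = (1 :: complex)"
    by (simp add: field_norm_eq_prod complex_embeddingsD)
  ultimately show ?thesis using det_twisted_trace_form[OF assms, of 1] by simp
qed

lemma det_trace_form_integer:
  assumes "length bs = n" "set bs \<subseteq> (ring_of_integers :: 'k set)"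
  shows "det (trace_form_matrix bs) \<in> \<int>"
proof (rule det_integer)
  show "trace_form_matrix bs \<in> carrier_mat n n" using assms by (simp add: trace_form_matrix_def)
  fix i j assume "i < n" "j < n"
  moreover from this have "bs ! i * bs ! j \<in> ring_of_integers"
    using assms by (auto simp: ring_of_integers_def subset_iff intro!: algebraic_int_mult)
  ultimately show "trace_form_matrix bs $$ (i, j) \<in> \<int>"
    using assms ring_of_integers_trace by (simp add: trace_form_matrix_def)
qed

section \<open>Coordinates and integral bases\<close>

lemma emb_mat_relation:
  assumes "det (emb_mat bs) \<noteq> 0" "(\<Sum>j<n. of_rat (c j) * bs ! j) = 0" "j < n"
  shows "c j = 0"
proof -
  have "emb_mat bs *\<^sub>v vec n (\<lambda>j. of_rat (c j)) = 0\<^sub>v n"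
  proof (rule eq_vecI)
    fix i assume "i < dim_vec (0\<^sub>v n)"
    then have i: "i < n" by simp
    have "(emb_mat bs *\<^sub>v vec n (\<lambda>j. of_rat (c j))) $ i = (emb_list ! i) (\<Sum>j<n. of_rat (c j) * bs ! j)"
      using i by (simp add: emb_mat_def scalar_prod_def atLeast0LessThan embedding_sum emb_list_nth
          complex_embeddingsD embedding_of_rat mult.commute)
    then show "(emb_mat bs *\<^sub>v vec n (\<lambda>j. of_rat (c j))) $ i = 0\<^sub>v n $ i"
      using assms(2) i by (simp add: embedding_0 emb_list_nth)
  qed (simp add: emb_mat_def)
  then have "vec n (\<lambda>j. of_rat (c j) :: complex) = 0\<^sub>v n"
    using assms(1) det_0_iff_vec_prod_zero[OF emb_mat_carrier, of bs] by (metis vec_carrier)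
  then have "vec n (\<lambda>j. of_rat (c j) :: complex) $ j = 0\<^sub>v n $ j" by simp
  then show ?thesis using assms(3) by simp
qed

text \<open>Cramer's rule.\<close>

lemma det_emb_mat_update:
  assumes "length bs = n" "k < n"
  shows "det (emb_mat (bs[k := \<Sum>j<n. of_rat (c j) * bs ! j])) = of_rat (c k) * det (emb_mat bs)"
proof -
  let ?v = "vec n (\<lambda>j. of_rat (c j) :: complex)"
  have "emb_mat (bs[k := \<Sum>j<n. of_rat (c j) * bs ! j]) = replace_col (emb_mat bs) (emb_mat bs *\<^sub>v ?v) k"
  proof (rule eq_matI)
    fix i j assume "i < dim_row (replace_col (emb_mat bs) (emb_mat bs *\<^sub>v ?v) k)"
      "j < dim_col (replace_col (emb_mat bs) (emb_mat bs *\<^sub>v ?v) k)"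
    then have ij: "i < n" "j < n" by (simp_all add: replace_col_def emb_mat_def)
    show "emb_mat (bs[k := \<Sum>j<n. of_rat (c j) * bs ! j]) $$ (i, j)
      = replace_col (emb_mat bs) (emb_mat bs *\<^sub>v ?v) k $$ (i, j)"
      using ij assms
      by (simp add: replace_col_def emb_mat_def scalar_prod_def atLeast0LessThan embedding_sum emb_list_nth
          complex_embeddingsD embedding_of_rat mult.commute)
  qed (simp_all add: replace_col_def emb_mat_def)
  then show ?thesis using cramer_lemma_mat[OF emb_mat_carrier vec_carrier assms(2)] assms(2) by simp
qed

text \<open>Among the spanning lists of algebraic integers take one of least absolute discriminant.
  If an algebraic integer had a fractional coordinate \<open>c k\<close>, then one with k-th
  coordinate \<open>frac (c k)\<close> could replace the k-th entry, and the discriminant would be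
  multiplied by the square of this fraction, which is below 1.\<close>

lemma integral_basis_exists: "\<exists>bs :: 'k list. is_integral_basis bs"
proof -
  define good where "good = (\<lambda>bs :: 'k list. rat_spanning bs \<and> set bs \<subseteq> ring_of_integers)"
  have "\<forall>i. \<exists>D::int. D > 0 \<and> of_int D * \<gamma> ^ i \<in> ring_of_integers" using integral_multiple by metis
  then obtain D :: "nat \<Rightarrow> int" where D: "\<And>i. D i > 0" "\<And>i. of_int (D i) * \<gamma> ^ i \<in> ring_of_integers" by metis
  have "good (map (\<lambda>i. of_int (D i) * \<gamma> ^ i) [0..<n])"
    unfolding good_def rat_spanning_def
  proof (intro conjI allI)
    fix x :: 'k
    obtain c where c: "x = (\<Sum>i<n. of_rat (c i) * \<gamma> ^ i)" using power_basis_span by blast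
    have D0: "D i \<noteq> 0" for i using D(1)[of i] by simp
    have "x = (\<Sum>j<n. of_rat (c j / of_int (D j)) * map (\<lambda>i. of_int (D i) * \<gamma> ^ i) [0..<n] ! j)"
      unfolding c by (intro sum.cong refl) (simp add: of_rat_divide D0)
    then show "\<exists>c. x = (\<Sum>j<n. of_rat (c j) * map (\<lambda>i. of_int (D i) * \<gamma> ^ i) [0..<n] ! j)"
      by (rule exI[of _ "\<lambda>j. c j / of_int (D j)"])
  qed (use D in auto)
  \<comment> \<open>These determinants are integers, so the floor loses nothing and the minimum is
    one over natural numbers.\<close>
  then obtain bs where bs: "good bs"
    and least: "\<And>bs'. good bs' \<Longrightarrow> nat \<lfloor>\<bar>det (trace_form_matrix bs)\<bar>\<rfloor> \<le> nat \<lfloor>\<bar>det (trace_form_matrix bs')\<bar>\<rfloor>"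
    using ex_has_least_nat[of good _ "\<lambda>bs. nat \<lfloor>\<bar>det (trace_form_matrix bs)\<bar>\<rfloor>"] by blast
  have len: "length bs = n" and E: "det (emb_mat bs) \<noteq> 0" and int: "set bs \<subseteq> ring_of_integers"
    using bs det_emb_mat_nonzero by (auto simp: good_def rat_spanning_def)
  have coords: "c k \<in> \<int>" if x: "(\<Sum>j<n. of_rat (c j) * bs ! j) \<in> ring_of_integers" and k: "k < n" for c k
  proof (rule ccontr)
    assume nint: "c k \<notin> \<int>"
    define c' where "c' = (\<lambda>j. if j = k then frac (c k) else c j)"
    let ?y = "\<Sum>j<n. of_rat (c' j) * bs ! j"
    have "?y = (\<Sum>j<n. of_rat (c j) * bs ! j - (if j = k then of_int \<lfloor>c k\<rfloor> * bs ! k else 0))"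
      by (intro sum.cong refl) (auto simp: c'_def frac_def of_rat_diff algebra_simps)
    also have "\<dots> = (\<Sum>j<n. of_rat (c j) * bs ! j) - of_int \<lfloor>c k\<rfloor> * bs ! k"
      using k by (simp add: sum_subtractf)
    finally have y: "?y = (\<Sum>j<n. of_rat (c j) * bs ! j) - of_int \<lfloor>c k\<rfloor> * bs ! k" .
    have yint: "?y \<in> ring_of_integers"
      unfolding y using x int k len
      by (auto simp: ring_of_integers_def subset_iff intro!: algebraic_int_diff algebraic_int_mult)
    let ?bs = "bs[k := ?y]"
    have det': "det (emb_mat ?bs) = of_rat (frac (c k)) * det (emb_mat bs)"
      using det_emb_mat_update[OF len k, of c'] by (simp add: c'_def)
    have frac: "0 < frac (c k)" "frac (c k) < 1" using nint frac_gt_0_iff frac_lt_1 by blast+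
    have "good ?bs"
      unfolding good_def rat_spanning_def
    proof (intro conjI allI)
      show "length ?bs = n" using len by simp
      show "set ?bs \<subseteq> ring_of_integers" using int yint set_update_subset_insert[of bs k ?y] by auto
      fix z :: 'k
      obtain a where a: "z = (\<Sum>j<n. of_rat (a j) * bs ! j)"
        using bs by (auto simp: good_def rat_spanning_def)
      \<comment> \<open>The coefficient of the new entry \<open>?y\<close>, fixed by the k-th
        coordinate; the other coordinates are then corrected by \<open>t * c' j\<close>.\<close>
      define t where "t = a k / frac (c k)"
      have "(\<Sum>j<n. of_rat (if j = k then t else a j - t * c' j) * ?bs ! j)
        = (\<Sum>j<n. (if j = k then of_rat t * ?y else 0) + (if j = k then 0 else of_rat (a j - t * c' j) * bs ! j))"
        using len by (intro sum.cong refl) auto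
      also have "\<dots> = of_rat t * ?y + (\<Sum>j<n. if j = k then 0 else of_rat (a j - t * c' j) * bs ! j)"
        using k by (simp add: sum.distrib)
      also have "(\<Sum>j<n. if j = k then 0 else of_rat (a j - t * c' j) * bs ! j)
        = (\<Sum>j<n. of_rat (a j) * bs ! j - of_rat t * (of_rat (c' j) * bs ! j))"
        using frac by (intro sum.cong refl) (auto simp: c'_def t_def of_rat_diff of_rat_mult of_rat_divide algebra_simps)
      also have "\<dots> = z - of_rat t * ?y" by (simp add: a sum_subtractf sum_distrib_left)
      finally have "z = (\<Sum>j<n. of_rat (if j = k then t else a j - t * c' j) * ?bs ! j)" by simp
      then show "\<exists>c. z = (\<Sum>j<n. of_rat (c j) * ?bs ! j)"
        by (rule exI[of _ "\<lambda>j. if j = k then t else a j - t * c' j"])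
    qed
    have "complex_of_rat (det (trace_form_matrix ?bs)) = of_rat (frac (c k) ^ 2 * det (trace_form_matrix bs))"
      using det' len by (simp add: of_rat_det_trace_form of_rat_mult of_rat_power power_mult_distrib)
    then have disc: "det (trace_form_matrix ?bs) = frac (c k) ^ 2 * det (trace_form_matrix bs)"
      by (simp only: of_rat_eq_iff)
    have "of_rat (det (trace_form_matrix bs)) \<noteq> (0 :: complex)"
      using E len by (simp add: of_rat_det_trace_form)
    then have d0: "det (trace_form_matrix bs) \<noteq> 0" by auto
    have "frac (c k) ^ 2 < 1" using frac by (simp add: power_less_one_iff abs_square_less_1)
    then have lt: "\<bar>det (trace_form_matrix ?bs)\<bar> < \<bar>det (trace_form_matrix bs)\<bar>"
      unfolding disc using d0 by (simp add: abs_mult)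
    have new: "length ?bs = n" "set ?bs \<subseteq> ring_of_integers"
      using \<open>good ?bs\<close> unfolding good_def rat_spanning_def by blast+
    obtain u where u: "det (trace_form_matrix ?bs) = of_int u"
      using det_trace_form_integer[OF new] by (rule Ints_cases)
    obtain v where v: "det (trace_form_matrix bs) = of_int v"
      using det_trace_form_integer[OF len int] by (rule Ints_cases)
    note uv = u v
    have "nat \<bar>v\<bar> \<le> nat \<bar>u\<bar>" using least[OF \<open>good ?bs\<close>] unfolding uv by (simp flip: of_int_abs)
    then show False using lt unfolding uv by (simp flip: of_int_abs)
  qed
  have "is_integral_basis bs"
    unfolding is_integral_basis_def
  proof (intro conjI ballI)
    fix x :: 'k assume x: "x \<in> ring_of_integers"
    obtain c where c: "x = (\<Sum>j<n. of_rat (c j) * bs ! j)" using bs by (auto simp: good_def rat_spanning_def)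
    have cint: "c j = of_int \<lfloor>c j\<rfloor>" if "j < n" for j
      using coords[of c j] x c that by (auto elim: Ints_cases)
    show "\<exists>!a::int list. length a = length bs \<and> x = (\<Sum>i<length bs. of_int (a ! i) * bs ! i)"
    proof (rule ex1I[of _ "map (\<lambda>j. \<lfloor>c j\<rfloor>) [0..<n]"])
      have "of_rat (c j) = (of_int \<lfloor>c j\<rfloor> :: 'k)" if "j < n" for j
        using cint[OF that] by (metis of_rat_of_int_eq)
      then show "length (map (\<lambda>j. \<lfloor>c j\<rfloor>) [0..<n]) = length bs \<and>
        x = (\<Sum>i<length bs. of_int (map (\<lambda>j. \<lfloor>c j\<rfloor>) [0..<n] ! i) * bs ! i)"
        using len c by simp
      fix a :: "int list" assume a: "length a = length bs \<and> x = (\<Sum>i<length bs. of_int (a ! i) * bs ! i)"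
      have "(\<Sum>j<n. of_rat (of_int (a ! j) - c j) * bs ! j) = 0"
        using a c len by (simp add: of_rat_diff algebra_simps sum_subtractf)
      then have "of_int (a ! j) - c j = 0" if "j < n" for j
        using emb_mat_relation[OF E, of "\<lambda>j. of_int (a ! j) - c j"] that by blast
      then have "a ! j = \<lfloor>c j\<rfloor>" if "j < n" for j
        using that by (metis eq_iff_diff_eq_0 floor_of_int)
      then show "a = map (\<lambda>j. \<lfloor>c j\<rfloor>) [0..<n]"
        using a len by (intro nth_equalityI) auto
    qed
  qed (use int in auto)
  then show ?thesis by blast
qed

text \<open>Uniqueness of the expansion of 0 excludes relations over the integers, and clearing
  denominators those over the rationals. This settles the length of an integral basis, which the
  definition leaves open.\<close>

lemma integral_basis_is_rat_basis:
  assumes "is_integral_basis (bs :: 'k list)"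
  shows "is_rat_basis bs"
proof -
  have uniq: "a = replicate (length bs) 0"
    if "length a = length bs" "(\<Sum>i<length bs. of_int (a ! i) * bs ! i) = 0" for a :: "int list"
  proof -
    have all: "\<forall>x\<in>ring_of_integers. \<exists>!c::int list. length c = length bs \<and>
        x = (\<Sum>i<length bs. of_int (c ! i) * bs ! i)"
      using assms unfolding is_integral_basis_def by blast
    have "0 \<in> (ring_of_integers :: 'k set)" by (simp add: ring_of_integers_def)
    then obtain c0 where c0: "\<And>c::int list. length c = length bs \<and>
        0 = (\<Sum>i<length bs. of_int (c ! i) * bs ! i) \<Longrightarrow> c = c0"
      using bspec[OF all] by blast
    have "a = c0" using that by (intro c0) simp
    moreover have "replicate (length bs) 0 = c0" by (intro c0) simp
    ultimately show ?thesis by simp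
  qed
  have dist: "distinct bs"
  proof (rule ccontr)
    assume "\<not> distinct bs"
    then obtain i j where ij: "i < length bs" "j < length bs" "i \<noteq> j" "bs ! i = bs ! j"
      by (auto simp: distinct_conv_nth)
    define a where "a = map (\<lambda>l. if l = i then 1 else if l = j then - 1 else (0::int)) [0..<length bs]"
    have "(\<Sum>l<length bs. of_int (a ! l) * bs ! l) = (\<Sum>l\<in>{i, j}. of_int (a ! l) * bs ! l)"
      using ij by (intro sum.mono_neutral_right) (auto simp: a_def)
    also have "\<dots> = 0" using ij by (simp add: a_def)
    finally have "a = replicate (length bs) 0" by (intro uniq) (simp_all add: a_def)
    then have "a ! i = 0" using ij by simp
    then show False using ij by (simp add: a_def)
  qed
  have bij: "bij_betw (\<lambda>i. bs ! i) {..<length bs} (set bs)"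
    using dist by (intro bij_betw_nth) auto
  have "\<not> rat_dependent (set bs)"
  proof
    assume "rat_dependent (set bs)"
    then obtain u where u: "\<exists>v\<in>set bs. u v \<noteq> 0" "(\<Sum>v\<in>set bs. of_rat (u v) * v) = 0"
      by (subst (asm) rat_vs.dependent_finite) auto
    obtain D :: int where D: "D > 0" "\<forall>v\<in>set bs. of_int D * u v \<in> \<int>"
      using common_denominator[of "set bs" u] by auto
    define a where "a = map (\<lambda>i. \<lfloor>of_int D * u (bs ! i)\<rfloor>) [0..<length bs]"
    have a: "of_int (a ! i) = of_int D * u (bs ! i)" if "i < length bs" for i
    proof -
      have "of_int D * u (bs ! i) \<in> \<int>" using D(2) that by auto
      then show ?thesis using that by (auto simp: a_def elim!: Ints_cases)
    qed
    have "(\<Sum>i<length bs. of_int (a ! i) * bs ! i) = (\<Sum>i<length bs. of_int D * (of_rat (u (bs ! i)) * bs ! i))"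
    proof (intro sum.cong refl)
      fix i assume "i \<in> {..<length bs}"
      then have "of_rat (of_int (a ! i)) = (of_rat (of_int D * u (bs ! i)) :: 'k)" using a by simp
      then show "of_int (a ! i) * bs ! i = of_int D * (of_rat (u (bs ! i)) * bs ! i)"
        by (simp add: of_rat_mult)
    qed
    also have "\<dots> = of_int D * (\<Sum>v\<in>set bs. of_rat (u v) * v)"
      by (simp add: sum_distrib_left[symmetric] sum.reindex_bij_betw[OF bij, of "\<lambda>v. of_rat (u v) * v"])
    finally have "a = replicate (length bs) 0" using u(2) by (intro uniq) (simp_all add: a_def)
    then have "u (bs ! i) = 0" if "i < length bs" for i using a[OF that] D(1) that by simp
    then show False using u(1) by (auto simp: in_set_conv_nth)
  qed
  moreover have "x \<in> rat_span (set bs)" for x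
  proof -
    obtain D :: int where D: "D > 0" "of_int D * x \<in> ring_of_integers" using integral_multiple .
    then obtain a :: "int list" where a: "of_int D * x = (\<Sum>i<length bs. of_int (a ! i) * bs ! i)"
      using assms unfolding is_integral_basis_def by blast
    have "x = of_rat (1 / of_int D) * (\<Sum>i<length bs. of_rat (of_int (a ! i)) * bs ! i)"
      using D(1) a by (simp add: of_rat_divide field_simps)
    also have "\<dots> \<in> rat_span (set bs)"
      by (intro rat_vs.span_scale rat_vs.span_sum rat_vs.span_base) auto
    finally show ?thesis .
  qed
  ultimately show ?thesis using dist by (auto simp: is_rat_basis_def)
qed

text \<open>The very choice made in \<open>field_discriminant\<close>, so that the discriminant need
  not be compared between different bases.\<close>

definition int_basis :: "'k list" where
  "int_basis = (SOME bs. is_integral_basis bs)"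

lemma int_basis: "is_integral_basis int_basis"
  unfolding int_basis_def using integral_basis_exists by (rule someI_ex)

lemma int_basis_spanning: "rat_spanning int_basis"
  using integral_basis_is_rat_basis[OF int_basis] is_rat_basis_spanning by blast

lemma int_basis_length: "length int_basis = n"
  using int_basis_spanning by (simp add: rat_spanning_def)

lemma int_basis_in: "j < n \<Longrightarrow> int_basis ! j \<in> ring_of_integers"
  using int_basis int_basis_length by (auto simp: is_integral_basis_def)

lemma ring_of_integers_int_basis:
  "x \<in> ring_of_integers \<longleftrightarrow> (\<exists>a::nat \<Rightarrow> int. x = (\<Sum>j<n. of_int (a j) * int_basis ! j))"
proof
  assume "x \<in> ring_of_integers"
  then obtain a :: "int list" where "x = (\<Sum>i<n. of_int (a ! i) * int_basis ! i)"
    using int_basis unfolding is_integral_basis_def int_basis_length by blast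
  then show "\<exists>a::nat \<Rightarrow> int. x = (\<Sum>j<n. of_int (a j) * int_basis ! j)"
    by (rule exI[of _ "\<lambda>i. a ! i"])
next
  assume "\<exists>a::nat \<Rightarrow> int. x = (\<Sum>j<n. of_int (a j) * int_basis ! j)"
  then show "x \<in> ring_of_integers"
    using int_basis_in
    by (auto simp: ring_of_integers_def intro!: algebraic_int_sum algebraic_int_mult)
qed

section \<open>Discriminant, norm and codifferent\<close>

lemma field_discriminant_eq: "of_rat (field_discriminant TYPE('k)) = det (emb_mat int_basis) ^ 2"
  unfolding field_discriminant_def int_basis_def[symmetric]
  by (rule of_rat_det_trace_form[OF int_basis_length])

lemma det_int_basis_nonzero: "det (emb_mat int_basis) \<noteq> 0"
  by (rule det_emb_mat_nonzero[OF int_basis_spanning])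

lemma field_discriminant_abs_ge_1: "\<bar>real_of_rat (field_discriminant TYPE('k))\<bar> \<ge> 1"
proof -
  have "field_discriminant TYPE('k) \<in> \<int>"
    unfolding field_discriminant_def int_basis_def[symmetric]
    using int_basis int_basis_length by (intro det_trace_form_integer) (auto simp: is_integral_basis_def)
  then obtain k where k: "field_discriminant TYPE('k) = of_int k" by (auto elim: Ints_cases)
  moreover have "field_discriminant TYPE('k) \<noteq> 0"
    using field_discriminant_eq det_int_basis_nonzero by (metis of_rat_0 power_eq_0_iff)
  ultimately show ?thesis by (simp flip: of_int_abs)
qed

lemma abs_discriminant: "\<bar>real_of_rat (field_discriminant TYPE('k))\<bar> = (cmod (det (emb_mat int_basis)))\<^sup>2"
proof -
  have "complex_of_rat q = of_real (real_of_rat q)" for q by (cases q) (simp add: of_rat_rat)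
  then have "\<bar>real_of_rat (field_discriminant TYPE('k))\<bar> = cmod (of_rat (field_discriminant TYPE('k)))"
    by simp
  then show ?thesis by (simp add: field_discriminant_eq norm_power)
qed

lemma abs_norm_eq: "real_of_rat (abs_norm x) = (\<Prod>\<sigma>\<in>complex_embeddings. cmod (\<sigma> (x::'k)))"
proof -
  have "complex_of_rat q = of_real (real_of_rat q)" for q by (cases q) (simp add: of_rat_rat)
  then have "cmod (of_rat q) = \<bar>real_of_rat q\<bar>" for q by (metis norm_of_real)
  then have "real_of_rat (abs_norm x) = cmod (of_rat (field_norm x))"
    by (simp add: abs_norm_def)
  then show ?thesis by (simp add: field_norm_eq_prod prod_norm)
qed

lemma abs_norm_ring_of_integers:
  assumes "x \<in> (ring_of_integers :: 'k set)" "x \<noteq> 0"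
  shows "real_of_rat (abs_norm x) \<ge> 1"
proof -
  obtain k where k: "field_norm x = of_int k"
    using ring_of_integers_norm[OF assms(1)] by (auto elim: Ints_cases)
  have "complex_of_rat (field_norm x) \<noteq> 0" unfolding field_norm_eq_prod using assms(2) by simp
  then have "k \<noteq> 0" using k by auto
  then show ?thesis by (simp add: abs_norm_def k flip: of_int_abs)
qed

text \<open>Such a \<open>w\<close> lies in the codifferent, so the form tr(w a b) takes integer
  values on the integral basis. Its determinant, the norm of \<open>w\<close> times the
  discriminant, is then a nonzero integer.\<close>

lemma codifferent_norm_ge:
  assumes "w \<noteq> 0" "\<And>j. j < n \<Longrightarrow> field_trace (w * int_basis ! j) \<in> \<int>"
  shows "real_of_rat (abs_norm (w::'k)) * \<bar>real_of_rat (field_discriminant TYPE('k))\<bar> \<ge> 1"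
proof -
  have tr: "field_trace (w * x) \<in> \<int>" if "x \<in> ring_of_integers" for x
  proof -
    obtain a :: "nat \<Rightarrow> int" where a: "x = (\<Sum>j<n. of_int (a j) * int_basis ! j)"
      using ring_of_integers_int_basis \<open>x \<in> ring_of_integers\<close> by blast
    have "complex_of_rat (field_trace (w * x)) = (\<Sum>\<sigma>\<in>complex_embeddings. \<Sum>j<n. of_int (a j) * \<sigma> (w * int_basis ! j))"
      unfolding field_trace_eq_sum a sum_distrib_left
      by (intro sum.cong refl) (simp add: embedding_sum complex_embeddingsD embedding_of_int mult_ac)
    also have "\<dots> = of_rat (\<Sum>j<n. of_int (a j) * field_trace (w * int_basis ! j))"
      by (subst sum.swap) (simp add: of_rat_sum of_rat_mult field_trace_eq_sum sum_distrib_left)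
    finally have "field_trace (w * x) = (\<Sum>j<n. of_int (a j) * field_trace (w * int_basis ! j))"
      by (simp only: of_rat_eq_iff)
    then show ?thesis using assms(2) by (auto intro!: Ints_sum Ints_mult)
  qed
  let ?T = "mat n n (\<lambda>(i, j). field_trace (w * int_basis ! i * int_basis ! j))"
  have "det ?T \<in> \<int>"
  proof (rule det_integer)
    fix i j assume ij: "i < n" "j < n"
    have "int_basis ! i * int_basis ! j \<in> ring_of_integers"
      using int_basis_in ij by (auto simp: ring_of_integers_def intro!: algebraic_int_mult)
    then show "?T $$ (i, j) \<in> \<int>" using tr ij by (simp add: mult.assoc)
  qed simp
  moreover have "complex_of_rat (det ?T) = of_rat (field_norm w * field_discriminant TYPE('k))"
    using det_twisted_trace_form[OF int_basis_length, of w] by (simp add: field_discriminant_eq of_rat_mult)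
  then have "det ?T = field_norm w * field_discriminant TYPE('k)" by (simp only: of_rat_eq_iff)
  ultimately obtain k where k: "field_norm w * field_discriminant TYPE('k) = of_int k"
    by (auto elim: Ints_cases)
  have "complex_of_rat (field_norm w) \<noteq> 0" unfolding field_norm_eq_prod using assms(1) by simp
  moreover have "field_discriminant TYPE('k) \<noteq> 0"
    using field_discriminant_abs_ge_1 by auto
  ultimately have "k \<noteq> 0" using k by auto
  have "real_of_rat (abs_norm w) * \<bar>real_of_rat (field_discriminant TYPE('k))\<bar>
    = real_of_rat \<bar>field_norm w * field_discriminant TYPE('k)\<bar>"
    by (simp add: abs_norm_def abs_mult of_rat_mult)
  also have "\<dots> \<ge> 1" using \<open>k \<noteq> 0\<close> unfolding k by (simp flip: of_int_abs)
  finally show ?thesis .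
qed

end

section \<open>Geometry of numbers\<close>

no_notation vec_index (infixl "$" 100)
no_notation scalar_prod (infix "\<bullet>" 70)
no_notation fps_nth (infixl "$" 75)

text \<open>Cut \<open>S\<close> along the half-open integer cubes and move all pieces into the unit
  cube. If no two points differed by an integer vector, the moved pieces would be disjoint and the
  measure at most 1.\<close>

lemma blichfeldt:
  fixes S :: "(real^'n) set"
  assumes S: "S \<in> lmeasurable" "bounded S" "measure lebesgue S > 1"
  shows "\<exists>x\<in>S. \<exists>y\<in>S. x \<noteq> y \<and> (\<forall>i. (x - y) $ i \<in> \<int>)"
proof (rule ccontr)
  assume no: "\<not> (\<exists>x\<in>S. \<exists>y\<in>S. x \<noteq> y \<and> (\<forall>i. (x - y) $ i \<in> \<int>))"
  then have inj: "x = y" if "x \<in> S" "y \<in> S" "\<And>i. (x - y) $ i \<in> \<int>" for x y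
    using that no by blast
  obtain B where B: "\<And>x. x \<in> S \<Longrightarrow> norm x \<le> B" using S(2) by (auto simp: bounded_iff)
  define N where "N = \<lceil>B\<rceil> + 1"
  define vec_of :: "('n \<Rightarrow> int) \<Rightarrow> real^'n" where "vec_of f = (\<chi> i. of_int (f i))" for f
  \<comment> \<open>Boundedness of \<open>S\<close> leaves finitely many cubes, so finite additivity
    is enough.\<close>
  define F where "F = (UNIV :: 'n set) \<rightarrow>\<^sub>E {- N..N}"
  define C where "C f = S \<inter> {x. \<forall>i. of_int (f i) \<le> x $ i \<and> x $ i < of_int (f i) + 1}" for f :: "'n \<Rightarrow> int"
  have finF: "finite F" unfolding F_def by (intro finite_PiE) auto
  have Cm: "C f \<in> lmeasurable" for f
  proof -
    have "{x::real^'n. \<forall>i. of_int (f i) \<le> x $ i \<and> x $ i < of_int (f i) + 1}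
      = (\<Inter>i. {x. of_int (f i) \<le> x $ i} \<inter> {x. x $ i < of_int (f i) + 1})" by auto
    also have "\<dots> \<in> sets borel"
      by (intro sets.countable_INT' sets.Int borel_closed borel_open closed_Collect_le open_Collect_less
          continuous_intros) auto
    finally show ?thesis unfolding C_def using S(1) by (intro fmeasurable_Int_fmeasurable) auto
  qed
  have Scov: "S = (\<Union>f\<in>F. C f)"
  proof
    show "S \<subseteq> (\<Union>f\<in>F. C f)"
    proof
      fix x assume x: "x \<in> S"
      have "\<lfloor>x $ i\<rfloor> \<in> {- N..N}" for i
      proof -
        have "\<bar>x $ i\<bar> \<le> B" using component_le_norm_cart[of x i] B[OF x] by linarith
        then show ?thesis unfolding N_def by (simp add: le_floor_iff floor_le_iff abs_le_iff) linarith
      qed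
      then have "(\<lambda>i. \<lfloor>x $ i\<rfloor>) \<in> F" by (auto simp: F_def)
      moreover have "x \<in> C (\<lambda>i. \<lfloor>x $ i\<rfloor>)" using x by (auto simp: C_def)
      ultimately show "x \<in> (\<Union>f\<in>F. C f)" by blast
    qed
  qed (auto simp: C_def)
  have disjC: "disjoint_family_on C F"
    unfolding disjoint_family_on_def
  proof (intro ballI impI)
    fix f g :: "'n \<Rightarrow> int" assume "f \<noteq> g"
    then obtain i where "f i \<noteq> g i" by auto
    then show "C f \<inter> C g = {}" by (force simp: C_def dest: spec[of _ i])
  qed
  define T where "T f = (+) (- vec_of f) ` C f" for f
  have Tm: "T f \<in> lmeasurable" for f unfolding T_def using Cm by (rule measurable_translation)
  have disjT: "disjoint_family_on T F"
    unfolding disjoint_family_on_def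
  proof (intro ballI impI)
    fix f g assume fg: "f \<in> F" "g \<in> F" "f \<noteq> g"
    show "T f \<inter> T g = {}"
    proof (rule ccontr)
      assume "T f \<inter> T g \<noteq> {}"
      then obtain x y where xy: "x \<in> C f" "y \<in> C g" "- vec_of f + x = - vec_of g + y"
        by (auto simp: T_def)
      have "(x - y) $ i \<in> \<int>" for i
      proof -
        have "(- vec_of f + x) $ i = (- vec_of g + y) $ i" using xy(3) by simp
        then have "(x - y) $ i = of_int (f i - g i)" by (simp add: vec_of_def)
        then show ?thesis by (metis Ints_of_int)
      qed
      then have "x = y" using xy inj by (auto simp: C_def)
      then show False using xy disjC fg by (auto simp: disjoint_family_on_def)
    qed
  qed
  have "measure lebesgue S = (\<Sum>f\<in>F. measure lebesgue (C f))"
    unfolding Scov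
  proof (intro measure_finite_Union finF disjC)
    show "C ` F \<subseteq> sets lebesgue" using Cm by (auto intro: fmeasurableD)
    show "emeasure lebesgue (C f) \<noteq> \<infinity>" for f unfolding infinity_ennreal_def by (rule fmeasurableD2[OF Cm])
  qed
  also have "\<dots> = (\<Sum>f\<in>F. measure lebesgue (T f))"
    by (simp only: T_def measure_translation)
  also have "\<dots> = measure lebesgue (\<Union>f\<in>F. T f)"
  proof (intro measure_finite_Union[symmetric] finF disjT)
    show "T ` F \<subseteq> sets lebesgue" using Tm by (auto intro: fmeasurableD)
    show "emeasure lebesgue (T f) \<noteq> \<infinity>" for f unfolding infinity_ennreal_def by (rule fmeasurableD2[OF Tm])
  qed
  also have "\<dots> \<le> measure lebesgue (cbox 0 (1 :: real^'n))"
  proof (rule measure_mono_fmeasurable)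
    show "(\<Union>f\<in>F. T f) \<subseteq> cbox 0 1"
    proof
      fix y assume "y \<in> (\<Union>f\<in>F. T f)"
      then obtain f x where fx: "x \<in> C f" "y = - vec_of f + x" by (auto simp: T_def)
      have "0 \<le> y $ i \<and> y $ i \<le> 1" for i
      proof -
        have "of_int (f i) \<le> x $ i" "x $ i < of_int (f i) + 1" using fx(1) by (auto simp: C_def)
        then show ?thesis by (simp add: fx(2) vec_of_def)
      qed
      then show "y \<in> cbox 0 1" by (simp add: mem_box_cart)
    qed
    show "(\<Union>f\<in>F. T f) \<in> sets lebesgue" using finF Tm by (intro sets.finite_UN) auto
  qed auto
  also have "(0 :: real^'n) \<in> cbox 0 1" by (simp add: mem_box_cart)
  then have "measure lebesgue (cbox 0 (1 :: real^'n)) = 1" by (auto simp: content_cbox_if_cart)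
  finally show False using S(3) by simp
qed

text \<open>Blichfeldt's theorem is applied to the preimage of the one-sided box with sides
  \<open>c i\<close>, not to half of a symmetric body: two points of the open box differ by less
  than \<open>c i\<close> in each coordinate. So the bounds are strict without a compactness
  argument.\<close>

theorem minkowski_linear_forms:
  fixes A :: "real^'n::{finite,wellorder}^'n::_" and c :: "'n::_ \<Rightarrow> real"
  assumes c: "\<And>i. c i > 0" and d: "Determinants.det A \<noteq> 0" "\<bar>Determinants.det A\<bar> < (\<Prod>i\<in>UNIV. c i)"
  obtains z :: "real^'n::_" where "z \<noteq> 0" "\<And>i. z $ i \<in> \<int>" "\<And>i. \<bar>(A *v z) $ i\<bar> < c i"
proof -
  obtain B where inv: "A ** B = Finite_Cartesian_Product.mat 1" "B ** A = Finite_Cartesian_Product.mat 1"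
    using d(1) unfolding invertible_det_nz[symmetric] invertible_def by blast
  define T where "T = box 0 (\<chi> i. c i)"
  define S where "S = (\<lambda>x. B *v x) ` T"
  have T: "T \<in> lmeasurable" "measure lebesgue T = (\<Prod>i\<in>UNIV. c i)"
  proof -
    show "T \<in> lmeasurable" by (simp add: T_def)
    have "measure lebesgue T = measure lebesgue (cbox 0 (\<chi> i. c i))"
      unfolding T_def by (simp add: measure_completion measure_lborel_box_eq measure_lborel_cbox_eq)
    also have "0 \<in> cbox 0 (\<chi> i. c i)" using c by (simp add: mem_box_cart less_imp_le)
    then have "measure lebesgue (cbox 0 (\<chi> i. c i)) = (\<Prod>i\<in>UNIV. c i)"
      by (auto simp: content_cbox_if_cart)
    finally show "measure lebesgue T = (\<Prod>i\<in>UNIV. c i)" .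
  qed
  have "Determinants.det A * Determinants.det B = 1"
    using inv by (metis det_I det_mul)
  then have detB: "\<bar>Determinants.det B\<bar> = 1 / \<bar>Determinants.det A\<bar>"
    using d(1) by (simp add: field_simps flip: abs_mult)
  have "measure lebesgue S = \<bar>Determinants.det B\<bar> * (\<Prod>i\<in>UNIV. c i)"
    unfolding S_def using measure_linear_image[OF matrix_vector_mul_linear T(1), of B] T(2) by simp
  also have "\<dots> > 1" using d by (simp add: detB field_simps)
  finally have "measure lebesgue S > 1" .
  moreover have "S \<in> lmeasurable"
    unfolding S_def by (intro measurable_linear_image matrix_vector_mul_linear T(1))
  moreover have "bounded S"
    unfolding S_def T_def by (intro bounded_linear_image bounded_box matrix_vector_mul_bounded_linear)
  ultimately obtain x y where xy: "x \<in> S" "y \<in> S" "x \<noteq> y" "\<And>i. (x - y) $ i \<in> \<int>"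
    using blichfeldt by blast
  obtain u v where uv: "u \<in> T" "x = B *v u" "v \<in> T" "y = B *v v" using xy by (auto simp: S_def)
  have "A *v (x - y) = u - v"
    unfolding uv matrix_vector_mult_diff_distrib matrix_vector_mul_assoc inv by simp
  then have "\<bar>(A *v (x - y)) $ i\<bar> < c i" for i
  proof -
    have "0 < u $ i" "u $ i < c i" "0 < v $ i" "v $ i < c i"
      using uv by (auto simp: T_def mem_box_cart)
    then show ?thesis using \<open>A *v (x - y) = u - v\<close> by simp
  qed
  then show ?thesis using xy that[of "x - y"] by simp
qed

section \<open>Dual lattices and the covering radius\<close>

lemma integer_multiple_closed:
  fixes L :: "'a::real_vector set"
  assumes "0 \<in> L" "\<And>a b. a \<in> L \<Longrightarrow> b \<in> L \<Longrightarrow> a + b \<in> L" "\<And>a b. a \<in> L \<Longrightarrow> b \<in> L \<Longrightarrow> a - b \<in> L"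
    and "b \<in> L"
  shows "of_int k *\<^sub>R b \<in> L"
proof (induction k rule: int_induct[where k = 0])
  case (step1 i)
  then show ?case using assms by (simp add: scaleR_add_left)
next
  case (step2 i)
  then show ?case using assms by (simp add: scaleR_diff_left)
qed (use assms in simp)

text \<open>A transference bound. Split off a shortest dual vector \<open>w\<close>: every dual vector of the sublattice
  orthogonal to \<open>w\<close> lifts to a dual vector whose \<open>w\<close>-component is at most half of \<open>w\<close>, so its squared
  length is at least three quarters of that of \<open>w\<close>.\<close>

theorem dual_covering_bound:
  fixes W L :: "'a::euclidean_space set"
  assumes "subspace W" "dim W = m" "L \<subseteq> W"
    and "0 \<in> L" "\<And>a b. a \<in> L \<Longrightarrow> b \<in> L \<Longrightarrow> a + b \<in> L" "\<And>a b. a \<in> L \<Longrightarrow> b \<in> L \<Longrightarrow> a - b \<in> L"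
    and "W \<subseteq> span {w \<in> W. \<forall>l\<in>L. w \<bullet> l \<in> \<int>}"
    and "\<delta> > 0" "\<And>w. w \<in> W \<Longrightarrow> \<forall>l\<in>L. w \<bullet> l \<in> \<int> \<Longrightarrow> w \<noteq> 0 \<Longrightarrow> \<delta> \<le> w \<bullet> w"
    and "x \<in> W"
  shows "\<exists>l\<in>L. (x - l) \<bullet> (x - l) \<le> (\<Sum>i<m. (4/3) ^ i) / (4 * \<delta>)"
  using assms
proof (induction m arbitrary: W L \<delta> x)
  case 0
  then have "x = 0" by (auto simp: dim_eq_0)
  then show ?case using 0 by (intro bexI[of _ 0]) auto
next
  case (Suc m)
  define D where "D = {w \<in> W. \<forall>l\<in>L. w \<bullet> l \<in> \<int>}"
  have Ddiff: "u - v \<in> D" if "u \<in> D" "v \<in> D" for u v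
    using that Suc.prems(1) by (auto simp: D_def subspace_diff inner_diff_left)
  have "\<exists>w\<in>D. w \<noteq> 0"
  proof (rule ccontr)
    assume "\<not> (\<exists>w\<in>D. w \<noteq> 0)"
    then have "span D \<subseteq> {0}" by (metis span_empty span_insert_0 span_mono subsetI insertI1)
    then have "W \<subseteq> {0}" using Suc.prems(7) by (auto simp: D_def)
    then have "dim W = 0" by (simp add: dim_eq_0)
    then show False using Suc.prems(2) by simp
  qed
  then obtain w0 where w0: "w0 \<in> D" "w0 \<noteq> 0" by blast
  define F where "F = {w \<in> D. w \<noteq> 0 \<and> norm w \<le> norm w0}"
  \<comment> \<open>Distinct dual vectors are at least \<open>sqrt \<delta>\<close> apart, so a ball
    contains finitely many of them and a shortest one exists.\<close>
  have "uniform_discrete F"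
    unfolding uniform_discrete_def
  proof (intro exI[of _ "sqrt \<delta>"] conjI ballI impI)
    show "sqrt \<delta> > 0" using Suc.prems(8) by simp
    fix u v assume uv: "u \<in> F" "v \<in> F" "dist u v < sqrt \<delta>"
    show "u = v"
    proof (rule ccontr)
      assume "u \<noteq> v"
      then have "\<delta> \<le> (u - v) \<bullet> (u - v)"
        using Ddiff[of u v] uv Suc.prems(9)[of "u - v"] by (auto simp: F_def D_def)
      then have "sqrt \<delta> \<le> norm (u - v)" by (simp add: norm_eq_sqrt_inner)
      then show False using uv(3) by (simp add: dist_norm)
    qed
  qed
  moreover have "bounded F" by (auto simp: bounded_iff F_def)
  ultimately have "finite F" using uniform_discrete_finite_iff by blast
  moreover have "F \<noteq> {}" using w0 by (auto simp: F_def)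
  ultimately obtain w where w: "w \<in> F" "\<And>v. v \<in> F \<Longrightarrow> norm w \<le> norm v"
    using arg_min_if_finite[of F norm] by (metis arg_min_on_def leI)
  define a where "a = w \<bullet> w"
  have shortest: "a \<le> v \<bullet> v" if "v \<in> D" "v \<noteq> 0" for v
  proof -
    have "norm w \<le> norm v" using w that by (cases "norm v \<le> norm w0") (auto simp: F_def)
    then show ?thesis by (simp add: a_def dot_square_norm)
  qed
  have wD: "w \<in> W" "\<And>l. l \<in> L \<Longrightarrow> w \<bullet> l \<in> \<int>" "w \<noteq> 0" using w by (auto simp: F_def D_def)
  have a: "a > 0" "\<delta> \<le> a" using wD Suc.prems(9)[of w] by (auto simp: a_def)
  \<comment> \<open>A shortest dual vector is primitive. The aim is a lattice vector
    \<open>b\<close> with \<open>w \<bullet> b = 1\<close>.\<close>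
  have prim: "\<not> (\<forall>l\<in>L. w \<bullet> l / g \<in> \<int>)" if g: "g > 1" for g :: real
  proof
    assume "\<forall>l\<in>L. w \<bullet> l / g \<in> \<int>"
    then have "(1 / g) *\<^sub>R w \<in> D" using wD Suc.prems(1) by (auto simp: D_def subspace_scale)
    then have "a \<le> ((1 / g) *\<^sub>R w) \<bullet> ((1 / g) *\<^sub>R w)" by (rule shortest) (use wD g in auto)
    also have "\<dots> = a / (g * g)" by (simp add: a_def)
    finally have "g * g \<le> 1" using a g by (simp add: field_simps)
    then show False using g by (smt (verit) mult_less_cancel_left1)
  qed
  have mult: "of_int k *\<^sub>R l \<in> L" if "l \<in> L" for k l
    using integer_multiple_closed[of L l k] Suc.prems(4-6) that by blast
  \<comment> \<open>The positive values of \<open>w\<close> on \<open>L\<close>. The least of them,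
    \<open>g\<close>, divides all others by division with remainder, and primitivity forces
    \<open>g = 1\<close>.\<close>
  define pos where "pos = (\<lambda>k::nat. k > 0 \<and> (\<exists>l\<in>L. w \<bullet> l = real k))"
  have "\<exists>k. pos k"
  proof -
    obtain l where l: "l \<in> L" "w \<bullet> l \<noteq> 0" using prim[of 2] by (metis Ints_0 div_0 one_less_numeral_iff semiring_norm(76))
    obtain k where k: "w \<bullet> l = of_int k" using wD(2)[OF l(1)] by (auto elim: Ints_cases)
    have "w \<bullet> (of_int (sgn k) *\<^sub>R l) = real (nat \<bar>k\<bar>)"
      by (cases "k \<ge> 0") (auto simp: k sgn_if)
    then have "\<exists>l\<in>L. w \<bullet> l = real (nat \<bar>k\<bar>)" using mult[OF l(1)] by blast
    moreover have "nat \<bar>k\<bar> > 0" using l(2) k by simp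
    ultimately show ?thesis unfolding pos_def by blast
  qed
  then obtain g where g: "pos g" and gleast: "\<And>k. pos k \<Longrightarrow> g \<le> k"
    using LeastI_ex[of pos] Least_le[of pos] by blast
  obtain b where b: "b \<in> L" "w \<bullet> b = real g" using g by (auto simp: pos_def)
  have "w \<bullet> l / real g \<in> \<int>" if l: "l \<in> L" for l
  proof -
    obtain k where k: "w \<bullet> l = of_int k" using wD(2)[OF l] by (auto elim: Ints_cases)
    define r where "r = k mod int g"
    have "w \<bullet> (l - of_int (k div int g) *\<^sub>R b) = of_int (k - (k div int g) * int g)"
      by (simp add: inner_diff_right k b(2))
    also have "k - (k div int g) * int g = r" by (simp add: r_def minus_div_mult_eq_mod)
    finally have r: "w \<bullet> (l - of_int (k div int g) *\<^sub>R b) = of_int r" .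
    have rb: "0 \<le> r" "r < int g" using g by (auto simp: r_def pos_def)
    have "r = 0"
    proof (rule ccontr)
      assume "r \<noteq> 0"
      then have "nat r > 0" using rb by simp
      moreover have "w \<bullet> (l - of_int (k div int g) *\<^sub>R b) = real (nat r)" using r rb by simp
      then have "\<exists>l\<in>L. w \<bullet> l = real (nat r)" using mult[OF b(1)] Suc.prems(6)[OF l] by blast
      ultimately have "pos (nat r)" unfolding pos_def by blast
      then show False using gleast[of "nat r"] rb by linarith
    qed
    then have "int g dvd k" by (simp add: r_def dvd_eq_mod_eq_0)
    then obtain q where "k = int g * q" by (auto simp: dvd_def)
    then show ?thesis using g by (simp add: k pos_def)
  qed
  then have "g = 1" using prim[of "real g"] g by (fastforce simp: pos_def)
  then have wb: "w \<bullet> b = 1" using b by simp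
  define W' where "W' = {y \<in> W. w \<bullet> y = 0}"
  define L' where "L' = {l \<in> L. w \<bullet> l = 0}"
  have sub': "subspace W'"
    using Suc.prems(1) by (auto simp: W'_def subspace_def inner_add_right)
  have dim': "dim W' = m"
  proof -
    have "W \<subseteq> span (insert w W')"
    proof
      fix y assume y: "y \<in> W"
      have "y - (w \<bullet> y / a) *\<^sub>R w \<in> W'"
        using y wD a Suc.prems(1) by (auto simp: W'_def inner_diff_right a_def subspace_diff subspace_scale)
      then have "(w \<bullet> y / a) *\<^sub>R w + (y - (w \<bullet> y / a) *\<^sub>R w) \<in> span (insert w W')"
        by (intro span_add span_scale span_base) auto
      then show "y \<in> span (insert w W')" by simp
    qed
    moreover have "span (insert w W') \<subseteq> W"
      using wD Suc.prems(1) by (intro span_minimal) (auto simp: W'_def)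
    ultimately have "dim W = dim (insert w W')" by (metis dim_span subset_antisym)
    moreover have "w \<notin> span W'" using sub' wD by (simp add: span_eq_iff[THEN iffD2] W'_def)
    ultimately show ?thesis using Suc.prems(2) by (simp add: dim_insert)
  qed
  have split: "l - of_int k *\<^sub>R b \<in> L'" if "l \<in> L" "w \<bullet> l = of_int k" for l k
    using that Suc.prems(6) mult[OF b(1)] by (auto simp: L'_def inner_diff_right wb)
  have span': "W' \<subseteq> span {u \<in> W'. \<forall>l\<in>L'. u \<bullet> l \<in> \<int>}"
  proof
    fix y assume y: "y \<in> W'"
    \<comment> \<open>Orthogonal projection along \<open>w\<close>. It preserves inner products with
      vectors of \<open>L'\<close>, which are orthogonal to \<open>w\<close>, and so sends dual
      vectors of \<open>L\<close> to dual vectors of \<open>L'\<close>.\<close>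
    define P where "P = (\<lambda>u. u - (w \<bullet> u / a) *\<^sub>R w)"
    have "linear P" unfolding P_def
      by (intro linearI) (auto simp: inner_add_right add_divide_distrib algebra_simps)
    then have "P ` span D = span (P ` D)" by (simp add: linear_span_image)
    moreover have "P y = y" using y by (simp add: P_def W'_def)
    moreover have "y \<in> span D" using y Suc.prems(7) by (auto simp: W'_def D_def)
    ultimately have "y \<in> span (P ` D)" by (metis imageI)
    moreover have "P ` D \<subseteq> {u \<in> W'. \<forall>l\<in>L'. u \<bullet> l \<in> \<int>}"
      using wD a Suc.prems(1)
      by (auto simp: P_def D_def W'_def L'_def inner_diff_right inner_diff_left a_def subspace_diff subspace_scale)
    ultimately show "y \<in> span {u \<in> W'. \<forall>l\<in>L'. u \<bullet> l \<in> \<int>}" using span_mono by blast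
  qed
  have dual': "3 * a / 4 \<le> u \<bullet> u" if u: "u \<in> W'" "\<forall>l\<in>L'. u \<bullet> l \<in> \<int>" "u \<noteq> 0" for u
  proof -
    \<comment> \<open>\<open>u\<close> is integral on \<open>L'\<close>, but perhaps not on
      \<open>b\<close>. Adding \<open>\<beta> *\<^sub>R w\<close> rounds
      \<open>u \<bullet> b\<close> to the nearest integer, since \<open>w \<bullet> b = 1\<close>,
      and changes nothing on \<open>L'\<close>.\<close>
    define t where "t = u \<bullet> b"
    define \<beta> where "\<beta> = of_int (round t) - t"
    have \<beta>: "\<bar>\<beta>\<bar> \<le> 1 / 2" using of_int_round_abs_le[of t] by (simp add: \<beta>_def)
    have uw: "w \<bullet> u = 0" "u \<in> W" using u by (auto simp: W'_def)
    have "(u + \<beta> *\<^sub>R w) \<bullet> l \<in> \<int>" if l: "l \<in> L" for l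
    proof -
      obtain k where k: "w \<bullet> l = of_int k" using wD(2)[OF l] by (auto elim: Ints_cases)
      have "u \<bullet> (l - of_int k *\<^sub>R b) \<in> \<int>" using split[OF l k] u by blast
      moreover have "(u + \<beta> *\<^sub>R w) \<bullet> l = u \<bullet> (l - of_int k *\<^sub>R b) + of_int (k * round t)"
        by (simp add: inner_add_left inner_diff_right k \<beta>_def t_def algebra_simps)
      ultimately show ?thesis by (metis Ints_add Ints_of_int)
    qed
    then have "u + \<beta> *\<^sub>R w \<in> D" using uw wD Suc.prems(1) by (auto simp: D_def subspace_add subspace_scale)
    moreover have "u + \<beta> *\<^sub>R w \<noteq> 0"
    proof
      assume "u + \<beta> *\<^sub>R w = 0"
      then have "(u + \<beta> *\<^sub>R w) \<bullet> u = 0" by simp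
      then show False using uw u(3) by (simp add: inner_add_left)
    qed
    ultimately have "a \<le> (u + \<beta> *\<^sub>R w) \<bullet> (u + \<beta> *\<^sub>R w)" by (rule shortest)
    also have "\<dots> = u \<bullet> u + \<beta>\<^sup>2 * a"
      using uw by (simp add: inner_add_left inner_add_right inner_commute a_def power2_eq_square)
    also have "\<beta>\<^sup>2 * a \<le> (1/2)\<^sup>2 * a"
      using \<beta> a by (intro mult_right_mono) (auto simp: abs_le_square_iff[symmetric])
    finally show ?thesis by (simp add: power2_eq_square)
  qed
  \<comment> \<open>Among the translates of \<open>W'\<close> by integer multiples of
    \<open>b\<close> take one nearest to \<open>x\<close>. Projecting \<open>x\<close> onto it costs
    \<alpha>^2 / a, at most 1 / (4 a), and the lattice \<open>L'\<close> handles the rest.\<close>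
  define k where "k = round (w \<bullet> x)"
  define \<alpha> where "\<alpha> = w \<bullet> x - of_int k"
  have \<alpha>: "\<bar>\<alpha>\<bar> \<le> 1 / 2" using of_int_round_abs_le[of "w \<bullet> x"] by (simp add: \<alpha>_def k_def abs_minus_commute)
  define x2 where "x2 = x - of_int k *\<^sub>R b - (\<alpha> / a) *\<^sub>R w"
  have bW: "b \<in> W" using b Suc.prems(3) by blast
  have x2: "x2 \<in> W'"
    using Suc.prems(1,10) wD bW a
    by (auto simp: W'_def x2_def \<alpha>_def inner_diff_right wb a_def subspace_diff subspace_scale)
  have "\<exists>l\<in>L'. (x2 - l) \<bullet> (x2 - l) \<le> (\<Sum>i<m. (4/3) ^ i) / (4 * (3 * a / 4))"
  proof (rule Suc.IH[OF sub' dim' _ _ _ _ span' _ _ x2])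
    show "L' \<subseteq> W'" using Suc.prems(3) by (auto simp: L'_def W'_def)
    show "0 \<in> L'" using Suc.prems(4) by (simp add: L'_def)
    show "u + v \<in> L'" if "u \<in> L'" "v \<in> L'" for u v
      using that Suc.prems(5) by (auto simp: L'_def inner_add_right)
    show "u - v \<in> L'" if "u \<in> L'" "v \<in> L'" for u v
      using that Suc.prems(6) by (auto simp: L'_def inner_diff_right)
    show "3 * a / 4 > 0" using a by simp
  qed (use dual' in blast)
  then obtain l where l: "l \<in> L'" "(x2 - l) \<bullet> (x2 - l) \<le> (\<Sum>i<m. (4/3) ^ i) / (3 * a)" by auto
  have "of_int k *\<^sub>R b + l \<in> L" using mult[OF b(1)] l Suc.prems(5) by (auto simp: L'_def)
  moreover have "(x - (of_int k *\<^sub>R b + l)) \<bullet> (x - (of_int k *\<^sub>R b + l)) \<le> (\<Sum>i<Suc m. (4/3) ^ i) / (4 * \<delta>)"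
  proof -
    have eq: "x - (of_int k *\<^sub>R b + l) = (x2 - l) + (\<alpha> / a) *\<^sub>R w" by (simp add: x2_def)
    have orth: "(x2 - l) \<bullet> w = 0" using x2 l by (simp add: W'_def L'_def inner_diff_right inner_commute[of _ w])
    have "(x - (of_int k *\<^sub>R b + l)) \<bullet> (x - (of_int k *\<^sub>R b + l)) = (x2 - l) \<bullet> (x2 - l) + \<alpha>\<^sup>2 / a"
    proof -
      have "w \<bullet> (x2 - l) = 0" using orth by (subst inner_commute)
      then show ?thesis
        unfolding eq inner_add_left inner_add_right using orth a
        by (simp add: a_def power2_eq_square)
    qed
    also have "\<alpha>\<^sup>2 / a \<le> (1/2)\<^sup>2 / a"
      using \<alpha> a by (intro divide_right_mono) (auto simp: abs_le_square_iff[symmetric])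
    also have "(x2 - l) \<bullet> (x2 - l) + (1/2)\<^sup>2 / a \<le> (\<Sum>i<m. (4/3) ^ i) / (3 * a) + (1/2)\<^sup>2 / a"
      using l by simp
    \<comment> \<open>Origin of the ratio 4/3: the induction hypothesis has been used with
      \<open>3 * a / 4\<close> in place of \<delta>.\<close>
    also have "\<dots> = (1 + 4 / 3 * (\<Sum>i<m. (4/3) ^ i)) / (4 * a)"
    proof -
      have "t / (3 * a) + (1/2)\<^sup>2 / a = (1 + 4 / 3 * t) / (4 * a)" for t
        using a(1) by (simp add: divide_simps power2_eq_square)
      then show ?thesis .
    qed
    also have "1 + 4 / 3 * (\<Sum>i<m. (4/3::real) ^ i) = (\<Sum>i<Suc m. (4/3) ^ i)"
      by (subst sum.lessThan_Suc_shift) (simp add: sum_distrib_left)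
    also have "(\<Sum>i<Suc m. (4/3) ^ i) / (4 * a) \<le> (\<Sum>i<Suc m. (4/3) ^ i) / (4 * \<delta>)"
      using a Suc.prems(8) by (intro divide_left_mono sum_nonneg) auto
    finally show ?thesis by simp
  qed
  ultimately show ?case by blast
qed

section \<open>The archimedean completion\<close>

text \<open>The inequality of the means, from t \<le> exp (t - 1) at t = \<open>f i / \<mu>\<close>:
  the exponents add up to 0.\<close>

lemma prod_le_mean_power:
  fixes f :: "'a \<Rightarrow> real"
  assumes S: "finite S" "S \<noteq> {}" and f: "\<And>i. i \<in> S \<Longrightarrow> f i \<ge> 0"
  shows "(\<Prod>i\<in>S. f i) \<le> ((\<Sum>i\<in>S. f i) / card S) ^ card S"
proof (cases "(\<Sum>i\<in>S. f i) = 0")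
  case True
  then have "f i = 0" if "i \<in> S" for i using sum_nonneg_eq_0_iff[of S f] S f True that by blast
  then have "(\<Prod>i\<in>S. f i) = 0" using S by (auto simp: prod_zero_iff)
  then show ?thesis by (simp add: True)
next
  case False
  define \<mu> where "\<mu> = (\<Sum>i\<in>S. f i) / card S"
  have card: "card S > 0" using S by (simp add: card_gt_0_iff)
  have "(\<Sum>i\<in>S. f i) > 0" using False sum_nonneg[of S f] f by force
  then have \<mu>: "\<mu> > 0" using card by (simp add: \<mu>_def)
  have "(\<Prod>i\<in>S. f i / \<mu>) \<le> (\<Prod>i\<in>S. exp (f i / \<mu> - 1))"
  proof (intro prod_mono conjI)
    fix i assume "i \<in> S"
    then show "0 \<le> f i / \<mu>" using f \<mu> by simp
    show "f i / \<mu> \<le> exp (f i / \<mu> - 1)" using exp_ge_add_one_self[of "f i / \<mu> - 1"] by simp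
  qed
  also have "\<dots> = exp ((\<Sum>i\<in>S. f i) / \<mu> - card S)"
    by (simp add: sum_subtractf sum_divide_distrib flip: exp_sum[OF S(1)])
  also have "(\<Sum>i\<in>S. f i) / \<mu> = card S" using False card by (simp add: \<mu>_def)
  finally have "(\<Prod>i\<in>S. f i) / \<mu> ^ card S \<le> 1" by (simp add: prod_dividef)
  then show ?thesis using \<mu> by (simp add: \<mu>_def[symmetric] field_simps)
qed

lemma sum_ge_of_prod_ge:
  fixes f :: "'a \<Rightarrow> real" and h :: real
  assumes S: "finite S" "S \<noteq> {}" and f: "\<And>i. i \<in> S \<Longrightarrow> f i \<ge> 0"
    and "h ^ card S \<le> (\<Prod>i\<in>S. f i)"
  shows "card S * h \<le> (\<Sum>i\<in>S. f i)"
proof -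
  have card: "card S > 0" using S by (simp add: card_gt_0_iff)
  have "h ^ card S \<le> ((\<Sum>i\<in>S. f i) / card S) ^ card S"
    using order_trans[OF assms(4) prod_le_mean_power[OF S f]] by simp
  then have "h \<le> (\<Sum>i\<in>S. f i) / card S"
    using card f by (intro power_le_imp_le_base[of h "card S - 1"]) (auto intro!: divide_nonneg_nonneg sum_nonneg)
  then show ?thesis using card by (simp add: field_simps)
qed

lemma cmod_one_minus_square:
  "(cmod (1 - z\<^sup>2))\<^sup>2 = 1 - 2 * (cmod z)\<^sup>2 + ((cmod z)\<^sup>2)\<^sup>2 + 4 * (Im z)\<^sup>2"
proof -
  have "Re (1 - z\<^sup>2) = 1 - (Re z)\<^sup>2 + (Im z)\<^sup>2" "Im (1 - z\<^sup>2) = - 2 * Re z * Im z"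
    by (simp_all add: power2_eq_square)
  then show ?thesis unfolding cmod_power2 by (simp add: power2_eq_square algebra_simps)
qed

text \<open>The elementary inequality behind Chebotarev's argument: \<open>t \<le> exp (t - 1)\<close>, applied to every
  \<open>t = \<bar>1 - z\<^sup>2\<bar>\<^sup>2\<close>.\<close>

lemma prod_one_minus_square_less:
  fixes z :: "'a \<Rightarrow> complex"
  assumes S: "finite S"
    and "(\<Sum>i\<in>S. 4 * (Im (z i))\<^sup>2) < (\<Sum>i\<in>S. 2 * (cmod (z i))\<^sup>2 - ((cmod (z i))\<^sup>2)\<^sup>2)"
  shows "(\<Prod>i\<in>S. cmod (1 - (z i)\<^sup>2)) < 1"
proof -
  let ?t = "\<lambda>i. 4 * (Im (z i))\<^sup>2 - (2 * (cmod (z i))\<^sup>2 - ((cmod (z i))\<^sup>2)\<^sup>2)"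
  have "(\<Prod>i\<in>S. (cmod (1 - (z i)\<^sup>2))\<^sup>2) \<le> (\<Prod>i\<in>S. exp (?t i))"
  proof (intro prod_mono conjI)
    fix i
    show "(cmod (1 - (z i)\<^sup>2))\<^sup>2 \<le> exp (?t i)"
      unfolding cmod_one_minus_square using exp_ge_add_one_self[of "?t i"] by linarith
  qed auto
  also have "\<dots> = exp (\<Sum>i\<in>S. ?t i)" by (simp add: exp_sum S)
  also have "\<dots> < 1" using assms(2) by (simp add: sum_subtractf)
  finally have "(\<Prod>i\<in>S. cmod (1 - (z i)\<^sup>2))\<^sup>2 < 1" by (simp add: prod_power_distrib)
  then show ?thesis using power2_less_imp_less[of "\<Prod>i\<in>S. cmod (1 - (z i)\<^sup>2)" 1] by simp
qed

text \<open>Bridge between matrices indexed by a finite type, used for the geometry of numbers, and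
  matrices indexed by natural numbers, used for the algebra; permutations are transported along
  \<open>r\<close>.\<close>

lemma det_cart_eq_det_mat:
  fixes r :: "'n::finite \<Rightarrow> nat" and f :: "nat \<Rightarrow> nat \<Rightarrow> 'a::comm_ring_1"
  assumes r: "bij_betw r UNIV {0..<m}"
  shows "Determinants.det (\<chi> i j. f (r i) (r j)) = det (mat m m (\<lambda>(i, j). f i j))"
proof -
  let ?g = "inv_into UNIV r"
  have inj: "inj r" using r by (auto simp: bij_betw_def)
  have g: "bij_betw ?g {0..<m} UNIV" using r by (rule bij_betw_inv_into)
  have gr: "?g (r i) = i" for i using inj by (simp add: inv_f_f)
  have rg: "r (?g i) = i" if "i \<in> {0..<m}" for i
    using that r by (simp add: bij_betw_def f_inv_into_f)
  have "Determinants.det (\<chi> i j. f (r i) (r j))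
    = (\<Sum>p\<in>{p. p permutes (UNIV :: 'n set)}. of_int (sign p) * (\<Prod>i\<in>UNIV. f (r i) (r (p i))))"
    by (simp add: Determinants.det_def)
  also have "\<dots> = (\<Sum>q\<in>{q. q permutes {0..<m}}. of_int (sign q) * (\<Prod>i\<in>{0..<m}. f i (q i)))"
  proof (rule sum.reindex_bij_witness[where i = "map_permutation {0..<m} ?g" and j = "map_permutation UNIV r"])
    fix p :: "'n \<Rightarrow> 'n" assume "p \<in> {p. p permutes UNIV}"
    then have p: "p permutes UNIV" by simp
    show "map_permutation {0..<m} ?g (map_permutation UNIV r p) = p"
      using gr by (intro map_permutation_compose_inv[OF r p]) auto
    show "map_permutation UNIV r p \<in> {q. q permutes {0..<m}}"
      using map_permutation_permutes[OF r p] by simp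
    have "sign (map_permutation UNIV r p) = sign p"
      using inj p by (intro sign_map_permutation) auto
    moreover have "(\<Prod>i\<in>{0..<m}. f i (map_permutation UNIV r p i)) = (\<Prod>i\<in>UNIV. f (r i) (r (p i)))"
      using inj by (subst prod.reindex_bij_betw[OF r, symmetric]) (simp add: map_permutation_apply)
    ultimately show "of_int (sign (map_permutation UNIV r p)) * (\<Prod>i\<in>{0..<m}. f i (map_permutation UNIV r p i))
      = of_int (sign p) * (\<Prod>i\<in>UNIV. f (r i) (r (p i)))" by simp
  next
    fix q :: "nat \<Rightarrow> nat" assume "q \<in> {q. q permutes {0..<m}}"
    then have q: "q permutes {0..<m}" by simp
    show "map_permutation UNIV r (map_permutation {0..<m} ?g q) = q"
      using rg by (intro map_permutation_compose_inv[OF g q]) auto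
    show "map_permutation {0..<m} ?g q \<in> {p. p permutes UNIV}"
      using map_permutation_permutes[OF g q] by simp
  qed
  also have "\<dots> = det (mat m m (\<lambda>(i, j). f i j))"
    unfolding det_def'[OF mat_carrier]
  proof (intro sum.cong refl arg_cong2[of _ _ _ _ "(*)"] prod.cong)
    fix q i assume "q \<in> {q. q permutes {0..<m}}" "i \<in> {0..<m}"
    then show "f i (q i) = mat m m (\<lambda>(i, j). f i j) $$ (i, q i)"
      using permutes_in_image[of q "{0..<m}" i] by auto
  qed
  finally show ?thesis .
qed

text \<open>An index type with as many elements as the degree of \<open>'k\<close>, so that the archimedean completion
  of a number field is a type \<open>real ^ 'n\<close>. The element \<open>0\<close> is added only because a type is never empty.\<close>

typedef (overloaded) ('k::field_char_0) place_index = "{i. i < field_degree TYPE('k)} \<union> {0}"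
  morphisms index_nat nat_index
  by blast

instantiation place_index :: (field_char_0) "{finite, wellorder}"
begin

definition less_eq_place_index :: "'a place_index \<Rightarrow> 'a place_index \<Rightarrow> bool" where
  "less_eq_place_index i j \<longleftrightarrow> index_nat i \<le> index_nat j"

definition less_place_index :: "'a place_index \<Rightarrow> 'a place_index \<Rightarrow> bool" where
  "less_place_index i j \<longleftrightarrow> index_nat i < index_nat j"

instance
proof
  show "finite (UNIV :: 'a place_index set)"
    unfolding type_definition.univ[OF type_definition_place_index] by simp
  fix P :: "'a place_index \<Rightarrow> bool" and a
  assume "\<And>x. (\<And>y. y < x \<Longrightarrow> P y) \<Longrightarrow> P x"
  then show "P a"
    unfolding less_place_index_def by (induction a rule: measure_induct_rule[where f = index_nat]) blast
qed (auto simp: less_eq_place_index_def less_place_index_def index_nat_inject)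

end

section \<open>Places and Minkowski coordinates\<close>

context primitive_number_field
begin

lemma index_nat_bij: "bij_betw (index_nat :: 'k place_index \<Rightarrow> nat) UNIV {0..<n}"
  unfolding bij_betw_def
proof
  show "inj (index_nat :: 'k place_index \<Rightarrow> nat)" by (auto intro: injI simp: index_nat_inject)
  show "range (index_nat :: 'k place_index \<Rightarrow> nat) = {0..<n}"
  proof -
    have "range (index_nat :: 'k place_index \<Rightarrow> nat) = {i. i < field_degree TYPE('k)} \<union> {0}"
      by (rule type_definition.Rep_range[OF type_definition_place_index])
    then show ?thesis using n_pos by (auto simp: field_degree_eq)
  qed
qed

lemma index_nat_less: "index_nat (i :: 'k place_index) < n"
  using index_nat_bij by (auto simp: bij_betw_def)

definition emb :: "'k place_index \<Rightarrow> 'k \<Rightarrow> complex" where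
  "emb i = emb_list ! index_nat i"

lemma emb_in: "emb i \<in> complex_embeddings"
  by (simp add: emb_def emb_list_nth index_nat_less)

lemma emb_bij: "bij_betw emb UNIV complex_embeddings"
  unfolding emb_def
  using bij_betw_trans[OF index_nat_bij, of "\<lambda>i. emb_list ! i" complex_embeddings] emb_list_bij
  by (simp add: comp_def atLeast0LessThan)

lemma card_place_index: "CARD('k place_index) = n"
  using bij_betw_same_card[OF index_nat_bij] by simp

text \<open>As \<gamma> generates K, \<open>Im (\<sigma> \<gamma>)\<close> vanishes exactly for the
  real embeddings, and it changes sign under conjugation. So \<open>places_P\<close> contains one
  member of each conjugate pair.\<close>

definition places_R :: "('k \<Rightarrow> complex) set" where
  "places_R = {\<sigma> \<in> complex_embeddings. Im (\<sigma> \<gamma>) = 0}"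

definition places_P :: "('k \<Rightarrow> complex) set" where
  "places_P = {\<sigma> \<in> complex_embeddings. Im (\<sigma> \<gamma>) > 0}"

definition places_N :: "('k \<Rightarrow> complex) set" where
  "places_N = {\<sigma> \<in> complex_embeddings. Im (\<sigma> \<gamma>) < 0}"

lemma places_partition:
  "complex_embeddings = places_R \<union> (places_P \<union> places_N)"
  "places_R \<inter> (places_P \<union> places_N) = {}" "places_P \<inter> places_N = {}"
  by (auto simp: places_R_def places_P_def places_N_def)

lemma finite_places [simp]: "finite places_R" "finite places_P" "finite places_N"
  by (auto simp: places_R_def places_P_def places_N_def)

lemma sum_places:
  "(\<Sum>\<sigma>\<in>complex_embeddings. f \<sigma>) = (\<Sum>\<sigma>\<in>places_R. f \<sigma>) + ((\<Sum>\<sigma>\<in>places_P. f \<sigma>) + (\<Sum>\<sigma>\<in>places_N. f \<sigma>))"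
  unfolding places_partition(1) using places_partition(2,3) by (simp add: sum.union_disjoint)

lemma prod_places:
  "(\<Prod>\<sigma>\<in>complex_embeddings. f \<sigma>) = (\<Prod>\<sigma>\<in>places_R. f \<sigma>) * ((\<Prod>\<sigma>\<in>places_P. f \<sigma>) * (\<Prod>\<sigma>\<in>places_N. f \<sigma>))"
  unfolding places_partition(1) using places_partition(2,3) by (simp add: prod.union_disjoint)

lemma cnj_cnj_comp: "cnj \<circ> (cnj \<circ> \<sigma>) = \<sigma>"
  by (simp add: fun_eq_iff)

lemma places_cnj_bij: "bij_betw (\<lambda>\<sigma>. cnj \<circ> \<sigma>) places_P places_N"
  by (rule bij_betw_byWitness[where f' = "\<lambda>\<sigma>. cnj \<circ> \<sigma>"])
    (auto simp: cnj_cnj_comp places_P_def places_N_def intro: embedding_cnj)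

lemma places_R_real:
  assumes "\<sigma> \<in> places_R"
  shows "Im (\<sigma> x) = 0"
proof -
  have \<sigma>: "\<sigma> \<in> complex_embeddings" "Im (\<sigma> \<gamma>) = 0" using assms by (auto simp: places_R_def)
  have "cnj \<circ> \<sigma> = \<sigma>"
    using \<sigma> by (intro embedding_eqI embedding_cnj) (auto simp: complex_eq_iff)
  then have "cnj (\<sigma> x) = \<sigma> x" by (metis comp_apply)
  then show ?thesis by (simp add: complex_eq_iff)
qed

lemma real_embeddings_eq: "real_embeddings = places_R"
proof
  show "real_embeddings \<subseteq> places_R"
    by (auto simp: real_embeddings_def places_R_def complex_is_Real_iff image_subset_iff)
  show "places_R \<subseteq> real_embeddings"
    using places_R_real by (auto simp: real_embeddings_def complex_is_Real_iff places_R_def)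
qed

lemma card_conjugate_pairs: "card (conjugate_embedding_pairs :: ('k \<Rightarrow> complex) set set) = card places_P"
proof -
  have "bij_betw (\<lambda>\<sigma>. {\<sigma>, cnj \<circ> \<sigma>}) places_P conjugate_embedding_pairs"
    unfolding bij_betw_def
  proof
    show "inj_on (\<lambda>\<sigma>. {\<sigma>, cnj \<circ> \<sigma>}) places_P"
    proof (rule inj_onI)
      fix \<sigma> \<tau> assume *: "\<sigma> \<in> places_P" "\<tau> \<in> places_P" "{\<sigma>, cnj \<circ> \<sigma>} = {\<tau>, cnj \<circ> \<tau>}"
      then have "\<sigma> = \<tau> \<or> \<sigma> = cnj \<circ> \<tau>" by blast
      moreover have "\<sigma> \<noteq> cnj \<circ> \<tau>" using * by (auto simp: places_P_def)
      ultimately show "\<sigma> = \<tau>" by blast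
    qed
    show "(\<lambda>\<sigma>. {\<sigma>, cnj \<circ> \<sigma>}) ` places_P = conjugate_embedding_pairs"
    proof
      show "(\<lambda>\<sigma>. {\<sigma>, cnj \<circ> \<sigma>}) ` places_P \<subseteq> conjugate_embedding_pairs"
        unfolding conjugate_embedding_pairs_def real_embeddings_eq
        by (auto simp: places_P_def places_R_def)
      show "conjugate_embedding_pairs \<subseteq> (\<lambda>\<sigma>. {\<sigma>, cnj \<circ> \<sigma>}) ` places_P"
      proof
        fix Q :: "('k \<Rightarrow> complex) set" assume "Q \<in> conjugate_embedding_pairs"
        then obtain \<sigma> where \<sigma>: "Q = {\<sigma>, cnj \<circ> \<sigma>}" "\<sigma> \<in> complex_embeddings" "\<sigma> \<notin> places_R"
          unfolding conjugate_embedding_pairs_def real_embeddings_eq by blast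
        show "Q \<in> (\<lambda>\<sigma>. {\<sigma>, cnj \<circ> \<sigma>}) ` places_P"
        proof (cases "Im (\<sigma> \<gamma>) > 0")
          case True
          then show ?thesis using \<sigma> by (auto simp: places_P_def)
        next
          case False
          then have "cnj \<circ> \<sigma> \<in> places_P"
            using \<sigma> embedding_cnj by (auto simp: places_P_def places_R_def)
          moreover have "Q = {cnj \<circ> \<sigma>, cnj \<circ> (cnj \<circ> \<sigma>)}" using \<sigma>(1) cnj_cnj_comp[of \<sigma>] by auto
          ultimately show ?thesis by blast
        qed
      qed
    qed
  qed
  then show ?thesis using bij_betw_same_card by metis
qed

lemma signature_cards:
  assumes "has_signature TYPE('k) r s"
  shows "card places_R = r" "card places_P = s" "card places_N = s" "n = r + 2 * s"
proof -
  show R: "card places_R = r" "card places_P = s"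
    using assms by (auto simp: has_signature_def real_embeddings_eq card_conjugate_pairs)
  then show N: "card places_N = s" using bij_betw_same_card[OF places_cnj_bij] by simp
  have "card (complex_embeddings :: ('k \<Rightarrow> complex) set) = card places_R + (card places_P + card places_N)"
    unfolding places_partition(1) using places_partition(2,3) by (simp add: card_Un_disjoint)
  then show "n = r + 2 * s" using R N card_embeddings by simp
qed

text \<open>A conjugate pair contributes sqrt 2 times a real and sqrt 2 times an imaginary part. So
  scaled, the squared length is the sum of |\<sigma> x|^2 over all embeddings, and the covolume of
  the ring of integers is the root of the absolute discriminant, without powers of 2.\<close>

definition coord :: "('k \<Rightarrow> complex) \<Rightarrow> 'k \<Rightarrow> real" where
  "coord \<sigma> x = (if Im (\<sigma> \<gamma>) = 0 then Re (\<sigma> x)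
     else if Im (\<sigma> \<gamma>) > 0 then sqrt 2 * Re (\<sigma> x) else sqrt 2 * Im (\<sigma> x))"

text \<open>The imaginary coordinates have reversed sign, so that the inner product with
  \<open>coord\<close> is the trace of \<open>x * y\<close>; in these coordinates the codifferent is
  the dual lattice.\<close>

definition coord_cnj :: "('k \<Rightarrow> complex) \<Rightarrow> 'k \<Rightarrow> real" where
  "coord_cnj \<sigma> x = (if Im (\<sigma> \<gamma>) < 0 then - coord \<sigma> x else coord \<sigma> x)"

text \<open>Spreads each doubled term over a conjugate pair; \<open>f\<close> stands for products of
  real parts and \<open>g\<close>, up to sign, for products of imaginary parts.\<close>

lemma sum_places_fold:
  assumes f: "\<And>\<sigma>. f (cnj \<circ> \<sigma>) = f \<sigma>" and g: "\<And>\<sigma>. g (cnj \<circ> \<sigma>) = g \<sigma>" "\<And>\<sigma>. \<sigma> \<in> places_R \<Longrightarrow> g \<sigma> = 0"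
  shows "(\<Sum>\<sigma>\<in>places_R. f \<sigma>) + ((\<Sum>\<sigma>\<in>places_P. 2 * f \<sigma>) + (\<Sum>\<sigma>\<in>places_N. 2 * g \<sigma>))
    = (\<Sum>\<sigma>\<in>complex_embeddings. f \<sigma> + g \<sigma> :: real)"
proof -
  have "(\<Sum>\<sigma>\<in>places_N. f \<sigma>) = (\<Sum>\<sigma>\<in>places_P. f \<sigma>)"
    using sum.reindex_bij_betw[OF places_cnj_bij, of f] f by simp
  moreover have "(\<Sum>\<sigma>\<in>places_N. g \<sigma>) = (\<Sum>\<sigma>\<in>places_P. g \<sigma>)"
    using sum.reindex_bij_betw[OF places_cnj_bij, of g] g by simp
  ultimately show ?thesis
    unfolding sum_places using g(2) by (simp add: sum.distrib flip: sum_distrib_left)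
qed

lemma coord_inner:
  "(\<Sum>\<sigma>\<in>complex_embeddings. coord \<sigma> x * coord \<sigma> y) = (\<Sum>\<sigma>\<in>complex_embeddings. Re (\<sigma> x * cnj (\<sigma> y)))"
proof -
  let ?f = "\<lambda>\<sigma>. Re (\<sigma> x) * Re (\<sigma> y)" and ?g = "\<lambda>\<sigma>. Im (\<sigma> x) * Im (\<sigma> y)"
  have "(\<Sum>\<sigma>\<in>complex_embeddings. coord \<sigma> x * coord \<sigma> y)
    = (\<Sum>\<sigma>\<in>places_R. ?f \<sigma>) + ((\<Sum>\<sigma>\<in>places_P. 2 * ?f \<sigma>) + (\<Sum>\<sigma>\<in>places_N. 2 * ?g \<sigma>))"
    unfolding sum_places
    by (intro arg_cong2[of _ _ _ _ "(+)"] sum.cong refl)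
      (auto simp: coord_def places_R_def places_P_def places_N_def)
  also have "\<dots> = (\<Sum>\<sigma>\<in>complex_embeddings. ?f \<sigma> + ?g \<sigma>)"
    by (rule sum_places_fold) (auto simp: places_R_real)
  finally show ?thesis by simp
qed

lemma coord_cnj_inner:
  "(\<Sum>\<sigma>\<in>complex_embeddings. coord_cnj \<sigma> x * coord \<sigma> y) = (\<Sum>\<sigma>\<in>complex_embeddings. Re (\<sigma> (x * y)))"
proof -
  let ?f = "\<lambda>\<sigma>. Re (\<sigma> x) * Re (\<sigma> y)" and ?g = "\<lambda>\<sigma>. - (Im (\<sigma> x) * Im (\<sigma> y))"
  have "(\<Sum>\<sigma>\<in>complex_embeddings. coord_cnj \<sigma> x * coord \<sigma> y)
    = (\<Sum>\<sigma>\<in>places_R. ?f \<sigma>) + ((\<Sum>\<sigma>\<in>places_P. 2 * ?f \<sigma>) + (\<Sum>\<sigma>\<in>places_N. 2 * ?g \<sigma>))"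
    unfolding sum_places
    by (intro arg_cong2[of _ _ _ _ "(+)"] sum.cong refl)
      (auto simp: coord_def coord_cnj_def places_R_def places_P_def places_N_def)
  also have "\<dots> = (\<Sum>\<sigma>\<in>complex_embeddings. ?f \<sigma> + ?g \<sigma>)"
    by (rule sum_places_fold) (auto simp: places_R_real)
  also have "\<dots> = (\<Sum>\<sigma>\<in>complex_embeddings. Re (\<sigma> (x * y)))"
    by (intro sum.cong refl) (simp add: complex_embeddingsD)
  finally show ?thesis .
qed

lemma coord_square_sum:
  "(\<Sum>\<sigma>\<in>complex_embeddings. (coord \<sigma> x)\<^sup>2) = (\<Sum>\<sigma>\<in>complex_embeddings. (cmod (\<sigma> x))\<^sup>2)"
proof -
  have "(\<Sum>\<sigma>\<in>complex_embeddings. (coord \<sigma> x)\<^sup>2) = (\<Sum>\<sigma>\<in>complex_embeddings. Re (\<sigma> x * cnj (\<sigma> x)))"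
    using coord_inner[of x x] by (simp add: power2_eq_square)
  also have "\<dots> = (\<Sum>\<sigma>\<in>complex_embeddings. (cmod (\<sigma> x))\<^sup>2)"
    by (intro sum.cong refl) (simp only: cmod_power2, simp add: power2_eq_square)
  finally show ?thesis .
qed

lemma sum_cnj_real:
  "(\<Sum>\<sigma>\<in>complex_embeddings. \<sigma> x * cnj (\<sigma> y))
    = of_real (\<Sum>\<sigma>\<in>complex_embeddings. coord \<sigma> x * coord \<sigma> (y :: 'k))"
proof -
  let ?S = "\<Sum>\<sigma>\<in>complex_embeddings. \<sigma> x * cnj (\<sigma> y)"
  have "bij_betw (\<lambda>\<sigma>. cnj \<circ> \<sigma>) complex_embeddings (complex_embeddings :: ('k \<Rightarrow> complex) set)"
    by (rule bij_betw_byWitness[where f' = "\<lambda>\<sigma>. cnj \<circ> \<sigma>"]) (auto simp: cnj_cnj_comp intro: embedding_cnj)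
  then have "(\<Sum>\<sigma>\<in>complex_embeddings. (cnj \<circ> \<sigma>) x * cnj ((cnj \<circ> \<sigma>) y)) = ?S"
    by (rule sum.reindex_bij_betw)
  then have "cnj ?S = ?S" by (simp add: cnj_sum)
  then have "Im ?S = 0" by (metis Reals_cnj_iff complex_is_Real_iff)
  then show ?thesis unfolding coord_inner by (simp add: complex_eq_iff)
qed

lemma coord_add: "\<sigma> \<in> complex_embeddings \<Longrightarrow> coord \<sigma> (x + y) = coord \<sigma> x + coord \<sigma> y"
  by (simp add: coord_def complex_embeddingsD algebra_simps)

lemma coord_diff: "\<sigma> \<in> complex_embeddings \<Longrightarrow> coord \<sigma> (x - y) = coord \<sigma> x - coord \<sigma> y"
  by (simp add: coord_def embedding_diff algebra_simps)

lemma coord_of_int_sum: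
  "\<sigma> \<in> complex_embeddings \<Longrightarrow> coord \<sigma> (\<Sum>j\<in>J. of_int (a j) * f j) = (\<Sum>j\<in>J. of_int (a j) * coord \<sigma> (f j))"
  by (simp add: coord_def embedding_sum complex_embeddingsD embedding_of_int sum_distrib_left mult_ac)

definition coord_matrix :: "'k list \<Rightarrow> real ^ 'k place_index ^ 'k place_index" where
  "coord_matrix bs = (\<chi> i j. coord (emb i) (bs ! index_nat j))"

lemma sum_emb: "(\<Sum>i\<in>UNIV. f (emb i)) = (\<Sum>\<sigma>\<in>complex_embeddings. f \<sigma>)"
  by (rule sum.reindex_bij_betw[OF emb_bij])

lemma prod_emb: "(\<Prod>i\<in>UNIV. f (emb i)) = (\<Prod>\<sigma>\<in>complex_embeddings. f \<sigma>)"
  by (rule prod.reindex_bij_betw[OF emb_bij])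

lemma sum_index_nat: "(\<Sum>j\<in>(UNIV :: 'k place_index set). f (index_nat j)) = (\<Sum>j<n. f j)"
  using sum.reindex_bij_betw[OF index_nat_bij] by (simp add: atLeast0LessThan)

text \<open>C^T C = E^T conj(E) for C = \<open>coord_matrix bs\<close> and E =
  \<open>emb_mat bs\<close>, because the scaling of \<open>coord\<close> preserves these sums over
  all embeddings. The squared determinants agree without matching rows to each other.\<close>

lemma det_coord_matrix: "(Determinants.det (coord_matrix bs))\<^sup>2 = (cmod (det (emb_mat bs)))\<^sup>2"
proof -
  let ?G = "\<lambda>j l. \<Sum>\<sigma>\<in>complex_embeddings. coord \<sigma> (bs ! j) * coord \<sigma> (bs ! l)"
  interpret cnj_hom: comm_ring_hom cnj by unfold_locales simp_all
  have gram: "Finite_Cartesian_Product.transpose (coord_matrix bs) ** coord_matrix bs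
    = (\<chi> j l. ?G (index_nat j) (index_nat l))"
  proof (unfold vec_eq_iff, intro allI)
    fix j l
    show "(Finite_Cartesian_Product.transpose (coord_matrix bs) ** coord_matrix bs) $ j $ l
      = (\<chi> j l. ?G (index_nat j) (index_nat l)) $ j $ l"
      using sum_emb[of "\<lambda>\<sigma>. coord \<sigma> (bs ! index_nat j) * coord \<sigma> (bs ! index_nat l)"]
      by (simp only: matrix_matrix_mult_def Finite_Cartesian_Product.transpose_def coord_matrix_def vec_lambda_beta)
  qed
  have "(Determinants.det (coord_matrix bs))\<^sup>2
    = Determinants.det (Finite_Cartesian_Product.transpose (coord_matrix bs) ** coord_matrix bs)"
    by (simp only: det_mul Determinants.det_transpose power2_eq_square)
  also have "\<dots> = Determinants.det ((\<chi> j l. ?G (index_nat j) (index_nat l)) :: real ^ 'k place_index ^ 'k place_index)"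
    by (simp only: gram)
  also have "\<dots> = det (mat n n (\<lambda>(j, l). ?G j l))"
    by (rule det_cart_eq_det_mat[OF index_nat_bij])
  finally have "complex_of_real ((Determinants.det (coord_matrix bs))\<^sup>2)
    = det (map_mat of_real (mat n n (\<lambda>(j, l). ?G j l)))"
    by (simp only: of_real_hom.hom_det)
  also have "map_mat of_real (mat n n (\<lambda>(j, l). ?G j l)) = transpose_mat (emb_mat bs) * map_mat cnj (emb_mat bs)"
  proof (rule eq_matI)
    fix j l assume "j < dim_row (transpose_mat (emb_mat bs) * map_mat cnj (emb_mat bs))"
      "l < dim_col (transpose_mat (emb_mat bs) * map_mat cnj (emb_mat bs))"
    then have jl: "j < n" "l < n" by (simp_all add: emb_mat_def)
    have "(transpose_mat (emb_mat bs) * map_mat cnj (emb_mat bs)) $$ (j, l)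
      = (\<Sum>i<n. (emb_list ! i) (bs ! j) * cnj ((emb_list ! i) (bs ! l)))"
      using jl by (simp add: emb_mat_def scalar_prod_def atLeast0LessThan)
    also have "\<dots> = of_real (?G j l)"
      using sum_emb_list[of "\<lambda>\<sigma>. \<sigma> (bs ! j) * cnj (\<sigma> (bs ! l))"] sum_cnj_real by simp
    finally show "map_mat of_real (mat n n (\<lambda>(j, l). ?G j l)) $$ (j, l)
      = (transpose_mat (emb_mat bs) * map_mat cnj (emb_mat bs)) $$ (j, l)" using jl by simp
  qed (simp_all add: emb_mat_def)
  also have "det (transpose_mat (emb_mat bs) * map_mat cnj (emb_mat bs)) = det (emb_mat bs) * cnj (det (emb_mat bs))"
    using det_mult[OF iffD2[OF transpose_carrier_mat emb_mat_carrier], of "map_mat cnj (emb_mat bs)" bs]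
    by (simp add: Determinant.det_transpose[OF emb_mat_carrier])
  also have "\<dots> = complex_of_real ((cmod (det (emb_mat bs)))\<^sup>2)" by (rule complex_norm_square[symmetric])
  finally show ?thesis by (simp only: of_real_eq_iff)
qed

lemma det_emb_mat_scale:
  assumes "length bs = n"
  shows "det (emb_mat (map (\<lambda>b. b * y) bs)) = (\<Prod>\<sigma>\<in>complex_embeddings. \<sigma> y) * det (emb_mat bs)"
proof -
  let ?D = "mat n n (\<lambda>(i, j). if i = j then (emb_list ! i) y else 0)"
  have "emb_mat (map (\<lambda>b. b * y) bs) = ?D * emb_mat bs"
  proof (rule eq_matI)
    fix i j assume "i < dim_row (?D * emb_mat bs)" "j < dim_col (?D * emb_mat bs)"
    then have ij: "i < n" "j < n" by (simp_all add: emb_mat_def)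
    then show "emb_mat (map (\<lambda>b. b * y) bs) $$ (i, j) = (?D * emb_mat bs) $$ (i, j)"
      using assms by (simp add: emb_mat_def scalar_prod_def atLeast0LessThan if_distrib[of "\<lambda>x. x * _"] sum.delta
          emb_list_nth complex_embeddingsD cong: if_cong)
  qed (simp_all add: emb_mat_def)
  then have "det (emb_mat (map (\<lambda>b. b * y) bs)) = det ?D * det (emb_mat bs)"
    using det_mult[OF mat_carrier emb_mat_carrier] by metis
  then show ?thesis by (simp add: det_diag_mat prod_emb_list[of "\<lambda>\<sigma>. \<sigma> y"])
qed

end

section \<open>Minima of the norm\<close>

context primitive_number_field
begin

lemma embeddings_nonempty: "complex_embeddings \<noteq> ({} :: ('k \<Rightarrow> complex) set)"
  using card_embeddings n_pos by force

definition nm :: "'k \<Rightarrow> real" where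
  "nm x = real_of_rat (abs_norm x)"

lemma nm_eq_prod: "nm x = (\<Prod>\<sigma>\<in>complex_embeddings. cmod (\<sigma> x))"
  by (simp add: nm_def abs_norm_eq)

lemma nm_mult: "nm (x * y) = nm x * nm y"
  by (simp add: nm_eq_prod complex_embeddingsD norm_mult prod.distrib)

lemma nm_pos: "x \<noteq> 0 \<Longrightarrow> nm x > 0"
  by (simp add: nm_eq_prod prod_pos)

lemma nm_1: "nm 1 = 1"
  by (simp add: nm_eq_prod complex_embeddingsD)

lemma nm_inverse:
  assumes "x \<noteq> 0"
  shows "nm (1 / x) = 1 / nm x"
proof -
  have "nm (1 / x) * nm x = 1" using assms by (simp add: nm_1 flip: nm_mult)
  then show ?thesis using nm_pos[OF assms] by (simp add: field_simps)
qed

lemma ring_of_integers_diff: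
  "x \<in> ring_of_integers \<Longrightarrow> y \<in> ring_of_integers \<Longrightarrow> x - y \<in> (ring_of_integers :: 'k set)"
  by (simp add: ring_of_integers_def algebraic_int_diff)

lemma ring_of_integers_add:
  "x \<in> ring_of_integers \<Longrightarrow> y \<in> ring_of_integers \<Longrightarrow> x + y \<in> (ring_of_integers :: 'k set)"
  by (simp add: ring_of_integers_def algebraic_int_add)

lemma ring_of_integers_0: "0 \<in> (ring_of_integers :: 'k set)"
  by (simp add: ring_of_integers_def)

text \<open>The minimum is attained because the values \<open>N (x - c)\<close> lie in a discrete set: multiplying
  \<open>x\<close> by a common denominator makes them integers.\<close>

lemma nm_minimum_exists:
  "\<exists>c0\<in>ring_of_integers. \<forall>c\<in>ring_of_integers. nm (x - c0) \<le> nm (x - c)"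
proof -
  obtain D :: int where D: "D > 0" "of_int D * x \<in> ring_of_integers" using integral_multiple .
  define f where "f = (\<lambda>c. nat \<lfloor>nm (of_int D * (x - c))\<rfloor>)"
  have f: "real (f c) = nm (of_int D * (x - c))" if c: "c \<in> ring_of_integers" for c
  proof -
    have "of_int D * c \<in> ring_of_integers"
      using c by (auto simp: ring_of_integers_def intro!: algebraic_int_mult)
    then have "of_int D * (x - c) \<in> ring_of_integers"
      using ring_of_integers_diff[OF D(2)] by (simp add: right_diff_distrib)
    then obtain k where "field_norm (of_int D * (x - c)) = of_int k"
      using ring_of_integers_norm by (auto elim: Ints_cases)
    then have "nm (of_int D * (x - c)) = of_int \<bar>k\<bar>"
      by (simp add: nm_def abs_norm_def flip: of_int_abs)
    then show ?thesis unfolding f_def by simp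
  qed
  obtain c0 where c0: "c0 \<in> ring_of_integers" "\<And>c. c \<in> ring_of_integers \<Longrightarrow> f c0 \<le> f c"
    using ex_has_least_nat[of "\<lambda>c. c \<in> ring_of_integers" 0 f] ring_of_integers_0 by blast
  have "nm (x - c0) \<le> nm (x - c)" if c: "c \<in> ring_of_integers" for c
  proof -
    have "real (f c0) \<le> real (f c)" using c0(2)[OF c] by simp
    then have "nm (of_int D) * nm (x - c0) \<le> nm (of_int D) * nm (x - c)"
      using f c c0(1) by (simp add: nm_mult)
    moreover have "nm (of_int D) > 0" using D(1) by (intro nm_pos) simp
    ultimately show ?thesis by simp
  qed
  then show ?thesis using c0(1) by blast
qed

section \<open>The Minkowski embedding and its lattices\<close>

definition disc :: real where
  "disc = (cmod (det (emb_mat int_basis)))\<^sup>2"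

lemma abs_discriminant_eq_disc: "\<bar>real_of_rat (field_discriminant TYPE('k))\<bar> = disc"
  by (simp only: disc_def abs_discriminant)

lemma disc_ge_1: "disc \<ge> 1"
  using field_discriminant_abs_ge_1 by (simp only: abs_discriminant_eq_disc)

definition minkowski_vec :: "'k \<Rightarrow> real ^ 'k place_index" where
  "minkowski_vec x = (\<chi> i. coord (emb i) x)"

lemma coord_matrix_mult_vec:
  fixes a :: "nat \<Rightarrow> int"
  assumes "length bs = n" "\<And>j. z $ j = of_int (a (index_nat j))"
  shows "coord_matrix bs *v z = minkowski_vec (\<Sum>j<n. of_int (a j) * bs ! j)"
proof (unfold vec_eq_iff, intro allI)
  fix i
  have "(coord_matrix bs *v z) $ i
    = (\<Sum>j\<in>(UNIV :: 'k place_index set). coord (emb i) (bs ! index_nat j) * of_int (a (index_nat j)))"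
    by (simp add: matrix_vector_mult_def coord_matrix_def assms(2))
  also have "\<dots> = (\<Sum>j<n. coord (emb i) (bs ! j) * of_int (a j))"
    by (rule sum_index_nat)
  also have "\<dots> = minkowski_vec (\<Sum>j<n. of_int (a j) * bs ! j) $ i"
    by (simp add: minkowski_vec_def coord_of_int_sum emb_in mult.commute)
  finally show "(coord_matrix bs *v z) $ i = minkowski_vec (\<Sum>j<n. of_int (a j) * bs ! j) $ i" .
qed

lemma minkowski_vec_inner:
  "(\<chi> i. f (emb i)) \<bullet> minkowski_vec y = (\<Sum>\<sigma>\<in>complex_embeddings. f \<sigma> * coord \<sigma> y)"
  using sum_emb[of "\<lambda>\<sigma>. f \<sigma> * coord \<sigma> y"] by (simp add: inner_vec_def minkowski_vec_def)

lemma minkowski_vec_norm: "minkowski_vec x \<bullet> minkowski_vec x = (\<Sum>\<sigma>\<in>complex_embeddings. (cmod (\<sigma> x))\<^sup>2)"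
proof -
  have "minkowski_vec x \<bullet> minkowski_vec x = (\<Sum>\<sigma>\<in>complex_embeddings. coord \<sigma> x * coord \<sigma> x)"
    using minkowski_vec_inner[of "\<lambda>\<sigma>. coord \<sigma> x" x] by (simp add: minkowski_vec_def)
  also have "\<dots> = (\<Sum>\<sigma>\<in>complex_embeddings. (coord \<sigma> x)\<^sup>2)" by (simp only: power2_eq_square)
  finally show ?thesis by (simp only: coord_square_sum)
qed

lemma minkowski_vec_add: "minkowski_vec (x + y) = minkowski_vec x + minkowski_vec y"
  by (simp add: vec_eq_iff minkowski_vec_def coord_add emb_in)

lemma minkowski_vec_diff: "minkowski_vec (x - y) = minkowski_vec x - minkowski_vec y"
  by (simp add: vec_eq_iff minkowski_vec_def coord_diff emb_in)

text \<open>The multiples a y with integral a form a lattice of covolume sqrt(disc) N(y). The volume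
  condition is squared because the determinant is known through its square.\<close>

theorem minkowski_number_field:
  assumes y: "y \<noteq> 0" and c: "\<And>\<sigma>. \<sigma> \<in> complex_embeddings \<Longrightarrow> c \<sigma> > 0"
    and vol: "disc * (nm y)\<^sup>2 < (\<Prod>\<sigma>\<in>complex_embeddings. c \<sigma>)\<^sup>2"
  obtains a where "a \<in> ring_of_integers" "a \<noteq> 0"
    "\<And>\<sigma>. \<sigma> \<in> complex_embeddings \<Longrightarrow> \<bar>coord \<sigma> (a * y)\<bar> < c \<sigma>"
proof -
  define bs where "bs = map (\<lambda>b. b * y) int_basis"
  have len: "length bs = n" by (simp add: bs_def int_basis_length)
  have "(Determinants.det (coord_matrix bs))\<^sup>2 = (nm y)\<^sup>2 * disc"
    unfolding det_coord_matrix bs_def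
    by (simp add: det_emb_mat_scale int_basis_length norm_mult power_mult_distrib nm_eq_prod prod_norm disc_def)
  then have det: "(Determinants.det (coord_matrix bs))\<^sup>2 = disc * (nm y)\<^sup>2" by simp
  have "disc * (nm y)\<^sup>2 > 0" using disc_ge_1 nm_pos[OF y] by (intro mult_pos_pos) auto
  then have det0: "Determinants.det (coord_matrix bs) \<noteq> 0" using det by auto
  have "\<bar>Determinants.det (coord_matrix bs)\<bar>\<^sup>2 < (\<Prod>i\<in>UNIV. c (emb i))\<^sup>2"
    using vol by (simp add: det prod_emb)
  then have "\<bar>Determinants.det (coord_matrix bs)\<bar> < (\<Prod>i\<in>UNIV. c (emb i))"
    by (rule power2_less_imp_less) (simp add: prod_nonneg c emb_in less_imp_le)
  then obtain z where z: "z \<noteq> 0" "\<And>i. z $ i \<in> \<int>" "\<And>i. \<bar>(coord_matrix bs *v z) $ i\<bar> < c (emb i)"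
    using minkowski_linear_forms[of "\<lambda>i. c (emb i)" "coord_matrix bs"] c emb_in det0 by blast
  define k where "k = (\<lambda>l. \<lfloor>z $ (inv_into UNIV index_nat l)\<rfloor>)"
  have k: "z $ j = of_int (k (index_nat j))" for j
    using z(2)[of j] index_nat_bij by (auto simp: k_def inv_f_f bij_betw_def elim!: Ints_cases)
  define a where "a = (\<Sum>j<n. of_int (k j) * int_basis ! j)"
  have ay: "(\<Sum>j<n. of_int (k j) * bs ! j) = a * y"
    by (simp add: a_def bs_def int_basis_length sum_distrib_right mult.assoc)
  have "a \<in> ring_of_integers" unfolding a_def ring_of_integers_int_basis by blast
  moreover have "a \<noteq> 0"
  proof
    assume "a = 0"
    then have "(\<Sum>j<n. of_rat (of_int (k j)) * int_basis ! j) = 0" by (simp add: a_def)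
    then have "rat_of_int (k j) = 0" if "j < n" for j
      using emb_mat_relation[OF det_int_basis_nonzero, of "\<lambda>j. of_int (k j)"] that by blast
    then have "z $ j = 0" for j using k[of j] index_nat_less by simp
    then show False using z(1) by (simp add: vec_eq_iff)
  qed
  moreover have "\<bar>coord \<sigma> (a * y)\<bar> < c \<sigma>" if "\<sigma> \<in> complex_embeddings" for \<sigma>
  proof -
    have "\<sigma> \<in> range emb" using emb_bij that by (simp add: bij_betw_def)
    then obtain i where i: "\<sigma> = emb i" by blast
    have "(coord_matrix bs *v z) $ i = coord (emb i) (a * y)"
      using coord_matrix_mult_vec[OF len k] by (simp add: ay minkowski_vec_def)
    then show ?thesis using z(3)[of i] by (simp add: i)
  qed
  ultimately show ?thesis using that by blast
qed

text \<open>\<open>h\<close> is a lower bound for the geometric mean of the |\<sigma> x|^2; stating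
  it through \<open>h ^ n\<close> keeps roots out.\<close>

lemma sum_norm_square_ge:
  assumes "h ^ n \<le> (nm x)\<^sup>2"
  shows "real n * h \<le> (\<Sum>\<sigma>\<in>complex_embeddings. (cmod (\<sigma> x))\<^sup>2)"
proof -
  show ?thesis
    using embeddings_nonempty sum_ge_of_prod_ge[of "complex_embeddings :: ('k \<Rightarrow> complex) set" "\<lambda>\<sigma>. (cmod (\<sigma> x))\<^sup>2" h] assms
    by (simp add: card_embeddings nm_eq_prod prod_power_distrib)
qed

lemma nm_square_le:
  "(nm x)\<^sup>2 \<le> ((\<Sum>\<sigma>\<in>complex_embeddings. (cmod (\<sigma> x))\<^sup>2) / n) ^ n"
proof -
  show ?thesis
    using embeddings_nonempty prod_le_mean_power[of "complex_embeddings :: ('k \<Rightarrow> complex) set" "\<lambda>\<sigma>. (cmod (\<sigma> x))\<^sup>2"]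
    by (simp add: card_embeddings nm_eq_prod prod_power_distrib)
qed

text \<open>Chebotarev's argument. If \<open>c0\<close> minimises \<open>N (x - c)\<close> and \<open>y0 = x - c0\<close>, then
  \<open>N (1 \<plusminus> a / y0) \<ge> 1\<close> for every integer \<open>a\<close>, whereas Minkowski's theorem yields an \<open>a \<noteq> 0\<close> for which
  \<open>a / y0\<close> has small imaginary parts and \<open>N (1 - (a / y0)\<^sup>2) < 1\<close>. Here \<open>N (y0)\<^sup>2 = 1 / h ^ n\<close>.\<close>

lemma chebotarev_contradiction:
  assumes sig: "has_signature TYPE('k) r s"
    and c0: "c0 \<in> ring_of_integers" "\<And>c. c \<in> ring_of_integers \<Longrightarrow> nm (x - c0) \<le> nm (x - c)"
    and h: "h > 0" "(nm (x - c0))\<^sup>2 * h ^ n = 1"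
    and A: "A > 0" "\<beta> > 0"
    and vol: "disc * h ^ n < A ^ (r + s) * \<beta> ^ s * 4 ^ s"
    and \<beta>: "8 * real s * \<beta> \<le> real n * h"
    and A': "A \<le> A'" "s > 0 \<Longrightarrow> A + \<beta> \<le> A'"
    and cond: "A' \<le> 1 \<or> real n * h \<le> A' * (2 - A')"
  shows False
proof -
  define y0 where "y0 = x - c0"
  have "y0 \<noteq> 0"
  proof
    assume "y0 = 0"
    obtain \<sigma> :: "'k \<Rightarrow> complex" where "\<sigma> \<in> complex_embeddings" using embeddings_nonempty by blast
    then have "nm (x - c0) = 0" unfolding nm_eq_prod
      using \<open>y0 = 0\<close> by (intro prod_zero) (auto simp: y0_def embedding_0)
    then show False using h(2) by simp
  qed
  note cards = signature_cards[OF sig]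
  \<comment> \<open>The box of squared real parts below \<open>A\<close> and squared imaginary parts
    below \<beta>. The factors 2 match the scaling of \<open>coord\<close> and produce the
    \<open>4 ^ s\<close> in the volume.\<close>
  define c where "c \<sigma> = (if Im (\<sigma> \<gamma>) = 0 then sqrt A else if Im (\<sigma> \<gamma>) > 0 then sqrt (2 * A) else sqrt (2 * \<beta>))"
    for \<sigma> :: "'k \<Rightarrow> complex"
  have c2: "(c \<sigma>)\<^sup>2 = (if Im (\<sigma> \<gamma>) = 0 then A else if Im (\<sigma> \<gamma>) > 0 then 2 * A else 2 * \<beta>)" for \<sigma>
    using A by (simp add: c_def)
  have "(\<Prod>\<sigma>\<in>complex_embeddings. c \<sigma>)\<^sup>2 = (\<Prod>\<sigma>\<in>complex_embeddings. (c \<sigma>)\<^sup>2)" by (simp add: prod_power_distrib)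
  also have "\<dots> = (\<Prod>\<sigma>\<in>places_R. A) * ((\<Prod>\<sigma>\<in>places_P. 2 * A) * (\<Prod>\<sigma>\<in>places_N. 2 * \<beta>))"
    unfolding prod_places
    by (intro arg_cong2[of _ _ _ _ "(*)"] prod.cong refl)
      (auto simp: c2 places_R_def places_P_def places_N_def)
  also have "\<dots> = A ^ (r + s) * \<beta> ^ s * 4 ^ s"
  proof -
    have "(2::real) ^ s * 2 ^ s = 4 ^ s" by (simp flip: power_mult_distrib)
    then show ?thesis by (simp add: cards(1-3) power_mult_distrib power_add mult_ac)
  qed
  finally have prod_c: "(\<Prod>\<sigma>\<in>complex_embeddings. c \<sigma>)\<^sup>2 = A ^ (r + s) * \<beta> ^ s * 4 ^ s" .
  have nm0: "nm y0 > 0" by (rule nm_pos[OF \<open>y0 \<noteq> 0\<close>])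
  have hn: "1 / (nm y0)\<^sup>2 = h ^ n" using h(2) nm0 by (simp add: y0_def field_simps)
  have "disc * (nm (1 / y0))\<^sup>2 < (\<Prod>\<sigma>\<in>complex_embeddings. c \<sigma>)\<^sup>2"
    unfolding prod_c using vol by (simp add: nm_inverse[OF \<open>y0 \<noteq> 0\<close>] power_divide hn)
  moreover have "c \<sigma> > 0" for \<sigma> using A by (simp add: c_def)
  moreover have "1 / y0 \<noteq> 0" using \<open>y0 \<noteq> 0\<close> by simp
  ultimately obtain a where a: "a \<in> ring_of_integers" "a \<noteq> 0"
    "\<And>\<sigma>. \<sigma> \<in> complex_embeddings \<Longrightarrow> \<bar>coord \<sigma> (a * (1 / y0))\<bar> < c \<sigma>"
    using minkowski_number_field[of "1 / y0" c] by blast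
  define l where "l = a * (1 / y0)"
  have coord2: "(coord \<sigma> l)\<^sup>2 < (c \<sigma>)\<^sup>2" if "\<sigma> \<in> complex_embeddings" for \<sigma>
    using power_strict_mono[of "\<bar>coord \<sigma> l\<bar>" "c \<sigma>" 2] a(3)[OF that] by (simp add: l_def)
  have ImR: "Im (\<sigma> l) = 0" if "\<sigma> \<in> places_R" for \<sigma> using places_R_real that by blast
  have ReR: "(Re (\<sigma> l))\<^sup>2 < A" if "\<sigma> \<in> places_R" for \<sigma>
    using coord2[of \<sigma>] that by (simp add: c2 coord_def places_R_def)
  have ReP: "(Re (\<sigma> l))\<^sup>2 < A" if "\<sigma> \<in> places_P" for \<sigma>
    using coord2[of \<sigma>] that by (simp add: c2 coord_def places_P_def power_mult_distrib)
  have ImN: "(Im (\<sigma> l))\<^sup>2 < \<beta>" if "\<sigma> \<in> places_N" for \<sigma>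
    using coord2[of \<sigma>] that by (simp add: c2 coord_def places_N_def power_mult_distrib)
  \<comment> \<open>The box bounds the imaginary part at one member of each pair and the real part
    at the other; conjugation supplies the missing bounds.\<close>
  have ImP: "(Im (\<sigma> l))\<^sup>2 < \<beta>" if "\<sigma> \<in> places_P" for \<sigma>
    using ImN[of "cnj \<circ> \<sigma>"] that places_cnj_bij by (auto simp: bij_betw_def)
  have ReN: "(Re (\<sigma> l))\<^sup>2 < A" if "\<sigma> \<in> places_N" for \<sigma>
  proof -
    obtain \<tau> where "\<tau> \<in> places_P" "\<sigma> = cnj \<circ> \<tau>" using places_cnj_bij \<open>\<sigma> \<in> places_N\<close> by (auto simp: bij_betw_def)
    then show ?thesis using ReP by simp
  qed
  let ?\<rho> = "\<lambda>\<sigma>. (cmod (\<sigma> l))\<^sup>2"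
  have \<rho>: "0 \<le> ?\<rho> \<sigma>" "?\<rho> \<sigma> \<le> A'" if "\<sigma> \<in> complex_embeddings" for \<sigma>
  proof -
    show "?\<rho> \<sigma> \<le> A'"
    proof (cases "\<sigma> \<in> places_R")
      case True
      then show ?thesis using ReR[OF True] ImR[OF True] A' by (simp add: cmod_power2)
    next
      case False
      then have *: "\<sigma> \<in> places_P \<or> \<sigma> \<in> places_N" using that places_partition(1) by blast
      then have "s > 0" using cards(2,3) finite_places by (metis card_gt_0_iff empty_iff)
      moreover have "(Re (\<sigma> l))\<^sup>2 < A" "(Im (\<sigma> l))\<^sup>2 < \<beta>" using * ReP ReN ImP ImN by blast+
      ultimately show ?thesis using A'(2) by (simp add: cmod_power2)
    qed
  qed simp
  have im: "(\<Sum>\<sigma>\<in>complex_embeddings. 4 * (Im (\<sigma> l))\<^sup>2) < real n * h"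
  proof (cases "s = 0")
    case True
    then have "places_P = {}" "places_N = {}" using cards(2,3) by auto
    then have "(\<Sum>\<sigma>\<in>complex_embeddings. 4 * (Im (\<sigma> l))\<^sup>2) = 0" unfolding sum_places by (simp add: ImR)
    then show ?thesis using h n_pos by simp
  next
    case False
    then have ne: "places_P \<noteq> {}" "places_N \<noteq> {}" using cards(2,3) by auto
    have "(\<Sum>\<sigma>\<in>places_P. 4 * (Im (\<sigma> l))\<^sup>2) < (\<Sum>\<sigma>\<in>places_P. 4 * \<beta>)"
      using ImP ne by (intro sum_strict_mono) auto
    moreover have "(\<Sum>\<sigma>\<in>places_N. 4 * (Im (\<sigma> l))\<^sup>2) < (\<Sum>\<sigma>\<in>places_N. 4 * \<beta>)"
      using ImN ne by (intro sum_strict_mono) auto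
    ultimately have "(\<Sum>\<sigma>\<in>complex_embeddings. 4 * (Im (\<sigma> l))\<^sup>2) < 8 * real s * \<beta>"
      unfolding sum_places by (simp add: ImR cards(2,3))
    then show ?thesis using \<beta> by simp
  qed
  have "nm a \<ge> 1" using abs_norm_ring_of_integers[OF a(1,2)] by (simp add: nm_def)
  then have "(nm a)\<^sup>2 \<ge> 1" by simp
  then have "h ^ n \<le> (nm l)\<^sup>2"
    unfolding l_def nm_mult nm_inverse[OF \<open>y0 \<noteq> 0\<close>] power_mult_distrib power_divide
    using h(1) by (simp add: hn)
  then have mean: "real n * h \<le> (\<Sum>\<sigma>\<in>complex_embeddings. ?\<rho> \<sigma>)" by (rule sum_norm_square_ge)
  \<comment> \<open>If every \<rho> is at most 1, then 2 \<rho> - \<rho>^2 \<ge> \<rho> and the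
    means suffice. Otherwise the second alternative of \<open>cond\<close> holds, and a single
    \<rho> between 1 and A' already contributes A' (2 - A'), because t (2 - t) decreases from t = 1
    on.\<close>
  have "real n * h \<le> (\<Sum>\<sigma>\<in>complex_embeddings. 2 * ?\<rho> \<sigma> - (?\<rho> \<sigma>)\<^sup>2)"
  proof (cases "\<forall>\<sigma>\<in>complex_embeddings. ?\<rho> \<sigma> \<le> 1")
    case True
    have "(\<Sum>\<sigma>\<in>complex_embeddings. ?\<rho> \<sigma>) \<le> (\<Sum>\<sigma>\<in>complex_embeddings. 2 * ?\<rho> \<sigma> - (?\<rho> \<sigma>)\<^sup>2)"
    proof (rule sum_mono)
      fix \<sigma> :: "'k \<Rightarrow> complex" assume \<sigma>: "\<sigma> \<in> complex_embeddings"
      have "?\<rho> \<sigma> * ?\<rho> \<sigma> \<le> ?\<rho> \<sigma> * 1" using True \<sigma> by (intro mult_left_mono) auto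
      then show "?\<rho> \<sigma> \<le> 2 * ?\<rho> \<sigma> - (?\<rho> \<sigma>)\<^sup>2" by (simp add: power2_eq_square)
    qed
    then show ?thesis using mean by linarith
  next
    case False
    then obtain \<tau> where \<tau>: "\<tau> \<in> complex_embeddings" "?\<rho> \<tau> > 1" by force
    have big: "real n * h \<le> A' * (2 - A')" using cond \<tau> \<rho>(2)[OF \<tau>(1)] by linarith
    moreover have "A' > 1" using \<tau> \<rho>(2)[OF \<tau>(1)] by linarith
    moreover have "real n * h > 0" using h n_pos by simp
    ultimately have "A' < 2" by (smt (verit) mult_nonneg_nonpos)
    have g: "2 * ?\<rho> \<sigma> - (?\<rho> \<sigma>)\<^sup>2 \<ge> 0" if "\<sigma> \<in> complex_embeddings" for \<sigma>
    proof -
      have "?\<rho> \<sigma> * (2 - ?\<rho> \<sigma>) \<ge> 0" using \<rho>[OF that] \<open>A' < 2\<close> by (intro mult_nonneg_nonneg) auto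
      then show ?thesis by (simp add: power2_eq_square right_diff_distrib)
    qed
    have "0 \<le> (A' - ?\<rho> \<tau>) * (A' + ?\<rho> \<tau> - 2)"
      using \<tau> \<rho>(2)[OF \<tau>(1)] \<open>A' > 1\<close> by (intro mult_nonneg_nonneg) auto
    then have "A' * (2 - A') \<le> 2 * ?\<rho> \<tau> - (?\<rho> \<tau>)\<^sup>2" by (simp add: power2_eq_square algebra_simps)
    also have "\<dots> \<le> (\<Sum>\<sigma>\<in>complex_embeddings. 2 * ?\<rho> \<sigma> - (?\<rho> \<sigma>)\<^sup>2)"
      using g \<tau>(1) by (intro member_le_sum) auto
    finally show ?thesis using big by linarith
  qed
  then have "(\<Sum>\<sigma>\<in>complex_embeddings. 4 * (Im (\<sigma> l))\<^sup>2) < (\<Sum>\<sigma>\<in>complex_embeddings. 2 * ?\<rho> \<sigma> - (?\<rho> \<sigma>)\<^sup>2)"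
    using im by linarith
  then have "(\<Prod>\<sigma>\<in>complex_embeddings. cmod (1 - (\<sigma> l)\<^sup>2)) < 1"
    using prod_one_minus_square_less[of complex_embeddings "\<lambda>\<sigma>. \<sigma> l"] by simp
  moreover have "(\<Prod>\<sigma>\<in>complex_embeddings. cmod (1 - (\<sigma> l)\<^sup>2)) = nm (1 - l\<^sup>2)"
    unfolding nm_eq_prod
    by (intro prod.cong refl) (simp add: embedding_diff complex_embeddingsD embedding_power)
  moreover have "nm (1 - l\<^sup>2) = nm (1 + l) * nm (1 - l)"
    by (simp add: power2_eq_square algebra_simps flip: nm_mult)
  moreover have "nm (1 + l) \<ge> 1" "nm (1 - l) \<ge> 1"
  proof -
    \<comment> \<open>\<open>y0 + u\<close> is again \<open>x\<close> minus an algebraic integer, so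
      the minimality of \<open>c0\<close> applies to it.\<close>
    have *: "nm (1 + u / y0) \<ge> 1" if "u \<in> ring_of_integers" for u
    proof -
      have "y0 * (1 + u / y0) = y0 + u" using \<open>y0 \<noteq> 0\<close> by (simp add: distrib_left)
      also have "\<dots> = x - (c0 - u)" by (simp add: y0_def)
      finally have "nm y0 * nm (1 + u / y0) = nm (x - (c0 - u))" by (simp only: nm_mult[symmetric])
      moreover have "nm y0 \<le> nm (x - (c0 - u))"
        unfolding y0_def using c0 ring_of_integers_diff that by blast
      ultimately show ?thesis using nm0 by (metis mult_le_cancel_left_pos mult.right_neutral)
    qed
    show "nm (1 + l) \<ge> 1" using *[OF a(1)] by (simp add: l_def)
    show "nm (1 - l) \<ge> 1"
      using *[of "- a"] ring_of_integers_diff[OF ring_of_integers_0 a(1)] by (simp add: l_def)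
  qed
  then have "nm (1 + l) * nm (1 - l) \<ge> 1 * 1" by (intro mult_mono) auto
  ultimately show False by linarith
qed

text \<open>The trace form is nondegenerate, so all prescribed traces against the integral basis are
  attained. This makes every dual vector in \<open>covering_norm_bound\<close> the image of a field
  element.\<close>

lemma trace_dual_element:
  fixes t :: "nat \<Rightarrow> int"
  obtains u :: 'k where "\<And>j. j < n \<Longrightarrow> field_trace (u * int_basis ! j) = of_int (t j)"
proof -
  let ?T = "trace_form_matrix int_basis"
  have T: "?T \<in> carrier_mat n n" by (simp add: trace_form_matrix_def int_basis_length)
  have "of_rat (det ?T) \<noteq> (0 :: complex)"
    using of_rat_det_trace_form[OF int_basis_length] det_int_basis_nonzero by simp
  then have "det ?T \<noteq> 0" by auto
  then obtain B where B: "B \<in> carrier_mat n n" "?T * B = 1\<^sub>m n"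
    using det_non_zero_imp_unit[OF T, of "()"] by (auto simp: Units_def ring_mat_def)
  define v where "v = B *\<^sub>v vec n (\<lambda>j. rat_of_int (t j))"
  have v: "v \<in> carrier_vec n" using B by (simp add: v_def)
  have Tv: "?T *\<^sub>v v = vec n (\<lambda>j. rat_of_int (t j))"
    unfolding v_def by (subst assoc_mult_mat_vec[OF T B(1), symmetric]) (simp_all add: B)
  define u where "u = (\<Sum>i<n. of_rat (vec_index v i) * int_basis ! i)"
  have "field_trace (u * int_basis ! j) = of_int (t j)" if j: "j < n" for j
  proof -
    have "complex_of_rat (field_trace (u * int_basis ! j))
      = (\<Sum>\<sigma>\<in>complex_embeddings. \<Sum>i<n. of_rat (vec_index v i) * \<sigma> (int_basis ! j * int_basis ! i))"
      unfolding field_trace_eq_sum u_def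
      by (intro sum.cong refl)
        (simp add: embedding_sum complex_embeddingsD embedding_of_rat sum_distrib_left mult_ac)
    also have "\<dots> = of_rat (\<Sum>i<n. field_trace (int_basis ! j * int_basis ! i) * vec_index v i)"
      by (subst sum.swap) (simp add: of_rat_sum of_rat_mult field_trace_eq_sum sum_distrib_left mult.commute)
    finally have "field_trace (u * int_basis ! j) = (\<Sum>i<n. field_trace (int_basis ! j * int_basis ! i) * vec_index v i)"
      by (simp only: of_rat_eq_iff)
    also have "\<dots> = vec_index (?T *\<^sub>v v) j"
      using j v by (simp add: scalar_prod_def trace_form_matrix_def int_basis_length atLeast0LessThan)
    finally show ?thesis using j by (simp add: Tv)
  qed
  then show ?thesis using that by blast
qed

lemma det_coord_matrix_int_basis: "Determinants.det (coord_matrix int_basis) \<noteq> 0"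
  using det_coord_matrix[of int_basis] det_int_basis_nonzero by auto

lemma coord_matrix_transpose_mult:
  "(Finite_Cartesian_Product.transpose (coord_matrix bs) *v w) $ j = w \<bullet> minkowski_vec (bs ! index_nat j)"
  by (simp add: matrix_vector_mult_def Finite_Cartesian_Product.transpose_def coord_matrix_def
      inner_vec_def minkowski_vec_def mult.commute)

text \<open>The covering radius is bounded through the dual lattice, which is the codifferent; its nonzero
  elements have norm at least \<open>1 / disc\<close>.\<close>

theorem covering_norm_bound:
  "\<exists>c\<in>ring_of_integers. (nm (x - c))\<^sup>2 \<le> ((\<Sum>i<n. (4/3) ^ i) / (4 * (real n)\<^sup>2)) ^ n * disc\<^sup>2"
proof -
  let ?A = "coord_matrix int_basis"
  let ?S = "\<Sum>i<n. (4/3::real) ^ i"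
  have d1: "disc \<ge> 1" by (rule disc_ge_1)
  \<comment> \<open>\<open>h ^ n\<close> bounds the squared norm of nonzero elements of the
    codifferent from below, so by the means their squared length is at least n h.\<close>
  define h where "h = root n (1 / disc\<^sup>2)"
  have h: "h > 0" "h ^ n = 1 / disc\<^sup>2"
    using n_pos d1 by (auto simp: h_def real_root_pow_pos2 real_root_gt_zero)
  define \<delta> where "\<delta> = real n * h"
  have \<delta>: "\<delta> > 0" using h n_pos by (simp add: \<delta>_def)
  define L where "L = minkowski_vec ` ring_of_integers"
  define At where "At = Finite_Cartesian_Product.transpose ?A"
  have "Determinants.det At \<noteq> 0" using det_coord_matrix_int_basis by (simp add: At_def Determinants.det_transpose)
  then obtain B where B: "At ** B = Finite_Cartesian_Product.mat 1" "B ** At = Finite_Cartesian_Product.mat 1"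
    unfolding invertible_det_nz[symmetric] invertible_def by blast
  have AtB: "At *v (B *v w) = w" "B *v (At *v w) = w" for w
    by (simp_all add: matrix_vector_mul_assoc B)
  have dual_int: "w \<bullet> l \<in> \<int>" if w: "\<And>j. (At *v w) $ j \<in> \<int>" and l: "l \<in> L" for w l
  proof -
    obtain a :: "nat \<Rightarrow> int" where a: "l = minkowski_vec (\<Sum>j<n. of_int (a j) * int_basis ! j)"
      using l ring_of_integers_int_basis by (auto simp: L_def)
    define z :: "real ^ 'k place_index" where "z = (\<chi> j. of_int (a (index_nat j)))"
    have "l = ?A *v z"
      unfolding a by (rule coord_matrix_mult_vec[symmetric]) (simp_all add: int_basis_length z_def)
    then have "w \<bullet> l = (At *v w) \<bullet> z"
      by (simp add: At_def dot_lmul_matrix flip: matrix_transpose_mul)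
    also have "\<dots> \<in> \<int>" using w by (auto simp: inner_vec_def z_def intro!: Ints_sum Ints_mult)
    finally show ?thesis .
  qed
  have "\<exists>l\<in>L. (minkowski_vec x - l) \<bullet> (minkowski_vec x - l) \<le> ?S / (4 * \<delta>)"
  proof (rule dual_covering_bound[of UNIV])
    show "dim (UNIV :: (real ^ 'k place_index) set) = n" by (simp add: card_place_index)
    show "0 \<in> L" unfolding L_def using ring_of_integers_0
      by (auto simp: image_iff vec_eq_iff minkowski_vec_def coord_def embedding_0 emb_in intro!: bexI[of _ 0])
    show "a + b \<in> L" if "a \<in> L" "b \<in> L" for a b
      using that ring_of_integers_add by (auto simp: L_def simp flip: minkowski_vec_add)
    show "a - b \<in> L" if "a \<in> L" "b \<in> L" for a b
      using that ring_of_integers_diff by (auto simp: L_def simp flip: minkowski_vec_diff)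
    show "UNIV \<subseteq> span {w \<in> UNIV. \<forall>l\<in>L. w \<bullet> l \<in> \<int>}"
    proof
      fix w :: "real ^ 'k place_index"
      \<comment> \<open>The columns of \<open>B\<close> form the basis dual to the integral
        basis.\<close>
      have "w = B *v (\<Sum>j\<in>UNIV. (At *v w) $ j *s axis j 1)" by (simp add: basis_expansion AtB)
      also have "\<dots> = (\<Sum>j\<in>UNIV. (At *v w) $ j *\<^sub>R (B *v axis j 1))"
        by (simp add: linear_sum[OF matrix_vector_mul_linear] scalar_mult_eq_scaleR
            linear_scale[OF matrix_vector_mul_linear])
      also have "\<dots> \<in> span {w \<in> UNIV. \<forall>l\<in>L. w \<bullet> l \<in> \<int>}"
      proof (intro span_sum span_scale span_base)
        fix j :: "'k place_index"
        have "(At *v (B *v axis j 1)) $ i \<in> \<int>" for i by (simp add: AtB axis_def)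
        then show "B *v axis j 1 \<in> {w \<in> UNIV. \<forall>l\<in>L. w \<bullet> l \<in> \<int>}" using dual_int by blast
      qed
      finally show "w \<in> span {w \<in> UNIV. \<forall>l\<in>L. w \<bullet> l \<in> \<int>}" .
    qed
    fix w :: "real ^ 'k place_index" assume w: "\<forall>l\<in>L. w \<bullet> l \<in> \<int>" "w \<noteq> 0"
    \<comment> \<open>The integers by which \<open>w\<close> pairs with the basis determine
      \<open>w\<close>. The field element \<open>u\<close> with these traces has the same pairings,
      and so \<open>w\<close> consists of its coordinates \<open>coord_cnj\<close>.\<close>
    define t where "t = (\<lambda>j. \<lfloor>w \<bullet> minkowski_vec (int_basis ! j)\<rfloor>)"
    have t: "of_int (t j) = w \<bullet> minkowski_vec (int_basis ! j)" if "j < n" for j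
    proof -
      have "w \<bullet> minkowski_vec (int_basis ! j) \<in> \<int>" using w(1) int_basis_in[OF that] by (auto simp: L_def)
      then show ?thesis by (auto simp: t_def elim!: Ints_cases)
    qed
    obtain u where u: "\<And>j. j < n \<Longrightarrow> field_trace (u * int_basis ! j) = of_int (t j)"
      using trace_dual_element[of t] by blast
    define w' :: "real ^ 'k place_index" where "w' = (\<chi> i. coord_cnj (emb i) u)"
    have "(At *v w') $ j = (At *v w) $ j" for j
    proof -
      have j: "index_nat j < n" by (rule index_nat_less)
      have "(At *v w') $ j = (\<Sum>\<sigma>\<in>complex_embeddings. Re (\<sigma> (u * int_basis ! index_nat j)))"
        using minkowski_vec_inner[of "\<lambda>\<sigma>. coord_cnj \<sigma> u" "int_basis ! index_nat j"]
        by (simp only: At_def coord_matrix_transpose_mult w'_def coord_cnj_inner)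
      also have "\<dots> = Re (of_rat (field_trace (u * int_basis ! index_nat j)))"
        by (simp add: field_trace_eq_sum)
      also have "\<dots> = of_int (t (index_nat j))" by (simp add: u[OF j])
      finally show ?thesis by (simp only: t[OF j] At_def coord_matrix_transpose_mult)
    qed
    then have "At *v w' = At *v w" by (simp add: vec_eq_iff)
    then have ww: "w = w'" using AtB(2) by metis
    have norm_w: "w \<bullet> w = (\<Sum>\<sigma>\<in>complex_embeddings. (cmod (\<sigma> u))\<^sup>2)"
    proof -
      have "w \<bullet> w = (\<Sum>i\<in>UNIV. (coord (emb i) u)\<^sup>2)"
        unfolding ww w'_def inner_vec_def by (intro sum.cong refl) (simp add: coord_cnj_def power2_eq_square)
      then show ?thesis using sum_emb[of "\<lambda>\<sigma>. (coord \<sigma> u)\<^sup>2"] by (simp add: coord_square_sum)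
    qed
    have "u \<noteq> 0"
    proof
      assume "u = 0"
      then have "w \<bullet> w = 0" unfolding norm_w by (simp add: embedding_0)
      then show False using w(2) by simp
    qed
    then have "nm u * disc \<ge> 1" using codifferent_norm_ge[of u] u by (simp only: nm_def abs_discriminant_eq_disc Ints_of_int simp_thms)
    then have "(nm u * disc)\<^sup>2 \<ge> 1" by simp
    then have "h ^ n \<le> (nm u)\<^sup>2" using d1 by (simp add: h(2) power_mult_distrib divide_le_eq)
    then show "\<delta> \<le> w \<bullet> w" unfolding norm_w \<delta>_def by (rule sum_norm_square_ge)
  qed (use \<delta> in auto)
  then obtain c where c: "c \<in> ring_of_integers"
    "minkowski_vec (x - c) \<bullet> minkowski_vec (x - c) \<le> ?S / (4 * \<delta>)"
    by (auto simp: L_def minkowski_vec_diff)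
  \<comment> \<open>The means again: a short vector has small norm.\<close>
  have "(nm (x - c))\<^sup>2 \<le> ((\<Sum>\<sigma>\<in>complex_embeddings. (cmod (\<sigma> (x - c)))\<^sup>2) / n) ^ n" by (rule nm_square_le)
  also have "\<dots> \<le> (?S / (4 * \<delta>) / n) ^ n"
    using c(2) unfolding minkowski_vec_norm
    by (intro power_mono divide_right_mono divide_nonneg_nonneg sum_nonneg) auto
  also have "\<dots> = (?S / (4 * (real n)\<^sup>2)) ^ n * (1 / h ^ n)"
  proof -
    have "?S / (4 * \<delta>) / n = ?S / (4 * (real n)\<^sup>2) * (1 / h)"
      by (simp add: \<delta>_def power2_eq_square)
    then show ?thesis by (simp only: power_mult_distrib power_one_over)
  qed
  also have "1 / h ^ n = disc\<^sup>2" by (simp add: h(2))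
  finally show ?thesis using c(1) by blast
qed

end

section \<open>The bound\<close>

lemma sum_four_thirds: "(\<Sum>i<m. (4/3::real) ^ i) = 3 * ((4/3) ^ m - 1)"
  by (subst geometric_sum) auto

lemma interval_4_24_cases:
  fixes n :: nat
  assumes "4 \<le> n" "n \<le> 24"
  shows "n \<in> {4, 5, 6, 7, 8, 9, 10, 11, 12, 13, 14, 15, 16, 17, 18, 19, 20, 21, 22, 23, 24}"
  using assms by (simp only: insert_iff empty_iff) presburger

text \<open>The number is \<open>16 * \<kappa> / real n\<close>, with \<open>\<kappa>\<close> as in
  \<open>chebotarev_parameters\<close>, and will bound n h. It is below 1 up to degree 24 and above
  1 at degree 25; the sharper bounds leave room for larger values of \<open>A\<close>.\<close>

lemma four_thirds_bounds:
  assumes "4 \<le> n" "n \<le> 24"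
  shows "12 * ((4/3::real) ^ n - 1) / real n ^ 3 \<le> 9/10"
    and "n \<le> 13 \<Longrightarrow> 12 * ((4/3::real) ^ n - 1) / real n ^ 3 \<le> 1/2"
    and "n = 5 \<Longrightarrow> 12 * ((4/3::real) ^ n - 1) / real n ^ 3 \<le> 8/25"
proof -
  note n = interval_4_24_cases[OF assms]
  show "12 * ((4/3::real) ^ n - 1) / real n ^ 3 \<le> 9/10"
    using n by (elim insertE emptyE; simp add: power_divide)
  show "12 * ((4/3::real) ^ n - 1) / real n ^ 3 \<le> 1/2" if "n \<le> 13"
    using n that by (elim insertE emptyE; simp add: power_divide)
  show "12 * ((4/3::real) ^ n - 1) / real n ^ 3 \<le> 8/25" if "n = 5"
    using that by (simp add: power_divide)
qed

text \<open>The degrees in which the comparison with powers of 4 in \<open>volume_inequality\<close>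
  fails. Degree 5 with s = 2 forces 7/4; there 3/2 would give only about 0.64.\<close>

lemma volume_inequality_small:
  fixes n s :: nat
  assumes "n \<in> {4, 5, 6, 7, 8, 9, 10}" "s \<in> {1, 2, 3, 4}" "2 * s < n"
  shows "1 \<le> ((if n = 5 then 7/4 else 3/2 :: real) * real n / 4) ^ (n - s) * (real n / (8 * real s)) ^ s"
  using assms by (elim insertE emptyE; simp add: power_divide)

text \<open>The volume condition of Minkowski's theorem with \<beta> = n h / (8 s) inserted and h
  cancelled; \<open>s < k\<close> expresses that there is a real embedding.\<close>

lemma volume_inequality:
  fixes A :: real
  assumes n: "n = k + s" "s < k" "s \<ge> 1" "4 \<le> n"
    and A: "A = (if n = 5 then 7/4 else if n \<le> 13 then 3/2 else 6/5)"
  shows "1 \<le> (A * real n / 4) ^ k * (real n / (8 * real s)) ^ s"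
proof (cases "n \<le> 10")
  case True
  then have "n \<in> {4, 5, 6, 7, 8, 9, 10}" using n(4) by (simp only: insert_iff empty_iff) presburger
  moreover have "s \<in> {1, 2, 3, 4}" using n True by (simp only: insert_iff empty_iff) presburger
  moreover have "2 * s < n" using n by simp
  ultimately have *: "1 \<le> ((if n = 5 then 7/4 else 3/2 :: real) * real n / 4) ^ (n - s) * (real n / (8 * real s)) ^ s"
    by (rule volume_inequality_small)
  have "A = (if n = 5 then 7/4 else 3/2)" "k = n - s" using A True n(1) by simp_all
  then show ?thesis using * by (simp only:)
next
  case False
  \<comment> \<open>This is why \<open>A\<close> changes after degree 13:
    \<open>A * real n / 4\<close> is 33/8 at n = 11 with 3/2 and 21/5 at n = 14 with 6/5, whereas
    6/5 would give only 3.9 at n = 13.\<close>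
  have big: "4 \<le> A * real n / 4" using False A by (auto simp: field_simps)
  have "real s \<le> real n / 2" using n by simp
  then have small: "1/4 \<le> real n / (8 * real s)" using n by (simp add: field_simps)
  have "(1::real) \<le> 4 ^ (k - s)" by simp
  also have "\<dots> = 4 ^ k * (1/4) ^ s"
    using n by (simp add: power_diff power_divide)
  also have "\<dots> \<le> (A * real n / 4) ^ k * (real n / (8 * real s)) ^ s"
    using big small by (intro mult_mono power_mono) auto
  finally show ?thesis .
qed

text \<open>With \<open>h ^ n = 1 / M\<^sup>2\<close>, the hypothesis \<open>star\<close> says that the minimum \<open>M\<close> exceeds the
  claimed bound, and \<open>red\<close> is the covering estimate for \<open>M\<close>. For \<open>n \<le> 24\<close> the two contradict each other
  if \<open>r = 0\<close>, and otherwise force \<open>n * h\<close> to be small, which makes room for \<open>A\<close> between 1 and 2.\<close>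

lemma chebotarev_parameters:
  fixes d h :: real
  assumes n: "n = r + 2 * s" "k = r + s" "4 \<le> n" and d: "d \<ge> 1" and h: "h > 0"
    and star: "d * (real n / 4) ^ k * h ^ k < 4 ^ s"
    and red: "1 \<le> ((\<Sum>i<n. (4/3) ^ i) / (4 * (real n)\<^sup>2) * h) ^ n * d\<^sup>2"
  obtains A \<beta> A' where "A > 0" "\<beta> > 0" "d * h ^ n < A ^ k * \<beta> ^ s * 4 ^ s" "8 * real s * \<beta> \<le> real n * h"
    "A \<le> A'" "s > 0 \<Longrightarrow> A + \<beta> \<le> A'" "A' \<le> 1 \<or> real n * h \<le> A' * (2 - A')"
proof -
  have npos: "real n > 0" using n by simp
  have nks: "n = k + s" using n by simp
  \<comment> \<open>Since n = k + s, the factor d h^k of d h^n is bounded by \<open>star\<close>;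
    what remains of the volume condition no longer involves d.\<close>
  have vol: "d * h ^ n < A ^ k * \<beta> ^ s * 4 ^ s" if "(4 / real n) ^ k * h ^ s \<le> A ^ k * \<beta> ^ s" for A \<beta> :: real
  proof -
    have "d * h ^ n = (d * (real n / 4) ^ k * h ^ k) * ((4 / real n) ^ k * h ^ s)"
      using npos by (simp add: nks power_add flip: power_mult_distrib)
    also have "\<dots> < 4 ^ s * ((4 / real n) ^ k * h ^ s)"
      using star npos h by (intro mult_strict_right_mono) auto
    also have "\<dots> \<le> 4 ^ s * (A ^ k * \<beta> ^ s)" using that by (intro mult_left_mono) auto
    finally show ?thesis by (simp add: mult_ac)
  qed
  consider "s = 0" | "n \<ge> 25" "s > 0" | "n \<le> 24" "s > 0" by linarith
  then show ?thesis
  proof cases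
    case 1
    \<comment> \<open>Totally real: there are no imaginary parts, and A = 1 suffices.\<close>
    have "(4 / real n) ^ k \<le> 1" using n by (intro power_le_one) (auto simp: divide_le_eq)
    then show ?thesis using 1 h vol[of 1 1] by (intro that[of 1 1 1]) (auto intro!: vol)
  next
    case 2
    \<comment> \<open>Here \<open>star\<close> alone gives h \<le> 1. The factorisation 4/25 = 4/5 *
      1/5 then suggests A = 4/5 and \<beta> = h / 5, with A + \<beta> \<le> 1.\<close>
    have "(real n / 4 * h) ^ k = 1 * ((real n / 4) ^ k * h ^ k)" by (simp only: power_mult_distrib mult_1_left)
    also have "\<dots> \<le> d * ((real n / 4) ^ k * h ^ k)" using d h by (intro mult_right_mono) auto
    also have "\<dots> = d * (real n / 4) ^ k * h ^ k" by (simp only: mult.assoc)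
    also have "\<dots> < 4 ^ s" by (rule star)
    also have "\<dots> \<le> (4::real) ^ k" using n by (intro power_increasing) auto
    finally have "real n / 4 * h < 4" by (rule power_less_imp_less_base) simp
    moreover have "25 / 4 * h \<le> real n / 4 * h" using 2 h by (intro mult_right_mono) auto
    ultimately have h1: "h \<le> 1" by linarith
    have "(4 / real n) ^ k \<le> (4/25) ^ k" using 2 by (intro power_mono divide_left_mono) auto
    also have "\<dots> = (4/5) ^ k * (1/5) ^ k" by (simp flip: power_mult_distrib)
    also have "\<dots> \<le> (4/5) ^ k * (1/5) ^ s"
      using n by (intro mult_left_mono power_decreasing) auto
    finally have "(4 / real n) ^ k * h ^ s \<le> (4/5) ^ k * (1/5) ^ s * h ^ s"
      using h by (intro mult_right_mono) auto
    then have "(4 / real n) ^ k * h ^ s \<le> (4/5) ^ k * (h / 5) ^ s"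
      by (simp add: mult.assoc flip: power_mult_distrib)
    moreover have "8 * real s * (h / 5) \<le> real n * h"
    proof -
      have "8 / 5 * real s \<le> real n" using n by simp
      then have "8 / 5 * real s * h \<le> real n * h" using h by (intro mult_right_mono) auto
      then show ?thesis by simp
    qed
    ultimately show ?thesis using h h1 by (intro that[of "4/5" "h / 5" 1] vol) auto
  next
    case 3
    define \<kappa> where "\<kappa> = (\<Sum>i<n. (4/3::real) ^ i) / (4 * (real n)\<^sup>2)"
    have S: "(\<Sum>i<n. (4/3::real) ^ i) > 0" using n(3) by (intro sum_pos2[of _ 0]) auto
    have \<kappa>: "\<kappa> > 0" using S npos by (simp add: \<kappa>_def)
    have t: "16 * \<kappa> / real n = 12 * ((4/3::real) ^ n - 1) / real n ^ 3"
    proof -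
      have aux: "16 * (3 * q / (4 * y\<^sup>2)) / y = 12 * q / y ^ 3" if "y \<noteq> 0" for q y :: real
        using that by (simp add: field_simps power2_eq_square power3_eq_cube)
      show ?thesis unfolding \<kappa>_def sum_four_thirds by (rule aux) (use npos in simp)
    qed
    note bounds = four_thirds_bounds[OF n(3) \<open>n \<le> 24\<close>, folded t]
    \<comment> \<open>Combining the square of \<open>star\<close> with \<open>red\<close> eliminates
      d. As 2 k = n + r, the powers of h reduce to the r-th, and the remaining 2 s factors are
      \<open>16 * \<kappa> / real n\<close>, at most 1.\<close>
    have main: "(real n * h / 4) ^ r < (4 * \<kappa> / real n) ^ r"
    proof -
      have "(real n * h / 4) ^ (n + r) \<le> (\<kappa> * h) ^ n * d\<^sup>2 * (real n * h / 4) ^ (n + r)"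
        using mult_right_mono[OF red, of "(real n * h / 4) ^ (n + r)"] h by (simp add: \<kappa>_def)
      also have "(real n * h / 4) ^ (n + r) = ((real n / 4) ^ k * h ^ k)\<^sup>2"
      proof -
        have "n + r = k * 2" using n by simp
        then show ?thesis by (simp add: power_mult flip: power_mult_distrib)
      qed
      also have "(\<kappa> * h) ^ n * d\<^sup>2 * ((real n / 4) ^ k * h ^ k)\<^sup>2 = (\<kappa> * h) ^ n * (d * (real n / 4) ^ k * h ^ k)\<^sup>2"
        by (simp add: power_mult_distrib mult_ac)
      also have "\<dots> < (\<kappa> * h) ^ n * (4 ^ s)\<^sup>2"
        using star d h \<kappa> by (intro mult_strict_left_mono power_strict_mono) auto
      also have "(4 ^ s)\<^sup>2 = (16::real) ^ s" by (simp flip: power_mult_distrib add: power2_eq_square)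
      finally have "((real n / 4) ^ k * h ^ k)\<^sup>2 < (\<kappa> * h) ^ n * 16 ^ s" .
      moreover have "((real n / 4) ^ k * h ^ k)\<^sup>2 = (real n * h / 4) ^ r * (real n / 4) ^ n * h ^ n"
      proof -
        have "((real n / 4) ^ k * h ^ k)\<^sup>2 = (real n * h / 4) ^ (k * 2)"
          by (simp add: power_mult flip: power_mult_distrib)
        also have "k * 2 = r + n" using n by simp
        finally show ?thesis by (simp add: power_add mult.assoc flip: power_mult_distrib)
      qed
      ultimately have "((real n * h / 4) ^ r * (real n / 4) ^ n) * h ^ n < (\<kappa> ^ n * 16 ^ s) * h ^ n"
        by (simp add: power_mult_distrib mult_ac)
      then have "(real n * h / 4) ^ r * (real n / 4) ^ n < \<kappa> ^ n * 16 ^ s" using h by simp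
      then have "(real n * h / 4) ^ r < \<kappa> ^ n * 16 ^ s / (real n / 4) ^ n"
        using npos by (subst pos_less_divide_eq) auto
      also have "\<dots> = (4 * \<kappa> / real n) ^ n * 16 ^ s"
        by (simp add: power_divide power_mult_distrib mult_ac)
      also have "\<dots> = (4 * \<kappa> / real n) ^ r * ((4 * \<kappa> / real n)\<^sup>2 * 16) ^ s"
        unfolding n(1) by (simp add: power_add power_mult power_mult_distrib)
      also have "(4 * \<kappa> / real n)\<^sup>2 * 16 = (16 * \<kappa> / real n)\<^sup>2" by (simp add: power2_eq_square)
      also have "(4 * \<kappa> / real n) ^ r * ((16 * \<kappa> / real n)\<^sup>2) ^ s \<le> (4 * \<kappa> / real n) ^ r * 1"
      proof (rule mult_left_mono)
        have "0 \<le> 16 * \<kappa> / real n" "16 * \<kappa> / real n \<le> 1" using bounds(1) \<kappa> by (simp, linarith)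
        then show "((16 * \<kappa> / real n)\<^sup>2) ^ s \<le> 1" by (intro power_le_one zero_le_power)
      qed (use \<kappa> in simp)
      finally show ?thesis by simp
    qed
    \<comment> \<open>For r = 0 the inequality \<open>main\<close> would read 1 < 1: no totally
      complex field is left.\<close>
    then have r: "r > 0" by (cases r) auto
    have "real n * h / 4 < 4 * \<kappa> / real n"
      using main by (rule power_less_imp_less_base) (use \<kappa> in auto)
    then have nh: "real n * h < 16 * \<kappa> / real n" by simp
    define A :: real where "A = (if n = 5 then 7/4 else if n \<le> 13 then 3/2 else 6/5)"
    \<comment> \<open>The largest \<beta> that the budget n h for the imaginary parts
      allows.\<close>
    define \<beta> where "\<beta> = real n * h / (8 * real s)"
    have A: "A > 0" by (simp add: A_def)
    have \<beta>: "\<beta> > 0" using h npos 3 by (simp add: \<beta>_def)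
    have \<beta>8: "\<beta> \<le> real n * h / 8" using h npos 3 by (simp add: \<beta>_def field_simps)
    have "1 \<le> (A * real n / 4) ^ k * (real n / (8 * real s)) ^ s"
      using n 3 r nks by (intro volume_inequality) (auto simp: A_def)
    then have "(4 / real n) ^ k * h ^ s * 1
      \<le> (4 / real n) ^ k * h ^ s * ((A * real n / 4) ^ k * (real n / (8 * real s)) ^ s)"
      using h npos by (intro mult_left_mono) auto
    also have "\<dots> = (4 / real n * (A * real n / 4)) ^ k * (h * (real n / (8 * real s))) ^ s"
      by (simp only: power_mult_distrib mult_ac)
    also have "\<dots> = A ^ k * \<beta> ^ s" using npos by (simp add: \<beta>_def mult.commute)
    finally have V: "d * h ^ n < A ^ k * \<beta> ^ s * 4 ^ s" by (intro vol) simp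
    have cond: "real n * h \<le> (A + \<beta>) * (2 - (A + \<beta>))"
    proof -
      consider "n = 5" | "n \<noteq> 5" "n \<le> 13" | "n > 13" by linarith
      \<comment> \<open>\<open>T\<close> bounds n h, so \<open>B + T / 8\<close> bounds A + \<beta>,
        as s \<ge> 1. In the last case the inequality is nearly sharp: about 0.902 against
        9/10.\<close>
      then obtain B T :: real where BT: "A = B" "real n * h \<le> T" "1 \<le> B" "T \<le> (B + T / 8) * (2 - (B + T / 8))"
      proof cases
        assume "n = 5"
        then show ?thesis using nh bounds(3) by (intro that[of "7/4" "8/25"]) (auto simp: A_def)
      next
        assume "n \<noteq> 5" "n \<le> 13"
        then show ?thesis using nh bounds(2) by (intro that[of "3/2" "1/2"]) (auto simp: A_def)
      next
        assume "n > 13"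
        then show ?thesis using nh bounds(1) by (intro that[of "6/5" "9/10"]) (auto simp: A_def)
      qed
      have le: "A + \<beta> \<le> B + T / 8" using BT(1,2) \<beta>8 by linarith
      have "0 \<le> (B + T / 8 - (A + \<beta>)) * (B + T / 8 + (A + \<beta>) - 2)"
        using le BT(1,3) \<beta> by (intro mult_nonneg_nonneg) linarith+
      moreover have "u * (2 - u) \<le> v * (2 - v)" if "0 \<le> (u - v) * (u + v - 2)" for u v :: real
        using that by (simp add: algebra_simps)
      ultimately have "(B + T / 8) * (2 - (B + T / 8)) \<le> (A + \<beta>) * (2 - (A + \<beta>))" by blast
      then show ?thesis using BT by linarith
    qed
    show ?thesis
      using A \<beta> V cond 3 by (intro that[of A \<beta> "A + \<beta>"]) (auto simp: \<beta>_def)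
  qed
qed

text \<open>The power 2 (r + s) clears the square root and both fractional exponents at
  once.\<close>

lemma bound_power:
  fixes d :: real
  assumes "n > 0" "r + s > 0" "d > 0"
  shows "(2 powr (- (real s * real n) / (real r + real s)) * (1 / 2 * sqrt (real n)) ^ n *
           d powr (real n / (2 * (real r + real s)))) ^ (2 * (r + s))
    = (d * (real n / 4) ^ (r + s) / 4 ^ s) ^ n"
proof -
  define k where "k = r + s"
  have k: "real k > 0" "real r + real s = real k" using assms(2) by (auto simp: k_def)
  have "(2 powr (- (real s * real n) / real k)) ^ (2 * k) = (2::real) powr (- (real s * real n) / real k * (2 * real k))"
    by (simp add: powr_powr flip: powr_realpow)
  also have "- (real s * real n) / real k * (2 * real k) = - real (2 * s * n)" using k by simp
  also have "(2::real) powr (- real (2 * s * n)) = 1 / (4 ^ s) ^ n"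
  proof -
    have "(2::real) powr (- real (2 * s * n)) = 1 / 2 ^ (2 * s * n)"
      by (subst powr_minus, subst powr_realpow) (simp_all add: divide_inverse)
    then show ?thesis by (simp add: power_mult)
  qed
  finally have 1: "(2 powr (- (real s * real n) / real k)) ^ (2 * k) = 1 / ((4::real) ^ s) ^ n" .
  have "((1 / 2 * sqrt (real n)) ^ n) ^ (2 * k) = (((1 / 2 * sqrt (real n))\<^sup>2) ^ k) ^ n"
    by (simp only: mult.commute mult.left_commute flip: power_mult)
  also have "(1 / 2 * sqrt (real n))\<^sup>2 = real n / 4" by (simp add: power_mult_distrib power2_eq_square)
  finally have 2: "((1 / 2 * sqrt (real n)) ^ n) ^ (2 * k) = ((real n / 4) ^ k) ^ n" .
  have "(d powr (real n / (2 * real k))) ^ (2 * k) = d powr (real n / (2 * real k) * (2 * real k))"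
    using assms(3) by (simp add: powr_powr flip: powr_realpow)
  also have "\<dots> = d ^ n" using k assms(3) by (simp add: powr_realpow)
  finally have 3: "(d powr (real n / (2 * real k))) ^ (2 * k) = d ^ n" .
  have distrib: "(a * b * c) ^ (2 * k) = a ^ (2 * k) * b ^ (2 * k) * c ^ (2 * k)" for a b c :: real
    by (simp only: power_mult_distrib)
  show ?thesis
    unfolding k(2) k_def[symmetric] distrib 1 2 3 by (simp add: power_mult_distrib power_divide mult.commute)
qed

section \<open>The bound for a single residue class\<close>

context primitive_number_field
begin

theorem nm_minimum_bound:
  assumes sig: "has_signature TYPE('k) r s" and n4: "n \<ge> 4"
  shows "\<exists>c\<in>ring_of_integers. nm (x - c) \<le>
    2 powr (- (real s * real n) / (real r + real s)) * (1 / 2 * sqrt (real n)) ^ n *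
    disc powr (real n / (2 * (real r + real s)))" (is "\<exists>c\<in>_. _ \<le> ?B")
proof -
  obtain c0 where c0: "c0 \<in> ring_of_integers" "\<And>c. c \<in> ring_of_integers \<Longrightarrow> nm (x - c0) \<le> nm (x - c)"
    using nm_minimum_exists by blast
  define M where "M = nm (x - c0)"
  have nrs: "n = r + 2 * s" by (rule signature_cards(4)[OF sig])
  have rs: "r + s > 0" using nrs n4 by linarith
  have B0: "?B \<ge> 0" by simp
  have "M \<le> ?B"
  proof (rule ccontr)
    assume "\<not> M \<le> ?B"
    then have MB: "M > ?B" by simp
    then have M0: "M > 0" using B0 by linarith
    define h where "h = root n (1 / M\<^sup>2)"
    have h: "h > 0" "M\<^sup>2 * h ^ n = 1"
      using n_pos M0 by (auto simp: h_def real_root_pow_pos2 real_root_gt_zero)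
    let ?k = "r + s"
    have "(disc * (real n / 4) ^ ?k / 4 ^ s) ^ n < M ^ (2 * ?k)"
      using bound_power[OF n_pos rs, of disc] disc_ge_1 power_strict_mono[OF MB B0, of "2 * ?k"] rs by simp
    \<comment> \<open>This power of h turns the right-hand side into 1 and the left-hand side into
      an n-th power, so that the n-th root can be taken.\<close>
    then have "(disc * (real n / 4) ^ ?k / 4 ^ s) ^ n * (h ^ ?k) ^ n < M ^ (2 * ?k) * (h ^ ?k) ^ n"
      using h(1) by (intro mult_strict_right_mono) auto
    also have "M ^ (2 * ?k) * (h ^ ?k) ^ n = (M\<^sup>2 * h ^ n) ^ ?k"
      by (simp add: power_mult_distrib mult.commute flip: power_mult)
    also have "\<dots> = 1" by (simp add: h(2))
    finally have "(disc * (real n / 4) ^ ?k / 4 ^ s * h ^ ?k) ^ n < 1 ^ n"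
      by (simp only: power_mult_distrib power_one)
    then have "disc * (real n / 4) ^ ?k / 4 ^ s * h ^ ?k < 1"
      by (rule power_less_imp_less_base) simp
    then have star: "disc * (real n / 4) ^ ?k * h ^ ?k < 4 ^ s" by (simp add: field_simps)
    obtain c where c: "c \<in> ring_of_integers"
      "(nm (x - c))\<^sup>2 \<le> ((\<Sum>i<n. (4/3) ^ i) / (4 * (real n)\<^sup>2)) ^ n * disc\<^sup>2"
      using covering_norm_bound by blast
    \<comment> \<open>Minimality carries the covering estimate over to \<open>c0\<close>, although
      the close integer \<open>c\<close> may be a different one.\<close>
    have "M\<^sup>2 \<le> (nm (x - c))\<^sup>2" using c0(2)[OF c(1)] M0 by (intro power_mono) (auto simp: M_def)
    then have "M\<^sup>2 * h ^ n \<le> (((\<Sum>i<n. (4/3) ^ i) / (4 * (real n)\<^sup>2)) ^ n * disc\<^sup>2) * h ^ n"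
      using c(2) h(1) by (intro mult_right_mono) auto
    then have red: "1 \<le> ((\<Sum>i<n. (4/3) ^ i) / (4 * (real n)\<^sup>2) * h) ^ n * disc\<^sup>2"
      unfolding h(2) power_mult_distrib[of _ h] by (simp only: mult_ac)
    obtain A \<beta> A' where *: "A > 0" "\<beta> > 0" "disc * h ^ n < A ^ ?k * \<beta> ^ s * 4 ^ s"
      "8 * real s * \<beta> \<le> real n * h" "A \<le> A'" "s > 0 \<Longrightarrow> A + \<beta> \<le> A'"
      "A' \<le> 1 \<or> real n * h \<le> A' * (2 - A')"
      using chebotarev_parameters[OF nrs refl n4 disc_ge_1 h(1) star red] by blast
    show False
      by (rule chebotarev_contradiction[OF sig c0 h(1) h(2)[unfolded M_def] *])
  qed
  then show ?thesis using c0(1) by (auto simp: M_def)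
qed

end

theorem mainTheorem1:
  fixes r s n :: nat and d :: real
  assumes "number_field TYPE('k::field_char_0)"
    and "has_signature TYPE('k) r s"
    and "n = field_degree TYPE('k)"
    and "n \<ge> 4"
    and "d = \<bar>real_of_rat (field_discriminant TYPE('k))\<bar>"
  shows "euclidean_minimum TYPE('k) \<le>
    ereal (2 powr (- (real s * real n) / (real r + real s)) * (1 / 2 * sqrt (real n)) ^ n *
           d powr (real n / (2 * (real r + real s))))"
proof -
  obtain \<gamma> :: 'k where \<gamma>: "adjoin \<gamma> = UNIV" using primitive_element[OF assms(1)] .
  obtain p where p: "is_min_poly p \<gamma>"
    using number_field_algebraic[OF assms(1), of \<gamma>] is_min_poly_exists by blast
  interpret primitive_number_field \<gamma> p by standard (fact \<gamma> p)+
  have n: "n = degree p" and d: "d = disc"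
    using assms(3,5) field_degree_eq abs_discriminant_eq_disc by auto
  show ?thesis
    unfolding euclidean_minimum_def
  proof (rule SUP_least)
    fix x :: 'k
    obtain c where c: "c \<in> ring_of_integers" "nm (x - c) \<le>
      2 powr (- (real s * real n) / (real r + real s)) * (1 / 2 * sqrt (real n)) ^ n *
      d powr (real n / (2 * (real r + real s)))"
      using nm_minimum_bound[OF assms(2), of x] assms(4) unfolding n d by blast
    then show "(INF c\<in>ring_of_integers. ereal (real_of_rat (abs_norm (x - c)))) \<le>
      ereal (2 powr (- (real s * real n) / (real r + real s)) * (1 / 2 * sqrt (real n)) ^ n *
        d powr (real n / (2 * (real r + real s))))"
      by (intro INF_lower2[OF c(1)]) (simp add: nm_def)
  qed
qed

end
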